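(* Let $\mu,\nu\in\mathcal P(\mathbb R)$ with $\mu\le_{\rm cx}\nu$ and $\nu$ atomless. Then $\mathcal M_M(\mu,\nu)$ is weakly dense in $\mathcal M(\mu,\nu)$. If $\mu$ is discrete, then $\mathcal M_M(\mu,\nu)$ is also dense in $\mathcal M(\mu,\nu)$ for the $\infty$-Wasserstein topology.
   Context: $\mathcal P(\mathbb R)$ is the set of Borel probability measures on $\mathbb R$ with finite first moment. $\mu\le_{\rm cx}\nu$ means $\int\phi\,d\mu\le\int\phi\,d\nu$ for every convex $\phi:\mathbb R\to\mathbb R$. $\mathcal M(\mu,\nu)$ is the set of martingale transports: laws $\pi$ on $\mathbb R^2$ of random vectors $(X,Y)$ with $X\sim\mu$, $Y\sim\nu$, $\mathbb E[Y|X]=X$ a.s. $\mathcal M_M(\mu,\nu)$ is the subset of those $\pi$ of the form $\pi=(f,\mathrm{id}_{\mathbb R})_{\#}\nu$ for some Borel $f:\mathbb R\to\mathbb R$ (i.e. $X=f(Y)$ a.s.). Weak density refers to the topology of weak convergence of probability measures on $\mathbb R^2$. The $\infty$-Wasserstein distance $W_\infty(\pi,\pi')$ on $\mathbb R^2$ (Euclidean metric) is the infimum over couplings of $\pi,\pi'$ of the essential supremum of the distance; density for it means that for every $\pi\in\mathcal M(\mu,\nu)$ and $\varepsilon>0$ there is $\pi_\varepsilon\in\mathcal M_M(\mu,\nu)$ with $W_\infty(\pi,\pi_\varepsilon)\le\varepsilon$. A measure is discrete if it is a countable sum of point masses. *)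

theory Defs
  imports "HOL-Probability.Probability"
begin

definition finite_moment_measures :: "real measure set" where
  "finite_moment_measures =
     {\<mu>. prob_space \<mu> \<and> sets \<mu> = sets borel \<and> integrable \<mu> (\<lambda>x. x)}"

(* Integral with values in the extended reals. A convex function is bounded below by an
   affine one, so for a measure with finite first moment the subtracted term is finite and
   the integral of a convex function is well defined, possibly equal to +infinity
   (where the Bochner integral would be 0). *)
definition ext_integral :: "'a measure \<Rightarrow> ('a \<Rightarrow> real) \<Rightarrow> ereal" where
  "ext_integral M f =
     enn2ereal (\<integral>\<^sup>+ x. ennreal (f x) \<partial>M) - enn2ereal (\<integral>\<^sup>+ x. ennreal (- f x) \<partial>M)"

definition convex_order :: "real measure \<Rightarrow> real measure \<Rightarrow> bool" (infix "\<le>cx" 50) where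
  "\<mu> \<le>cx \<nu> \<longleftrightarrow> (\<forall>\<phi>. convex_on UNIV \<phi> \<longrightarrow> ext_integral \<mu> \<phi> \<le> ext_integral \<nu> \<phi>)"

definition atomless :: "real measure \<Rightarrow> bool" where
  "atomless \<nu> \<longleftrightarrow> (\<forall>x. emeasure \<nu> {x} = 0)"

(* The weights a n may vanish, so finite sums are included. *)
definition discrete_measure :: "real measure \<Rightarrow> bool" where
  "discrete_measure \<mu> \<longleftrightarrow>
     (\<exists>(x :: nat \<Rightarrow> real) (a :: nat \<Rightarrow> ennreal). \<forall>B \<in> sets borel.
        emeasure \<mu> B = (\<Sum>n. a n * emeasure (return borel (x n)) B))"

definition borel_probs :: "'a::topological_space measure set" where
  "borel_probs = {\<pi>. prob_space \<pi> \<and> sets \<pi> = sets borel}"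

(* The pair (X, Y) is realised as (fst, snd) on the plane equipped with its law;
   the conditional expectation is taken with respect to the sigma-algebra generated by fst. *)
definition martingale_transports :: "real measure \<Rightarrow> real measure \<Rightarrow> (real \<times> real) measure set"
  where
  "martingale_transports \<mu> \<nu> =
     {\<pi> \<in> borel_probs. distr \<pi> borel fst = \<mu> \<and> distr \<pi> borel snd = \<nu> \<and>
        (AE z in \<pi>. real_cond_exp \<pi> (vimage_algebra (space \<pi>) fst borel) snd z = fst z)}"

definition backward_Monge_martingale_transports ::
    "real measure \<Rightarrow> real measure \<Rightarrow> (real \<times> real) measure set" where
  "backward_Monge_martingale_transports \<mu> \<nu> =
     {\<pi> \<in> martingale_transports \<mu> \<nu>.
        \<exists>f \<in> borel_measurable borel. \<pi> = distr \<nu> borel (\<lambda>y. (f y, y))}"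

(* The coarsest topology on Borel probability measures making every map
   \<pi> \<mapsto> integral of \<phi>, with \<phi> bounded and continuous, continuous. *)
definition weak_topology :: "'a::topological_space measure topology" where
  "weak_topology = topology_generated_by
     {{\<pi> \<in> borel_probs. (\<integral>z. \<phi> z \<partial>\<pi>) \<in> U} | (\<phi> :: 'a \<Rightarrow> real) U.
        continuous_on UNIV \<phi> \<and> bounded (range \<phi>) \<and> open U}"

definition couplings ::
    "'a::topological_space measure \<Rightarrow> 'a measure \<Rightarrow> ('a \<times> 'a) measure set" where
  "couplings \<pi> \<pi>' = {\<gamma> \<in> borel_probs. distr \<gamma> borel fst = \<pi> \<and> distr \<gamma> borel snd = \<pi>'}"

definition Wasserstein_infty ::
    "'a::metric_space measure \<Rightarrow> 'a measure \<Rightarrow> ereal" where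
  "Wasserstein_infty \<pi> \<pi>' =
     (INF \<gamma> \<in> couplings \<pi> \<pi>'. esssup \<gamma> (\<lambda>(z, z'). ereal (dist z z')))"

end

theory Submission
  imports Defs
begin

text \<open>
  The potential \<open>t \<mapsto> \<integral>\<bar>y - t\<bar> d\<beta>\<close> encodes the convex order, mass and first moment being fixed.
  An atom below an atomless \<open>\<beta>\<close> can be embedded as an interval of \<open>\<beta>\<close> with the right mass and
  barycentre, and whatever else is dominated by \<open>\<beta>\<close> remains dominated by the rest; hence a sequence
  of atoms can be embedded as disjoint sets. If \<open>\<alpha>\<close> is below \<open>\<beta>\<close>, spread \<open>\<alpha>\<close> out to atoms wherever the
  potentials differ: each atom then occupies a set \<open>S\<close> of \<open>\<beta>\<close>, and \<open>\<alpha> = \<beta>\<close> on what remains.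
  On \<open>S\<close> there is an atomless function \<open>F\<close> of \<open>Y\<close> with \<open>E[Y | F]\<close> constant, so that any
  distribution of \<open>X\<close> given the atom is realised by a function of \<open>F\<close>.

  To approximate a given \<open>\<pi>\<close>, cut the line into countably many small cells \<open>J i\<close> and decompose the part
  of \<open>\<pi>\<close> with \<open>X \<in> J i\<close> in this way, for each \<open>i\<close>. In each cell of the \<open>Y\<close> axis, the
  contributions of all the atoms to that cell are again replaced by disjoint sets with the same masses and
  barycentres. Only the contact part of \<open>J i\<close> remains in the cell \<open>J i\<close>, and it is dominated
  by the rest of \<open>\<nu>\<close> there, so a backward map within the cell completes the
  construction. The resulting transport gives every product cell the same mass as \<open>\<pi>\<close>; this bounds the
  \<open>\<infinity>\<close>-Wasserstein distance by the diameter of the cells, whether or not \<open>\<mu>\<close> is discrete.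
\<close>

section \<open>Measures on the line with finite first moment, and their potentials\<close>

text \<open>The obstacle is that the martingale property conditions on X only: cutting a coupling
  into product cells \<open>J i\<close> times \<open>J j\<close> destroys it, so a backward map
  cannot be sought cell by cell. What survives the cut is linear data. Once X has been spread to
  atoms, a set assigned to an atom enters only through its mass and its barycentre (see
  \<open>pieces\<close>), and any law of X on that set is then available from
  \<open>fiber_map\<close>. Mass and moment are additive over the cells of the Y axis, so each set
  may be exchanged, cell by cell, for another one with the same two numbers there. X stays in its
  slice, since the kernel of an atom lives on the slice the atom came from. Points where the
  potentials touch cannot be spread, because spreading raises the potential. There, however, what is
  left of the slice is \<mu> itself, hence lies in the diagonal cell. In that cell the room needed
  for it exists because collapsing the competing contributions to their barycentres lowers their
  potentials. A possibly different map then serves the contact part, but mass and moment still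
  balance within the cell.\<close>

context finite_borel_measure
begin

lemmas sets_eq [simp, measurable_cong] = M_is_borel
lemmas space_eq [simp] = borel_UNIV

lemma measurable_M [simp]: "measurable M N = measurable borel N"
  by (rule measurable_cong_sets) simp_all

end

text \<open>Finite mass instead of mass one: the arguments act on parts of \<mu>, \<nu> and \<pi>,
  which are never normalised.\<close>

locale first_moment_measure = finite_borel_measure M for M +
  assumes integrable_id: "integrable M (\<lambda>x. x)"
begin

lemma integrable_abs_diff [simp, intro]: "integrable M (\<lambda>y. \<bar>y - t\<bar>)"
  using integrable_id by simp

lemma integrable_diff_const [simp, intro]: "integrable M (\<lambda>y. y - t)"
  using integrable_id by simp

lemma integrable_linear_growth:
  fixes f :: "real \<Rightarrow> real"
  assumes "f \<in> borel_measurable borel" and "\<And>y. \<bar>f y\<bar> \<le> C + D * \<bar>y\<bar>"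
  shows "integrable M f"
proof (rule Bochner_Integration.integrable_bound)
  show "integrable M (\<lambda>y. C + D * \<bar>y\<bar>)" using integrable_id by simp
  show "f \<in> borel_measurable M" using assms(1) by simp
  show "AE y in M. norm (f y) \<le> norm (C + D * \<bar>y\<bar>)"
    using assms(2) by (auto intro!: AE_I2 order_trans[OF assms(2)])
qed

lemma integrable_indicator_mult [intro]:
  fixes f :: "real \<Rightarrow> real"
  assumes "integrable M f" "S \<in> sets borel"
  shows "integrable M (\<lambda>y. indicator S y * f y)"
  using integrable_real_mult_indicator[of S M f] assms by (simp add: mult.commute)

end

abbreviation mass :: "real measure \<Rightarrow> real" where "mass M \<equiv> measure M UNIV"

abbreviation moment :: "real measure \<Rightarrow> real" where "moment M \<equiv> (\<integral>y. y \<partial>M)"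

definition pot :: "real measure \<Rightarrow> real \<Rightarrow> real" where
  "pot M t = (\<integral>y. \<bar>y - t\<bar> \<partial>M)"

text \<open>A density and not \<open>restrict_space\<close>, so that the space remains the whole
  line and parts can be compared by their potentials.\<close>

definition restr :: "real measure \<Rightarrow> real set \<Rightarrow> real measure" where
  "restr M S = density M (indicator S)"

context first_moment_measure
begin

lemma integral_affine: "(\<integral>y. y - t \<partial>M) = moment M - t * mass M"
  using integrable_id by (simp add: mult.commute)

lemma pot_nonneg: "0 \<le> pot M t"
  unfolding pot_def by simp

lemma pot_ge: "\<bar>moment M - t * mass M\<bar> \<le> pot M t"
  unfolding pot_def integral_affine[symmetric] by (rule integral_abs_bound)

lemma pot_lipschitz: "pot M s \<le> pot M t + mass M * \<bar>s - t\<bar>"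
proof -
  have "pot M s \<le> (\<integral>y. \<bar>y - t\<bar> + \<bar>s - t\<bar> \<partial>M)"
    unfolding pot_def by (rule integral_mono) auto
  also have "\<dots> = pot M t + mass M * \<bar>s - t\<bar>"
    unfolding pot_def by (subst Bochner_Integration.integral_add) auto
  finally show ?thesis .
qed

lemma continuous_on_pot: "continuous_on A (pot M)"
proof (rule lipschitz_on_continuous_on)
  show "(mass M)-lipschitz_on A (pot M)"
  proof (rule lipschitz_onI)
    show "dist (pot M s) (pot M t) \<le> mass M * dist s t" for s t
      using pot_lipschitz[of s t] pot_lipschitz[of t s]
      by (simp add: dist_real_def abs_le_iff abs_minus_commute)
  qed auto
qed

text \<open>Adding y - t to |y - t| leaves twice the positive part of y - t, which vanishes in the
  limit by dominated convergence. Thus mass and moment fix the asymptotes of the potential, and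
  potentials of measures that share both merge at infinity.\<close>

lemma pot_at_top: "((\<lambda>t. pot M t - (t * mass M - moment M)) \<longlongrightarrow> 0) at_top"
proof -
  have eq: "pot M t - (t * mass M - moment M) = (\<integral>y. 2 * max 0 (y - t) \<partial>M)" for t
  proof -
    have "pot M t - (t * mass M - moment M) = (\<integral>y. \<bar>y - t\<bar> + (y - t) \<partial>M)"
      unfolding pot_def by (subst Bochner_Integration.integral_add) (auto simp: integral_affine)
    also have "\<dots> = (\<integral>y. 2 * max 0 (y - t) \<partial>M)"
      by (rule Bochner_Integration.integral_cong) (auto simp: max_def abs_if)
    finally show ?thesis .
  qed
  have "((\<lambda>t. \<integral>y. 2 * max 0 (y - t) \<partial>M) \<longlongrightarrow> (\<integral>y. 0 \<partial>M)) at_top"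
  proof (rule integral_dominated_convergence_at_top)
    show "AE x in M. ((\<lambda>i. 2 * max 0 (x - i)) \<longlongrightarrow> 0) at_top"
    proof (rule AE_I2)
      fix x :: real
      have "\<forall>\<^sub>F i in at_top. 2 * max 0 (x - i) = 0"
        using eventually_ge_at_top[of x] by eventually_elim auto
      then show "((\<lambda>i. 2 * max 0 (x - i)) \<longlongrightarrow> 0) at_top"
        by (rule tendsto_eventually)
    qed
    show "\<forall>\<^sub>F i in at_top. AE x in M. norm (2 * max 0 (x - i)) \<le> 2 * \<bar>x\<bar>"
      using eventually_ge_at_top[of 0] by eventually_elim (auto simp: max_def)
    show "integrable M (\<lambda>x. 2 * \<bar>x\<bar>)" using integrable_id by simp
  qed auto
  then show ?thesis by (simp add: eq)
qed

lemma first_moment_measure_uminus: "first_moment_measure (distr M borel uminus)"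
proof -
  interpret d: finite_measure "distr M borel uminus"
    by (rule finite_measure_distr) auto
  show ?thesis
    by unfold_locales (auto simp: integrable_distr_eq integrable_id)
qed

lemma pot_uminus: "pot (distr M borel uminus) t = pot M (- t)"
  unfolding pot_def by (subst integral_distr) (auto intro!: Bochner_Integration.integral_cong)

lemma mass_uminus: "mass (distr M borel uminus) = mass M"
  by (subst measure_distr) auto

lemma moment_uminus: "moment (distr M borel uminus) = - moment M"
  by (subst integral_distr) auto

lemma pot_at_bot: "((\<lambda>t. pot M t - (moment M - t * mass M)) \<longlongrightarrow> 0) at_bot"
proof -
  interpret d: first_moment_measure "distr M borel uminus" by (rule first_moment_measure_uminus)
  have "((\<lambda>t. pot M (- t) - (t * mass M + moment M)) \<longlongrightarrow> 0) at_top"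
    using d.pot_at_top unfolding pot_uminus mass_uminus moment_uminus by simp
  then show ?thesis
    unfolding at_bot_mirror filterlim_filtermap by (simp add: algebra_simps)
qed

lemma first_moment_measure_density:
  assumes k: "k \<in> borel_measurable borel" "\<And>x. 0 \<le> k x" "\<And>x. k x \<le> (1::real)"
  shows "first_moment_measure (density M k)"
proof -
  have "emeasure (density M k) UNIV \<le> emeasure M UNIV"
  proof -
    have "(\<integral>\<^sup>+ x. ennreal (k x) \<partial>M) \<le> (\<integral>\<^sup>+ x. 1 \<partial>M)"
      using k by (intro nn_integral_mono) (simp add: ennreal_le_1)
    then show ?thesis using k by (subst emeasure_density) auto
  qed
  then have "emeasure (density M k) UNIV \<noteq> \<infinity>"
    unfolding infinity_ennreal_def by (intro neq_top_trans[OF emeasure_finite[unfolded infinity_ennreal_def]])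
  then interpret d: finite_measure "density M k" by (intro finite_measureI) auto
  have "integrable M (\<lambda>x. k x * x)"
  proof (rule Bochner_Integration.integrable_bound[OF integrable_id])
    show "AE x in M. norm (k x * x) \<le> norm x"
      using k by (auto simp: abs_mult intro!: mult_left_le_one_le)
  qed (use k in auto)
  then have "integrable (density M k) (\<lambda>x. x)"
    using k by (subst integrable_density) auto
  then show ?thesis by unfold_locales auto
qed

lemma integral_density_real:
  fixes f :: "real \<Rightarrow> real"
  assumes "k \<in> borel_measurable borel" "\<And>x. 0 \<le> k x" "f \<in> borel_measurable borel"
  shows "(\<integral>x. f x \<partial>density M k) = (\<integral>x. k x * f x \<partial>M)"
  using assms by (subst integral_density) auto

lemma measure_density_real:
  fixes k :: "real \<Rightarrow> real"
  assumes "k \<in> borel_measurable borel" "\<And>x. 0 \<le> k x" "\<And>x. k x \<le> (1::real)" "B \<in> sets borel"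
  shows "measure (density M k) B = (\<integral>x. indicator B x * k x \<partial>M)"
proof -
  interpret d: first_moment_measure "density M k" using assms by (intro first_moment_measure_density) auto
  have "measure (density M k) B = (\<integral>x. indicator B x \<partial>density M k)"
    using assms by simp
  also have "\<dots> = (\<integral>x. k x * indicator B x \<partial>M)"
    using assms by (intro integral_density_real) auto
  finally show ?thesis by (simp add: mult.commute)
qed

lemma restr_eq: "restr M S = density M (\<lambda>x. ennreal (indicator S x :: real))"
  unfolding restr_def by (simp add: ennreal_indicator)

lemma first_moment_measure_restr: "S \<in> sets borel \<Longrightarrow> first_moment_measure (restr M S)"
  unfolding restr_eq by (intro first_moment_measure_density) auto

lemma integral_restr:
  fixes f :: "real \<Rightarrow> real"
  assumes "S \<in> sets borel" "f \<in> borel_measurable borel"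
  shows "(\<integral>x. f x \<partial>restr M S) = (\<integral>x. indicator S x * f x \<partial>M)"
  unfolding restr_eq using assms by (subst integral_density_real) auto

lemma measure_restr:
  assumes "S \<in> sets borel" "B \<in> sets borel"
  shows "measure (restr M S) B = measure M (S \<inter> B)"
  unfolding restr_eq using assms
  by (subst measure_density_real) (auto simp: indicator_inter_arith[symmetric] Int_commute)

lemma emeasure_restr:
  assumes "S \<in> sets borel" "B \<in> sets borel"
  shows "emeasure (restr M S) B = emeasure M (S \<inter> B)"
  unfolding restr_def using assms
  by (subst emeasure_density) (auto simp: indicator_inter_arith[symmetric])

lemma restr_restr:
  assumes "S \<in> sets borel" "T \<in> sets borel"
  shows "restr (restr M S) T = restr M (S \<inter> T)"
proof -
  interpret S: first_moment_measure "restr M S" using assms by (intro first_moment_measure_restr)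
  interpret ST: first_moment_measure "restr M (S \<inter> T)" using assms by (intro first_moment_measure_restr) auto
  interpret T: first_moment_measure "restr (restr M S) T" using assms by (intro S.first_moment_measure_restr)
  show ?thesis
    using assms by (intro measure_eqI) (auto simp: emeasure_restr S.emeasure_restr Int_assoc)
qed

lemma restr_UNIV: "restr M UNIV = M"
  unfolding restr_def by (simp add: density_1)

end

lemma atomless_measure: "atomless M \<Longrightarrow> measure M {x} = 0"
  unfolding atomless_def by (simp add: measure_def)

lemma (in first_moment_measure) atomless_restr:
  assumes "atomless M" "S \<in> sets borel"
  shows "atomless (restr M S)"
  unfolding atomless_def
proof
  fix x
  have "emeasure M (S \<inter> {x}) \<le> emeasure M {x}" by (intro emeasure_mono) auto
  then show "emeasure (restr M S) {x} = 0" using assms by (simp add: emeasure_restr atomless_def)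
qed

section \<open>Measures determined by their potentials\<close>

lemma finite_borel_measure_eqI:
  assumes "finite_borel_measure M" "finite_borel_measure N"
    and "\<And>x. measure M {x<..} = measure N {x<..}"
  shows "M = N"
proof -
  interpret M: finite_borel_measure M by fact
  interpret N: finite_borel_measure N by fact
  show ?thesis
    by (rule measure_eqI_lessThan)
      (use assms(3) in \<open>auto simp: M.emeasure_eq_measure N.emeasure_eq_measure\<close>)
qed

lemma pot_diff_tendsto:
  assumes "first_moment_measure M" "first_moment_measure N"
    and "mass M = mass N" "moment M = moment N"
  shows "((\<lambda>t. pot M t - pot N t) \<longlongrightarrow> 0) at_top" "((\<lambda>t. pot M t - pot N t) \<longlongrightarrow> 0) at_bot"
proof -
  interpret M: first_moment_measure M by fact
  interpret N: first_moment_measure N by fact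
  show "((\<lambda>t. pot M t - pot N t) \<longlongrightarrow> 0) at_top"
    using tendsto_diff[OF M.pot_at_top N.pot_at_top] assms by simp
  show "((\<lambda>t. pot M t - pot N t) \<longlongrightarrow> 0) at_bot"
    using tendsto_diff[OF M.pot_at_bot N.pot_at_bot] assms by simp
qed

text \<open>The tail \<open>M (x, \<infinity>)\<close> is the limit of difference quotients of
  \<open>t \<mapsto> \<integral>(y - t)\<^sup>+ dM\<close>, which the potential determines together with mass and first moment.\<close>

lemma first_moment_eqI_pot:
  assumes "first_moment_measure M" "first_moment_measure N"
    and mass: "mass M = mass N" and mom: "moment M = moment N" and pot: "\<And>t. pot M t = pot N t"
  shows "M = N"
proof (rule finite_borel_measure_eqI)
  show "finite_borel_measure M" "finite_borel_measure N"
    using assms(1,2) by (auto dest: first_moment_measure.axioms)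
  fix x :: real
  define q where "q n y = real (Suc n) * (max 0 (y - x) - max 0 (y - (x + 1 / real (Suc n))))"
    for n :: nat and y :: real
  have q_le: "\<bar>q n y\<bar> \<le> 1" for n y
  proof -
    have *: "\<bar>max 0 (y - x) - max 0 (y - (x + d))\<bar> \<le> d" if "d > 0" for d
      using that by (auto simp: max_def)
    have "\<bar>q n y\<bar> = real (Suc n) * \<bar>max 0 (y - x) - max 0 (y - (x + 1 / real (Suc n)))\<bar>"
      unfolding q_def abs_mult by simp
    also have "\<dots> \<le> real (Suc n) * (1 / real (Suc n))"
      by (intro mult_left_mono *) auto
    finally show ?thesis by simp
  qed
  have q_lim: "(\<lambda>n. q n y) \<longlonglongrightarrow> indicator {x<..} y" for y
  proof (cases "y > x")
    case True
    then have "\<forall>\<^sub>F n in sequentially. 1 / real (Suc n) < y - x"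
      using LIMSEQ_inverse_real_of_nat by (intro order_tendstoD(2)) (auto simp: inverse_eq_divide)
    moreover have "q n y = 1" if "1 / real (Suc n) < y - x" for n
    proof -
      have "max 0 (y - x) - max 0 (y - (x + 1 / real (Suc n))) = 1 / real (Suc n)"
        using that True by (simp add: max_def)
      then show ?thesis unfolding q_def by simp
    qed
    ultimately have "\<forall>\<^sub>F n in sequentially. q n y = 1"
      by (auto elim: eventually_mono)
    then show ?thesis using True by (auto intro: tendsto_eventually)
  next
    case False
    have "q n y = 0" for n
    proof -
      have "0 < 1 / real (Suc n)" by simp
      then have "max 0 (y - x) = 0" "max 0 (y - (x + 1 / real (Suc n))) = 0"
        using False by linarith+
      then show ?thesis unfolding q_def by simp
    qed
    then show ?thesis using False by auto
  qed
  \<comment> \<open>The positive part is the mean of |y - t| and y - t, so its integral depends on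
    potential, mass and moment alone.\<close>
  have call: "(\<integral>y. max 0 (y - t) \<partial>K) = (pot K t + (moment K - t * mass K)) / 2"
    if "first_moment_measure K" for K t
  proof -
    interpret K: first_moment_measure K by fact
    have "pot K t + (moment K - t * mass K) = (\<integral>y. \<bar>y - t\<bar> + (y - t) \<partial>K)"
      unfolding pot_def by (subst Bochner_Integration.integral_add) (auto simp: K.integral_affine)
    also have "\<dots> = (\<integral>y. 2 * max 0 (y - t) \<partial>K)"
      by (rule Bochner_Integration.integral_cong) (auto simp: max_def abs_if)
    finally show ?thesis by simp
  qed
  have qint: "(\<integral>y. q n y \<partial>K) = real (Suc n) *
      ((\<integral>y. max 0 (y - x) \<partial>K) - (\<integral>y. max 0 (y - (x + 1 / real (Suc n))) \<partial>K))"
    if "first_moment_measure K" for K n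
  proof -
    interpret K: first_moment_measure K by fact
    show ?thesis unfolding q_def using K.integrable_id by simp
  qed
  have lim: "(\<lambda>n. \<integral>y. q n y \<partial>K) \<longlonglongrightarrow> measure K {x<..}" if "first_moment_measure K" for K
  proof -
    interpret K: first_moment_measure K by fact
    have "(\<lambda>n. \<integral>y. q n y \<partial>K) \<longlonglongrightarrow> (\<integral>y. indicator {x<..} y \<partial>K)"
    proof (rule integral_dominated_convergence[where w="\<lambda>_. 1"])
      show "\<And>n. q n \<in> borel_measurable K" unfolding q_def by measurable
    qed (use q_lim q_le in auto)
    then show ?thesis by simp
  qed
  show "measure M {x<..} = measure N {x<..}"
    using lim[OF assms(1)] lim[OF assms(2)]
    unfolding qint[OF assms(1)] qint[OF assms(2)] call[OF assms(1)] call[OF assms(2)] mass mom pot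
    by (rule LIMSEQ_unique)
qed

section \<open>Convexity of potentials and comparison across gaps\<close>

lemma abs_convex_combination_le:
  fixes x y z t :: real
  assumes "0 \<le> t" "t \<le> 1"
  shows "\<bar>z - ((1 - t) * x + t * y)\<bar> \<le> (1 - t) * \<bar>z - x\<bar> + t * \<bar>z - y\<bar>"
proof -
  have "\<bar>z - ((1 - t) * x + t * y)\<bar> = \<bar>(1 - t) * (z - x) + t * (z - y)\<bar>"
    by (simp add: algebra_simps)
  also have "\<dots> \<le> (1 - t) * \<bar>z - x\<bar> + t * \<bar>z - y\<bar>"
    using assms abs_triangle_ineq[of "(1 - t) * (z - x)" "t * (z - y)"] by (simp add: abs_mult)
  finally show ?thesis .
qed

lemma (in first_moment_measure) convex_on_pot: "convex_on UNIV (pot M)"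
proof (intro convex_onI)
  fix t x y :: real assume t: "0 < t" "t < 1"
  have "pot M ((1 - t) * x + t * y) \<le> (\<integral>z. (1 - t) * \<bar>z - x\<bar> + t * \<bar>z - y\<bar> \<partial>M)"
    unfolding pot_def
  proof (rule integral_mono)
    show "\<bar>z - ((1 - t) * x + t * y)\<bar> \<le> (1 - t) * \<bar>z - x\<bar> + t * \<bar>z - y\<bar>" for z
      using t by (intro abs_convex_combination_le) auto
  qed auto
  also have "\<dots> = (1 - t) * pot M x + t * pot M y"
    unfolding pot_def by (subst Bochner_Integration.integral_add) auto
  finally show "pot M ((1 - t) *\<^sub>R x + t *\<^sub>R y) \<le> (1 - t) * pot M x + t * pot M y"
    by simp
qed auto

text \<open>On a gap of \<open>A\<close> the potential of \<open>M\<close> is affine while \<open>u\<close> is convex, so the inequality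
  extends from the endpoints of the gap; an infinite endpoint is replaced by a far away point.\<close>

lemma convex_le_pot:
  assumes M: "first_moment_measure M" and conv: "convex_on UNIV u"
    and A: "AE y in M. y \<in> A" and le: "\<And>t. t \<in> A \<Longrightarrow> u t \<le> pot M t"
    and top: "\<And>e. 0 < e \<Longrightarrow> \<forall>\<^sub>F t in at_top. u t \<le> pot M t + e"
    and bot: "\<And>e. 0 < e \<Longrightarrow> \<forall>\<^sub>F t in at_bot. u t \<le> pot M t + e"
  shows "u t \<le> pot M t"
proof (cases "t \<in> A")
  case False
  interpret M: first_moment_measure M by fact
  have u_cont: "continuous_on UNIV u"
    using conv by (intro convex_on_continuous) auto
  have closed: "closed {t. u t \<le> pot M t}"
    by (intro closed_Collect_le u_cont M.continuous_on_pot)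
  show ?thesis
  proof (rule field_le_epsilon)
    fix e :: real assume e: "0 < e"
    \<comment> \<open>When A has points to the left of t, their supremum lies in the closed set
      where the inequality holds; the error e is spent only when there are none and a far away point
      is taken. The point r on the right is found likewise.\<close>
    obtain s where s: "s \<le> t" "A \<inter> {s<..t} = {}" "u s \<le> pot M s + e"
    proof (cases "A \<inter> {..t} = {}")
      case True
      have "\<forall>\<^sub>F s in at_bot. s \<le> t \<and> u s \<le> pot M s + e"
        using bot[OF e] eventually_le_at_bot[of t] by eventually_elim simp
      then obtain s where "s \<le> t" "u s \<le> pot M s + e"
        by (auto dest: eventually_happens)
      with True show ?thesis by (intro that[of s]) auto
    next
      case ne: False
      let ?s = "Sup (A \<inter> {..t})"
      have bdd: "bdd_above (A \<inter> {..t})" by (auto intro!: bdd_aboveI)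
      have "?s \<in> closure (A \<inter> {..t})" using ne bdd by (intro closure_contains_Sup)
      also have "\<dots> \<subseteq> {t. u t \<le> pot M t}" using le by (intro closure_minimal closed) auto
      finally have "u ?s \<le> pot M ?s" by simp
      moreover have "?s \<le> t" using ne by (intro cSup_least) auto
      moreover have "A \<inter> {?s<..t} = {}" using cSup_upper[OF _ bdd] by fastforce
      ultimately show ?thesis using e by (intro that[of ?s]) auto
    qed
    obtain r where r: "t \<le> r" "A \<inter> {t..<r} = {}" "u r \<le> pot M r + e"
    proof (cases "A \<inter> {t..} = {}")
      case True
      have "\<forall>\<^sub>F r in at_top. t \<le> r \<and> u r \<le> pot M r + e"
        using top[OF e] eventually_ge_at_top[of t] by eventually_elim simp
      then obtain r where "t \<le> r" "u r \<le> pot M r + e"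
        by (auto dest: eventually_happens)
      with True show ?thesis by (intro that[of r]) auto
    next
      case ne: False
      let ?r = "Inf (A \<inter> {t..})"
      have bdd: "bdd_below (A \<inter> {t..})" by (auto intro!: bdd_belowI)
      have "?r \<in> closure (A \<inter> {t..})" using ne bdd by (intro closure_contains_Inf)
      also have "\<dots> \<subseteq> {t. u t \<le> pot M t}" using le by (intro closure_minimal closed) auto
      finally have "u ?r \<le> pot M ?r" by simp
      moreover have "t \<le> ?r" using ne by (intro cInf_greatest) auto
      moreover have "A \<inter> {t..<?r} = {}" using cInf_lower[OF _ bdd] by fastforce
      ultimately show ?thesis using e by (intro that[of ?r]) auto
    qed
    show "u t \<le> pot M t + e"
    proof (cases "s < r")
      case True
      define l where "l = (t - s) / (r - s)"
      have l: "0 \<le> l" "l \<le> 1" using s r True by (auto simp: l_def)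
      have t_eq: "t = (1 - l) * s + l * r"
      proof -
        have "l * (r - s) = t - s" using True unfolding l_def by simp
        then show ?thesis by (simp add: algebra_simps)
      qed
      have "(1 - l) * pot M s + l * pot M r = (\<integral>z. (1 - l) * \<bar>z - s\<bar> + l * \<bar>z - r\<bar> \<partial>M)"
        unfolding pot_def by (subst Bochner_Integration.integral_add) auto
      also have "\<dots> = pot M t"
        unfolding pot_def
      proof (rule integral_cong_AE)
        show "AE z in M. (1 - l) * \<bar>z - s\<bar> + l * \<bar>z - r\<bar> = \<bar>z - t\<bar>"
          using A
        proof eventually_elim
          case (elim z)
          then have "z \<le> s \<or> r \<le> z" using s(2) r(2) by force
          then show ?case
          proof
            assume "z \<le> s"
            then have "\<bar>z - s\<bar> = s - z" "\<bar>z - r\<bar> = r - z" "\<bar>z - t\<bar> = t - z" using s r by auto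
            then show ?thesis unfolding t_eq by (simp add: algebra_simps)
          next
            assume "r \<le> z"
            then have "\<bar>z - s\<bar> = z - s" "\<bar>z - r\<bar> = z - r" "\<bar>z - t\<bar> = z - t" using s r by auto
            then show ?thesis unfolding t_eq by (simp add: algebra_simps)
          qed
        qed
      qed auto
      finally have pot_t: "pot M t = (1 - l) * pot M s + l * pot M r" by simp
      have "u t \<le> (1 - l) * u s + l * u r"
        using convex_onD[OF conv, of l s r] l by (simp add: t_eq)
      also have "\<dots> \<le> (1 - l) * (pot M s + e) + l * (pot M r + e)"
        using l s r by (intro add_mono mult_left_mono) auto
      also have "\<dots> = pot M t + e" unfolding pot_t by (simp add: algebra_simps)
      finally show ?thesis .
    next
      case False
      then have "s = t" using s r by auto
      then show ?thesis using s by simp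
    qed
  qed
qed (use le in auto)

section \<open>Distribution functions of atomless measures\<close>

context finite_borel_measure
begin

lemma measurable_cdf [measurable]: "cdf M \<in> borel_measurable borel"
  by (intro borel_measurable_mono monoI cdf_nondecreasing)

lemma continuous_cdf:
  assumes "atomless M"
  shows "continuous_on A (cdf M)"
  using assms isCont_cdf atomless_measure by (intro continuous_at_imp_continuous_on) auto

lemma cdf_le_mass: "cdf M x \<le> mass M"
  using cdf_bounded by simp

lemma cdf_attains:
  assumes "atomless M" "0 < s" "s < mass M"
  obtains t where "cdf M t = s"
proof -
  have "\<forall>\<^sub>F x in at_bot. cdf M x < s"
    using cdf_lim_at_bot assms by (intro order_tendstoD(2)) auto
  then obtain x where x: "cdf M x < s" by (auto dest: eventually_happens)
  have "\<forall>\<^sub>F x in at_top. s < cdf M x"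
    using cdf_lim_at_top assms by (intro order_tendstoD(1)) auto
  then obtain y where y: "s < cdf M y" by (auto dest: eventually_happens)
  have "x \<le> y" using x y cdf_nondecreasing[of y x] by linarith
  then have "\<exists>t\<ge>x. t \<le> y \<and> cdf M t = s"
    using x y continuous_cdf[OF assms(1)] by (intro IVT') auto
  then show ?thesis using that by auto
qed

text \<open>Probability integral transform: \<open>cdf M\<close> is uniform on [0, mass] under an
  atomless \<open>M\<close>. A nonempty proper sublevel set is a closed half line whose end point z
  is the last one at level s, and continuity gives \<open>cdf M z = s\<close>.\<close>

lemma measure_cdf_le:
  assumes "atomless M" "0 \<le> s"
  shows "measure M {x. cdf M x \<le> s} = min s (mass M)"
proof (cases "s < mass M")
  case False
  then have "cdf M x \<le> s" for x using cdf_le_mass[of x] by linarith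
  then have "{x. cdf M x \<le> s} = UNIV" by blast
  then have "measure M {x. cdf M x \<le> s} = mass M" by (rule arg_cong)
  then show ?thesis using False by simp
next
  case True
  let ?A = "{x. cdf M x \<le> s}"
  have "\<forall>\<^sub>F x in at_top. s < cdf M x"
    using cdf_lim_at_top True by (intro order_tendstoD(1)) auto
  then obtain y where y: "s < cdf M y" by (auto dest: eventually_happens)
  have bdd: "bdd_above ?A"
  proof (rule bdd_aboveI)
    fix x assume "x \<in> ?A"
    then have "cdf M x \<le> s" by (rule CollectD)
    then show "x \<le> y" using y cdf_nondecreasing[of y x] by linarith
  qed
  have cl: "closed ?A"
    by (rule closed_Collect_le[OF continuous_cdf[OF assms(1)] continuous_on_const])
  show ?thesis
  proof (cases "?A = {}")
    case empty: True
    have "\<not> 0 < s"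
    proof
      assume "0 < s"
      then have "\<forall>\<^sub>F x in at_bot. cdf M x < s"
        using cdf_lim_at_bot by (intro order_tendstoD(2)) auto
      then obtain x where "cdf M x < s" by (auto dest: eventually_happens)
      then have "x \<in> ?A" by (intro CollectI less_imp_le)
      with empty show False by blast
    qed
    then have "s = 0" using assms(2) by simp
    have "measure M {x. cdf M x \<le> s} = 0" by (simp only: empty measure_empty)
    then show ?thesis using \<open>s = 0\<close> by simp
  next
    case False
    define z where "z = Sup ?A"
    have x: "z \<in> ?A" unfolding z_def using closed_contains_Sup[OF False bdd cl] .
    have A: "?A = {..z}"
    proof (intro set_eqI iffI)
      fix x assume "x \<in> {..z}"
      then have "cdf M x \<le> cdf M z" by (intro cdf_nondecreasing) simp
      also have "\<dots> \<le> s" using x by (rule CollectD)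
      finally show "x \<in> ?A" by simp
    next
      fix x assume "x \<in> ?A"
      then have "x \<le> z" unfolding z_def by (rule cSup_upper[OF _ bdd])
      then show "x \<in> {..z}" by simp
    qed
    have "s \<le> cdf M z"
    proof (rule tendsto_lowerbound)
      show "(cdf M \<longlongrightarrow> cdf M z) (at_right z)"
        using cdf_is_right_cont[of z] by (simp add: continuous_within)
      show "\<forall>\<^sub>F x in at_right z. s \<le> cdf M x"
        using eventually_at_right_less[of z]
      proof eventually_elim
        case (elim x)
        then have "x \<notin> ?A" unfolding A by simp
        then show ?case by simp
      qed
    qed simp
    moreover have "cdf M z \<le> s" using x by (rule CollectD)
    ultimately have "cdf M z = s" by (rule order.antisym[rotated])
    have mA: "measure M ?A = cdf M z" unfolding cdf_def2[of M z] A by (rule refl)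
    show ?thesis unfolding mA using True \<open>cdf M z = s\<close> by simp
  qed
qed

lemma sets_cdf_le [simp]: "{x. cdf M x \<le> s} \<in> sets borel"
  by measurable

text \<open>A level set can be a whole interval if \<open>M\<close> has gaps, but it lies in a band
  of levels from s - e to s, whose mass is at most e.\<close>

lemma measure_cdf_eq:
  assumes "atomless M"
  shows "measure M {x. cdf M x = s} = 0"
proof (cases "0 \<le> s")
  case False
  have "cdf M x \<noteq> s" for x using cdf_nonneg[of x] False by linarith
  then show ?thesis by simp
next
  case True
  have *: "measure M {x. cdf M x = s} \<le> e" if "0 < e" for e
  proof (cases "0 \<le> s - e")
    case True
    have "measure M {x. cdf M x = s} \<le> measure M ({x. cdf M x \<le> s} - {x. cdf M x \<le> s - e})"
    proof (rule finite_measure_mono)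
      show "{x. cdf M x = s} \<subseteq> {x. cdf M x \<le> s} - {x. cdf M x \<le> s - e}" using that by force
    qed (simp add: sets.Diff)
    also have "\<dots> = measure M {x. cdf M x \<le> s} - measure M {x. cdf M x \<le> s - e}"
    proof (rule finite_measure_Diff)
      show "{x. cdf M x \<le> s - e} \<subseteq> {x. cdf M x \<le> s}" using that by force
    qed simp_all
    also have "\<dots> \<le> e"
      unfolding measure_cdf_le[OF assms \<open>0 \<le> s\<close>] measure_cdf_le[OF assms True] using that by (simp add: min_def)
    finally show ?thesis .
  next
    case False
    have "measure M {x. cdf M x = s} \<le> measure M {x. cdf M x \<le> s}"
    proof (rule finite_measure_mono)
      show "{x. cdf M x = s} \<subseteq> {x. cdf M x \<le> s}" by force
    qed simp
    also have "\<dots> \<le> e" unfolding measure_cdf_le[OF assms True] using False by (simp add: min_def)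
    finally show ?thesis .
  qed
  have "measure M {x. cdf M x = s} \<le> 0"
  proof (rule field_le_epsilon)
    fix e :: real assume "0 < e"
    from *[OF this] show "measure M {x. cdf M x = s} \<le> 0 + e" by simp
  qed
  then show ?thesis using measure_nonneg[of M "{x. cdf M x = s}"] by linarith
qed

lemma AE_cdf_neq:
  assumes "atomless M"
  shows "AE x in M. cdf M x \<noteq> s"
proof -
  have "{x. cdf M x = s} \<in> null_sets M"
    by (intro null_setsI) (simp_all add: emeasure_eq_measure measure_cdf_eq[OF assms])
  from AE_not_in[OF this] show ?thesis by simp
qed

end

section \<open>Shadows of atoms and barcodes\<close>

context first_moment_measure
begin

lemma pot_restr: "S \<in> sets borel \<Longrightarrow> pot (restr M S) t = (\<integral>y. indicator S y * \<bar>y - t\<bar> \<partial>M)"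
  unfolding pot_def by (subst integral_restr) auto

lemma moment_restr: "S \<in> sets borel \<Longrightarrow> moment (restr M S) = (\<integral>y. indicator S y * y \<partial>M)"
  by (subst integral_restr) auto

lemma mass_restr: "S \<in> sets borel \<Longrightarrow> mass (restr M S) = measure M S"
  by (subst measure_restr) auto

lemma integral_split_compl:
  fixes f :: "real \<Rightarrow> real"
  assumes "integrable M f" "S \<in> sets borel"
  shows "(\<integral>y. indicator S y * f y \<partial>M) + (\<integral>y. indicator (- S) y * f y \<partial>M) = (\<integral>y. f y \<partial>M)"
proof -
  have "(\<integral>y. indicator S y * f y \<partial>M) + (\<integral>y. indicator (- S) y * f y \<partial>M)
    = (\<integral>y. indicator S y * f y + indicator (- S) y * f y \<partial>M)"
    using assms by (intro Bochner_Integration.integral_add[symmetric]) auto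
  also have "\<dots> = (\<integral>y. f y \<partial>M)"
    by (intro Bochner_Integration.integral_cong) (auto simp: indicator_def)
  finally show ?thesis .
qed

lemma pot_restr_compl:
  "S \<in> sets borel \<Longrightarrow> pot (restr M S) t + pot (restr M (- S)) t = pot M t"
  using integral_split_compl[of "\<lambda>y. \<bar>y - t\<bar>" S] by (simp add: pot_restr) (simp add: pot_def)

text \<open>Take for t a quantile of level s. Then |y - t| - (y - t) is twice the positive part of t
  - y, which is carried by the lowest share of mass s. This turns bounds on the potential into
  bounds on the moment of that share, as the intermediate value argument of
  \<open>shadow_interval\<close> requires.\<close>

lemma cdf_level_moment:
  assumes "atomless M" "0 < s" "s < mass M"
  obtains t where "2 * (t * s - (\<integral>y. indicator {y. cdf M y \<le> s} y * y \<partial>M))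
      = pot M t - (moment M - t * mass M)"
proof -
  obtain t where t: "cdf M t = s" using cdf_attains[OF assms] .
  have "pot M t - (moment M - t * mass M) = (\<integral>y. \<bar>y - t\<bar> - (y - t) \<partial>M)"
    unfolding pot_def by (subst Bochner_Integration.integral_diff) (auto simp: integral_affine)
  also have "\<dots> = (\<integral>y. 2 * (t * indicator {y. cdf M y \<le> s} y - indicator {y. cdf M y \<le> s} y * y) \<partial>M)"
  proof (rule integral_cong_AE)
    show "AE y in M. \<bar>y - t\<bar> - (y - t)
        = 2 * (t * indicator {y. cdf M y \<le> s} y - indicator {y. cdf M y \<le> s} y * y)"
      using AE_cdf_neq[OF assms(1), of s]
    proof eventually_elim
      case (elim y)
      then show ?case
        using t cdf_nondecreasing[of y t] cdf_nondecreasing[of t y]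
        by (cases "y \<le> t") (auto simp: indicator_def)
    qed
  qed auto
  also have "\<dots> = 2 * (t * s - (\<integral>y. indicator {y. cdf M y \<le> s} y * y \<partial>M))"
  proof -
    have "measure M {y. cdf M y \<le> s} = s" using assms by (subst measure_cdf_le) auto
    moreover have "integrable M (indicator {y. cdf M y \<le> s} :: real \<Rightarrow> real)"
      by (intro integrable_real_indicator) (auto simp: less_top[symmetric])
    ultimately show ?thesis
      using integrable_indicator_mult[OF integrable_id, of "{y. cdf M y \<le> s}"]
      by (subst integral_mult_right_zero, subst Bochner_Integration.integral_diff) auto
  qed
  finally show ?thesis by (intro that[of t]) simp
qed

text \<open>The indicators converge except where \<open>cdf M y\<close> equals the limiting level,
  and that set is null.\<close>

lemma continuous_cdf_level_moment:
  assumes "atomless M"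
  shows "continuous_on A (\<lambda>s. \<integral>y. indicator {y. cdf M y \<le> s} y * y \<partial>M)"
  unfolding continuous_on_sequentially comp_def
proof (intro allI ballI impI)
  fix x :: "nat \<Rightarrow> real" and a assume x: "(\<forall>n. x n \<in> A) \<and> x \<longlonglongrightarrow> a"
  show "(\<lambda>n. \<integral>y. indicator {y. cdf M y \<le> x n} y * y \<partial>M)
      \<longlonglongrightarrow> (\<integral>y. indicator {y. cdf M y \<le> a} y * y \<partial>M)"
  proof (rule integral_dominated_convergence[where w="\<lambda>y. \<bar>y\<bar>"])
    show "AE y in M. (\<lambda>n. indicator {y. cdf M y \<le> x n} y * y) \<longlonglongrightarrow> indicator {y. cdf M y \<le> a} y * y"
      using AE_cdf_neq[OF assms, of a]
    proof eventually_elim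
      case (elim y)
      have "\<forall>\<^sub>F n in sequentially. indicator {y. cdf M y \<le> x n} y * y = indicator {y. cdf M y \<le> a} y * y"
      proof (cases "cdf M y < a")
        case True
        then have "\<forall>\<^sub>F n in sequentially. cdf M y < x n" using x by (intro order_tendstoD(1)) auto
        then show ?thesis by eventually_elim (use True in \<open>auto simp: indicator_def\<close>)
      next
        case False
        then have "\<forall>\<^sub>F n in sequentially. x n < cdf M y" using x elim by (intro order_tendstoD(2)) auto
        then show ?thesis by eventually_elim (use False elim in \<open>auto simp: indicator_def\<close>)
      qed
      then show ?case by (rule tendsto_eventually)
    qed
  qed (auto simp: integrable_id indicator_def)
qed

text \<open>The shadow of an atom of mass \<open>m\<close> at \<open>b\<close> in \<open>M\<close>: among the intervals of mass \<open>m\<close> one has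
  barycentre \<open>b\<close>, by the intermediate value theorem. Removing it leaves as much room as possible
  for the rest \<open>u\<close>, because nothing of the remaining mass lies inside the interval.\<close>

lemma shadow_interval:
  assumes al: "atomless M" and m: "0 \<le> m" "0 \<le> mu" "m + mu = mass M"
    and mom: "m * b + Mu = moment M" "mu = 0 \<Longrightarrow> Mu = 0"
    and conv: "convex_on UNIV u" and u_ge: "\<And>t. \<bar>Mu - t * mu\<bar> \<le> u t"
    and le: "\<And>t. u t + m * \<bar>b - t\<bar> \<le> pot M t"
  obtains S where "S \<in> sets borel" "measure M S = m" "(\<integral>y. indicator S y * y \<partial>M) = m * b"
    "\<And>t. u t \<le> pot (restr M (- S)) t"
proof -
  define G where "G s = (\<integral>y. indicator {y. cdf M y \<le> s} y * y \<partial>M)" for s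
  \<comment> \<open>Intervals are described by levels of the cdf, so that sliding p with q - p = m
    keeps the mass equal to m.\<close>
  define I where "I p q = {y. p < cdf M y \<and> cdf M y \<le> q}" for p q
  have [measurable]: "I p q \<in> sets borel" for p q unfolding I_def by measurable
  have int_I: "(\<integral>y. indicator (I p q) y * y \<partial>M) = G q - G p" if "p \<le> q" for p q
  proof -
    have "(\<integral>y. indicator (I p q) y * y \<partial>M)
        = (\<integral>y. indicator {y. cdf M y \<le> q} y * y - indicator {y. cdf M y \<le> p} y * y \<partial>M)"
      using that by (intro Bochner_Integration.integral_cong) (auto simp: I_def indicator_def)
    then show ?thesis
      using integrable_id unfolding G_def by (simp add: integrable_indicator_mult)
  qed
  have meas_I: "measure M (I p q) = q - p" if "0 \<le> p" "p \<le> q" "q \<le> mass M" for p q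
  proof -
    have "I p q = {y. cdf M y \<le> q} - {y. cdf M y \<le> p}" by (auto simp: I_def)
    then have "measure M (I p q) = measure M {y. cdf M y \<le> q} - measure M {y. cdf M y \<le> p}"
      using that by (simp add: finite_measure_Diff subset_eq)
    then show ?thesis using that al by (simp add: measure_cdf_le)
  qed
  have "\<exists>S. S \<in> sets borel \<and> is_interval S \<and> measure M S = m \<and> (\<integral>y. indicator S y * y \<partial>M) = m * b"
  proof -
    consider "m = 0" | "mu = 0" | "0 < m" "0 < mu" using m by linarith
    then show ?thesis
    proof cases
      case 1
      then show ?thesis by (intro exI[of _ "{}"]) auto
    next
      case 2
      then show ?thesis using m mom by (intro exI[of _ UNIV]) auto
    next
      case 3
      have lin: "A \<le> B \<Longrightarrow> q = d - A \<Longrightarrow> d \<le> v \<Longrightarrow> 2 * g = p - q \<Longrightarrow> v + B \<le> p \<Longrightarrow> A \<le> g"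
        for A B q d v g p :: real by linarith
      have lin': "A \<le> B \<Longrightarrow> q = (Mu - d) + A \<Longrightarrow> d - Mu \<le> v \<Longrightarrow> 2 * g = p - q \<Longrightarrow> v + B \<le> p
          \<Longrightarrow> d - Mu \<le> g" for A B q d v g p :: real by linarith
      \<comment> \<open>Left end of the slide: the hypothesis on potentials at the quantile of level
        m shows that the lowest interval of mass m has too small a moment.\<close>
      have G_m: "G m \<le> m * b"
      proof -
        obtain t where t: "2 * (t * m - G m) = pot M t - (moment M - t * mass M)"
          using cdf_level_moment[OF al, of m] 3 m unfolding G_def by auto
        have "m * (t - b) \<le> m * \<bar>b - t\<bar>" using m by (intro mult_left_mono) auto
        moreover have "moment M - t * mass M = (Mu - t * mu) - m * (t - b)"
          unfolding m(3)[symmetric] mom(1)[symmetric] by (simp add: algebra_simps)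
        moreover have "Mu - t * mu \<le> u t" using u_ge[of t] by simp
        ultimately have "m * (t - b) \<le> t * m - G m" using t le[of t] by (rule lin)
        then show ?thesis by (simp add: algebra_simps)
      qed
      \<comment> \<open>Right end: the lowest share of mass mu has moment at most Mu, so its
        complement, the highest interval of mass m, has moment at least m * b.\<close>
      have G_mu: "G mu \<le> Mu"
      proof -
        obtain t where t: "2 * (t * mu - G mu) = pot M t - (moment M - t * mass M)"
          using cdf_level_moment[OF al, of mu] 3 m unfolding G_def by auto
        have "m * (b - t) \<le> m * \<bar>b - t\<bar>" using m by (intro mult_left_mono) auto
        moreover have "moment M - t * mass M = (Mu - t * mu) + m * (b - t)"
          unfolding m(3)[symmetric] mom(1)[symmetric] by (simp add: algebra_simps)
        moreover have "t * mu - Mu \<le> u t" using u_ge[of t] by simp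
        ultimately have "t * mu - Mu \<le> t * mu - G mu" using t le[of t] by (rule lin')
        then show ?thesis by simp
      qed
      have G0: "G 0 = 0"
      proof -
        have "G 0 = (\<integral>y. 0 \<partial>M)"
          unfolding G_def
        proof (rule integral_cong_AE)
          show "AE y in M. indicator {y. cdf M y \<le> 0} y * y = 0"
            using AE_cdf_neq[OF al, of 0]
          proof eventually_elim
            case (elim y)
            then have "\<not> cdf M y \<le> 0" using cdf_nonneg[of y] by linarith
            then show ?case by simp
          qed
        qed auto
        then show ?thesis by simp
      qed
      have G_mass: "G (mass M) = moment M"
        unfolding G_def using cdf_le_mass by simp
      have "continuous_on {0..mu} (\<lambda>p. G (p + m) - G p)"
        using continuous_cdf_level_moment[OF al] unfolding G_def[symmetric]
        by (intro continuous_on_diff continuous_on_compose2[of UNIV G "{0..mu}" "\<lambda>p. p + m"])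
          (auto intro!: continuous_intros)
      then have "\<exists>p\<ge>0. p \<le> mu \<and> G (p + m) - G p = m * b"
        using G_m G_mu G0 G_mass m mom 3 by (intro IVT') (auto simp: add.commute)
      then obtain p where p: "0 \<le> p" "p \<le> mu" "G (p + m) - G p = m * b" by auto
      have "is_interval (I p (p + m))"
        unfolding is_interval_1 I_def
        by (auto intro: less_le_trans[OF _ cdf_nondecreasing] order_trans[OF cdf_nondecreasing])
      moreover have "measure M (I p (p + m)) = m" using meas_I[of p "p + m"] p m by auto
      moreover have "(\<integral>y. indicator (I p (p + m)) y * y \<partial>M) = m * b" using int_I[of p "p + m"] p m by auto
      ultimately show ?thesis by (intro exI[of _ "I p (p + m)"]) auto
    qed
  qed
  then obtain S where S [measurable]: "S \<in> sets borel" and "is_interval S"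
    and mS: "measure M S = m" and fS: "(\<integral>y. indicator S y * y \<partial>M) = m * b"
    by auto
  interpret S: first_moment_measure "restr M S" by (rule first_moment_measure_restr) fact
  interpret C: first_moment_measure "restr M (- S)" by (rule first_moment_measure_restr) auto
  have mass_S: "mass (restr M S) = m" using mS by (simp add: mass_restr)
  have moment_S: "moment (restr M S) = m * b" using fS by (simp add: moment_restr)
  have u_le: "u t \<le> pot (restr M (- S)) t + (pot (restr M S) t - m * \<bar>b - t\<bar>)" for t
    using le[of t] pot_restr_compl[OF S, of t] by simp
  \<comment> \<open>If t is outside the interval, S lies on one side of t and the bracket in
    \<open>u_le\<close> is zero. Inside it, the remaining measure has no mass, which is the
    situation of \<open>convex_le_pot\<close>; far away the bracket tends to zero.\<close>
  have "u t \<le> pot (restr M (- S)) t" for t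
  proof (rule convex_le_pot[where A="- S"])
    show "first_moment_measure (restr M (- S))" "convex_on UNIV u"
      using C.first_moment_measure_axioms conv by auto
    show "AE y in restr M (- S). y \<in> - S"
      unfolding restr_def by (subst AE_density) (auto simp: indicator_def)
    show "u t \<le> pot (restr M (- S)) t" if t: "t \<in> - S" for t
    proof -
      have "(\<forall>y\<in>S. y \<le> t) \<or> (\<forall>y\<in>S. t \<le> y)"
        using \<open>is_interval S\<close> t unfolding is_interval_1 by (metis ComplD linorder_linear)
      then have "pot (restr M S) t = \<bar>moment (restr M S) - t * mass (restr M S)\<bar>"
      proof
        assume *: "\<forall>y\<in>S. y \<le> t"
        have "pot (restr M S) t = - (\<integral>y. y - t \<partial>restr M S)"
          unfolding integral_minus[symmetric] using *
          by (simp only: pot_restr[OF S], subst integral_restr)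
            (auto intro!: Bochner_Integration.integral_cong simp: indicator_def)
        then show ?thesis using S.pot_nonneg[of t] by (simp add: S.integral_affine)
      next
        assume *: "\<forall>y\<in>S. t \<le> y"
        have "pot (restr M S) t = (\<integral>y. y - t \<partial>restr M S)"
          using * by (simp only: pot_restr[OF S], subst integral_restr)
            (auto intro!: Bochner_Integration.integral_cong simp: indicator_def)
        then show ?thesis using S.pot_nonneg[of t] by (simp add: S.integral_affine)
      qed
      also have "\<dots> = m * \<bar>b - t\<bar>"
      proof -
        have "m * b - t * m = m * (b - t)" by (simp add: algebra_simps)
        then show ?thesis using m unfolding mass_S moment_S by (simp add: abs_mult)
      qed
      finally show ?thesis using u_le[of t] by simp
    qed
    show "\<forall>\<^sub>F t in at_top. u t \<le> pot (restr M (- S)) t + e" if "0 < e" for e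
    proof -
      have "\<forall>\<^sub>F t in at_top. pot (restr M S) t - (t * m - m * b) < e"
        using S.pot_at_top that unfolding mass_S moment_S by (intro order_tendstoD(2)) auto
      then show ?thesis using eventually_ge_at_top[of b]
      proof eventually_elim
        case (elim t)
        then have "m * \<bar>b - t\<bar> = t * m - m * b" by (simp add: algebra_simps)
        then show ?case using elim u_le[of t] by linarith
      qed
    qed
    show "\<forall>\<^sub>F t in at_bot. u t \<le> pot (restr M (- S)) t + e" if "0 < e" for e
    proof -
      have "\<forall>\<^sub>F t in at_bot. pot (restr M S) t - (m * b - t * m) < e"
        using S.pot_at_bot that unfolding mass_S moment_S by (intro order_tendstoD(2)) auto
      then show ?thesis using eventually_le_at_bot[of b]
      proof eventually_elim
        case (elim t)
        then have "m * \<bar>b - t\<bar> = m * b - t * m" by (simp add: algebra_simps)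
        then show ?case using elim u_le[of t] by linarith
      qed
    qed
  qed
  then show ?thesis using that S mS fS by blast
qed

end

section \<open>Embedding a sequence of atoms\<close>

lemma convex_on_suminf_abs:
  fixes m b :: "nat \<Rightarrow> real"
  assumes "\<And>q. 0 \<le> m q" "\<And>t. summable (\<lambda>q. m q * \<bar>b q - t\<bar>)"
  shows "convex_on UNIV (\<lambda>t. \<Sum>q. m q * \<bar>b q - t\<bar>)"
proof (intro convex_onI)
  fix l x y :: real assume l: "0 < l" "l < 1"
  have "(\<Sum>q. m q * \<bar>b q - ((1 - l) * x + l * y)\<bar>)
      \<le> (\<Sum>q. (1 - l) * (m q * \<bar>b q - x\<bar>) + l * (m q * \<bar>b q - y\<bar>))"
  proof (rule suminf_le)
    fix q
    have "m q * \<bar>b q - ((1 - l) * x + l * y)\<bar>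
        \<le> m q * ((1 - l) * \<bar>b q - x\<bar> + l * \<bar>b q - y\<bar>)"
      using l assms(1) by (intro mult_left_mono abs_convex_combination_le) auto
    then show "m q * \<bar>b q - ((1 - l) * x + l * y)\<bar>
        \<le> (1 - l) * (m q * \<bar>b q - x\<bar>) + l * (m q * \<bar>b q - y\<bar>)"
      by (simp add: algebra_simps)
  qed (intro summable_add summable_mult assms)+
  also have "\<dots> = (1 - l) * (\<Sum>q. m q * \<bar>b q - x\<bar>) + l * (\<Sum>q. m q * \<bar>b q - y\<bar>)"
    by (subst suminf_add[symmetric])
      (intro summable_mult assms, intro summable_mult assms, simp only: suminf_mult[OF assms(2)])
  finally show "(\<Sum>q. m q * \<bar>b q - ((1 - l) *\<^sub>R x + l *\<^sub>R y)\<bar>)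
      \<le> (1 - l) * (\<Sum>q. m q * \<bar>b q - x\<bar>) + l * (\<Sum>q. m q * \<bar>b q - y\<bar>)" by simp
qed auto

context first_moment_measure
begin

text \<open>The atoms are placed one after another in what the earlier ones left. At each step the
  function \<open>u\<close> of \<open>shadow_interval\<close> is the potential of \<open>E\<close>
  together with all later atoms, so no step uses up room that is needed afterwards. What
  \<open>E\<close> finds at the end is the decreasing intersection of the remainders.\<close>

lemma barcode:
  fixes m b :: "nat \<Rightarrow> real"
  assumes al: "atomless M" and E: "first_moment_measure E"
    and m: "\<And>q. 0 \<le> m q" and sm: "summable m" and smb: "summable (\<lambda>q. m q * \<bar>b q\<bar>)"
    and mass: "mass E + (\<Sum>q. m q) = mass M"
    and mom: "moment E + (\<Sum>q. m q * b q) = moment M"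
    and le: "\<And>t. pot E t + (\<Sum>q. m q * \<bar>b q - t\<bar>) \<le> pot M t"
  obtains S where "\<And>q. S q \<in> sets borel" "disjoint_family S" "\<And>q. measure M (S q) = m q"
    "\<And>q. (\<integral>y. indicator (S q) y * y \<partial>M) = m q * b q"
    "\<And>t. pot E t \<le> pot (restr M (- (\<Union>q. S q))) t"
proof -
  interpret E: first_moment_measure E by fact
  have s_abs: "summable (\<lambda>q. m q * \<bar>b q - t\<bar>)" for t
  proof (rule summable_comparison_test)
    show "\<exists>N. \<forall>n\<ge>N. norm (m n * \<bar>b n - t\<bar>) \<le> m n * \<bar>b n\<bar> + m n * \<bar>t\<bar>"
      using m by (auto simp: abs_mult distrib_left[symmetric] intro!: mult_left_mono)
    show "summable (\<lambda>n. m n * \<bar>b n\<bar> + m n * \<bar>t\<bar>)"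
      by (intro summable_add smb summable_mult2 sm)
  qed
  have s_diff: "summable (\<lambda>q. m q * (b q - t))" for t
    by (rule summable_rabs_cancel) (use s_abs[of t] m in \<open>simp add: abs_mult\<close>)
  have s_b: "summable (\<lambda>q. m q * b q)"
    using s_diff[of 0] by simp
  \<comment> \<open>Mass, moment and potential of the atoms from index n on.\<close>
  define mt where "mt n = (\<Sum>q. m (q + n))" for n
  define Mt where "Mt n = (\<Sum>q. m (q + n) * b (q + n))" for n
  define ut where "ut n t = (\<Sum>q. m (q + n) * \<bar>b (q + n) - t\<bar>)" for n t
  have mt_Suc: "m n + mt (Suc n) = mt n" for n
    using suminf_split_head[OF summable_ignore_initial_segment[OF sm, of n]] unfolding mt_def by simp
  have Mt_Suc: "m n * b n + Mt (Suc n) = Mt n" for n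
    using suminf_split_head[OF summable_ignore_initial_segment[OF s_b, of n]] unfolding Mt_def by simp
  have ut_Suc: "ut (Suc n) t + m n * \<bar>b n - t\<bar> = ut n t" for n t
    using suminf_split_head[OF summable_ignore_initial_segment[OF s_abs[of t], of n]]
    unfolding ut_def by simp
  have mt_nonneg: "0 \<le> mt n" for n
    unfolding mt_def using m summable_ignore_initial_segment[OF sm] by (intro suminf_nonneg) auto
  have ut_nonneg: "0 \<le> ut n t" for n t
    unfolding ut_def using m summable_ignore_initial_segment[OF s_abs] by (intro suminf_nonneg) auto
  have ut_ge: "\<bar>Mt n - t * mt n\<bar> \<le> ut n t" for n t
  proof -
    have "Mt n - t * mt n = (\<Sum>q. m (q + n) * (b (q + n) - t))"
      unfolding Mt_def mt_def
      using suminf_diff[OF summable_ignore_initial_segment[OF s_b, of n]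
          summable_mult[OF summable_ignore_initial_segment[OF sm, of n], of t]]
        suminf_mult[OF summable_ignore_initial_segment[OF sm, of n], of t]
      by (simp add: algebra_simps)
    also have "\<bar>\<dots>\<bar> \<le> (\<Sum>q. \<bar>m (q + n) * (b (q + n) - t)\<bar>)"
      using m summable_ignore_initial_segment[OF s_abs[of t], of n]
      by (intro summable_rabs) (simp add: abs_mult)
    also have "\<dots> = ut n t" unfolding ut_def using m by (simp add: abs_mult)
    finally show ?thesis .
  qed
  define inv where "inv n R \<longleftrightarrow> R \<in> sets borel \<and> measure M R = mass E + mt n
    \<and> (\<integral>y. indicator R y * y \<partial>M) = moment E + Mt n
    \<and> (\<forall>t. pot E t + ut n t \<le> pot (restr M R) t)" for n R
  define step where "step n R R' \<longleftrightarrow> R' \<subseteq> R \<and> measure M (R - R') = m n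
    \<and> (\<integral>y. indicator (R - R') y * y \<partial>M) = m n * b n" for n R R'
  \<comment> \<open>The clause for n = 0 pins the start of the chosen sequence to the whole line;
    the invariant alone would not.\<close>
  have "\<exists>R. \<forall>n. (inv n (R n) \<and> (n = 0 \<longrightarrow> R n = UNIV)) \<and> step n (R n) (R (Suc n))"
  proof (rule dependent_nat_choice)
    show "\<exists>R. inv 0 R \<and> (0 = (0::nat) \<longrightarrow> R = UNIV)"
      using mass mom le unfolding inv_def mt_def Mt_def ut_def
      by (intro exI[of _ UNIV]) (simp add: restr_UNIV)
  next
    fix R n assume "inv n R \<and> (n = 0 \<longrightarrow> R = UNIV)"
    then have R [measurable]: "R \<in> sets borel" and mR: "measure M R = mass E + mt n"
      and fR: "(\<integral>y. indicator R y * y \<partial>M) = moment E + Mt n"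
      and pR: "\<And>t. pot E t + ut n t \<le> pot (restr M R) t"
      unfolding inv_def by auto
    interpret R: first_moment_measure "restr M R" by (rule first_moment_measure_restr) fact
    obtain S where S [measurable]: "S \<in> sets borel" and mS: "measure (restr M R) S = m n"
      and fS: "(\<integral>y. indicator S y * y \<partial>restr M R) = m n * b n"
      and pS: "\<And>t. pot E t + ut (Suc n) t \<le> pot (restr (restr M R) (- S)) t"
    proof (rule R.shadow_interval[where m="m n" and b="b n" and mu="mass E + mt (Suc n)"
          and Mu="moment E + Mt (Suc n)" and u="\<lambda>t. pot E t + ut (Suc n) t"])
      show "atomless (restr M R)" using al R by (rule atomless_restr)
      show "0 \<le> m n" by fact
      show "0 \<le> mass E + mt (Suc n)" using mt_nonneg by (intro add_nonneg_nonneg) auto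
      show "m n + (mass E + mt (Suc n)) = mass (restr M R)"
        using mR mt_Suc[of n] by (simp add: mass_restr)
      show "m n * b n + (moment E + Mt (Suc n)) = moment (restr M R)"
        using fR Mt_Suc[of n] by (simp add: moment_restr)
      show "convex_on UNIV (\<lambda>t. pot E t + ut (Suc n) t)"
        unfolding ut_def
        by (intro convex_on_add E.convex_on_pot convex_on_suminf_abs m
            summable_ignore_initial_segment[OF s_abs])
      show "\<bar>moment E + Mt (Suc n) - t * (mass E + mt (Suc n))\<bar> \<le> pot E t + ut (Suc n) t" for t
      proof -
        have eq: "moment E + Mt (Suc n) - t * (mass E + mt (Suc n))
            = (moment E - t * mass E) + (Mt (Suc n) - t * mt (Suc n))"
          by (simp add: algebra_simps)
        show ?thesis unfolding eq
          by (rule order_trans[OF abs_triangle_ineq add_mono[OF E.pot_ge ut_ge]])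
      qed
      show "pot E t + ut (Suc n) t + m n * \<bar>b n - t\<bar> \<le> pot (restr M R) t" for t
        using pR[of t] ut_Suc[of n t] by simp
      \<comment> \<open>Side condition of \<open>shadow_interval\<close>: if nothing remains to be
        placed, the remaining moment is zero as well.\<close>
      assume "mass E + mt (Suc n) = 0"
      then have *: "mass E = 0" "mt (Suc n) = 0"
        using mt_nonneg[of "Suc n"] measure_nonneg[of E UNIV] by linarith+
      have "m (q + Suc n) = 0" for q
        using *(2) suminf_eq_zero_iff[OF summable_ignore_initial_segment[OF sm, of "Suc n"]] m
        unfolding mt_def by blast
      then have "Mt (Suc n) = 0" unfolding Mt_def by simp
      moreover have "moment E = 0"
      proof -
        have "AE y in E. False"
          using *(1) by (subst AE_iff_measurable[OF _ refl]) (auto simp: E.emeasure_eq_measure)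
        then have "moment E = (\<integral>y. 0 \<partial>E)" by (intro integral_cong_AE) auto
        then show ?thesis by simp
      qed
      ultimately show "moment E + Mt (Suc n) = 0" by simp
    qed blast
    have RS: "R - (R - S) = R \<inter> S" by auto
    have m_RS: "measure M (R \<inter> S) = m n" using mS by (simp add: measure_restr)
    have f_RS: "(\<integral>y. indicator (R \<inter> S) y * y \<partial>M) = m n * b n"
      using fS by (simp add: integral_restr indicator_inter_arith mult.assoc)
    have "measure M (R - S) = mass E + mt (Suc n)"
    proof -
      have "measure M (R - S) = measure M R - measure M (R \<inter> S)"
        by (simp add: finite_measure_Diff' )
      then show ?thesis using mR m_RS mt_Suc[of n] by simp
    qed
    moreover have "(\<integral>y. indicator (R - S) y * y \<partial>M) = moment E + Mt (Suc n)"
    proof -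
      have "(\<integral>y. indicator (R - S) y * y \<partial>M)
          = (\<integral>y. indicator R y * y - indicator (R \<inter> S) y * y \<partial>M)"
        by (intro Bochner_Integration.integral_cong) (auto simp: indicator_def)
      also have "\<dots> = (\<integral>y. indicator R y * y \<partial>M) - (\<integral>y. indicator (R \<inter> S) y * y \<partial>M)"
        by (intro Bochner_Integration.integral_diff integrable_indicator_mult integrable_id) auto
      finally show ?thesis using fR f_RS Mt_Suc[of n] by simp
    qed
    moreover have "restr (restr M R) (- S) = restr M (R - S)"
      by (subst restr_restr) (auto simp: Diff_eq)
    ultimately have "inv (Suc n) (R - S)" using pS unfolding inv_def by auto
    moreover have "step n R (R - S)" unfolding step_def RS using m_RS f_RS by auto
    ultimately show "\<exists>R'. (inv (Suc n) R' \<and> (Suc n = 0 \<longrightarrow> R' = UNIV)) \<and> step n R R'"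
      by blast
  qed
  then obtain R where inv: "\<And>n. inv n (R n)" and R0: "R 0 = UNIV"
    and step: "\<And>n. step n (R n) (R (Suc n))" by blast
  define S where "S n = R n - R (Suc n)" for n
  have R_meas [measurable]: "R n \<in> sets borel" for n using inv unfolding inv_def by blast
  have R_Suc: "R (Suc n) \<subseteq> R n" for n using step unfolding step_def by blast
  have R_mono: "R k \<subseteq> R n" if "n \<le> k" for n k using that R_Suc by (rule lift_Suc_antimono_le[rotated])
  have S_meas: "S n \<in> sets borel" for n unfolding S_def by measurable
  have disj: "disjoint_family S"
  proof -
    have "S k \<inter> S n = {}" if "k < n" for k n
      using R_mono[of "Suc k" n] that unfolding S_def by auto
    then show ?thesis unfolding disjoint_family_on_def by (metis inf_commute linorder_neqE_nat)
  qed
  have UN_S: "- (\<Union>n. S n) = (\<Inter>n. R n)"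
  proof (intro equalityI subsetI)
    fix y assume y: "y \<in> - (\<Union>n. S n)"
    have "y \<in> R n" for n
    proof (induction n)
      case (Suc n)
      then show ?case using y unfolding S_def by auto
    qed (simp add: R0)
    then show "y \<in> (\<Inter>n. R n)" by blast
  qed (auto simp: S_def)
  \<comment> \<open>Dropping the nonnegative tail \<open>ut n\<close> from the invariant leaves a
    bound without n on the left, and dominated convergence carries it to the intersection.\<close>
  have "pot E t \<le> pot (restr M (- (\<Union>q. S q))) t" for t
  proof (rule LIMSEQ_le_const)
    have "(\<lambda>n. \<integral>y. indicator (R n) y * \<bar>y - t\<bar> \<partial>M)
        \<longlonglongrightarrow> (\<integral>y. indicator (\<Inter>n. R n) y * \<bar>y - t\<bar> \<partial>M)"
    proof (rule integral_dominated_convergence[where w="\<lambda>y. \<bar>y - t\<bar>"])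
      show "AE y in M. (\<lambda>n. indicator (R n) y * \<bar>y - t\<bar>) \<longlonglongrightarrow> indicator (\<Inter>n. R n) y * \<bar>y - t\<bar>"
        using R_Suc by (intro AE_I2 tendsto_mult tendsto_const LIMSEQ_indicator_decseq decseq_SucI)
    qed (auto simp: indicator_def)
    then show "(\<lambda>n. pot (restr M (R n)) t) \<longlonglongrightarrow> pot (restr M (- (\<Union>q. S q))) t"
      unfolding UN_S by (simp add: pot_restr)
    have "pot E t \<le> pot (restr M (R n)) t" for n
      using inv[of n] ut_nonneg[of n t] unfolding inv_def by (auto dest!: spec[of _ t])
    then show "\<exists>N. \<forall>n\<ge>N. pot E t \<le> pot (restr M (R n)) t" by blast
  qed
  with S_meas disj step show ?thesis
    unfolding step_def S_def[symmetric] by (intro that[of S]) auto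
qed

end

section \<open>Spreading out off the contact set\<close>

lemma sums_integral_dominated:
  fixes h :: "nat \<Rightarrow> 'a \<Rightarrow> real"
  assumes w: "integrable M w" and h: "\<And>q. integrable M (h q)"
    and sums: "\<And>x. (\<lambda>q. h q x) sums g x" and le: "\<And>x N. \<bar>\<Sum>q<N. h q x\<bar> \<le> w x"
  shows "(\<lambda>q. \<integral>x. h q x \<partial>M) sums (\<integral>x. g x \<partial>M)"
proof -
  have meas: "(\<lambda>x. \<Sum>q<N. h q x) \<in> borel_measurable M" for N
    using h by (intro borel_measurable_sum) auto
  have "(\<lambda>N. \<integral>x. (\<Sum>q<N. h q x) \<partial>M) \<longlonglongrightarrow> (\<integral>x. g x \<partial>M)"
  proof (rule integral_dominated_convergence[where w=w])
    show "g \<in> borel_measurable M"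
      by (rule borel_measurable_LIMSEQ_real[OF _ meas]) (use sums in \<open>auto simp: sums_def\<close>)
  qed (use w sums le meas in \<open>auto simp: sums_def\<close>)
  moreover have "(\<integral>x. (\<Sum>q<N. h q x) \<partial>M) = (\<Sum>q<N. \<integral>x. h q x \<partial>M)" for N
    by (rule Bochner_Integration.integral_sum) (use h in auto)
  ultimately show ?thesis unfolding sums_def by simp
qed

lemma sum_indicator_disjoint_le_1:
  fixes S :: "nat \<Rightarrow> 'a set"
  assumes "disjoint_family S"
  shows "(\<Sum>q<N. indicator (S q) x :: real) \<le> 1"
proof -
  have "(\<lambda>q. indicator (S q) x) sums (indicator (\<Union>q. S q) x :: real)"
    using assms by (intro indicator_sums) (auto simp: disjoint_family_on_def)
  then have "(\<Sum>q<N. indicator (S q) x :: real) \<le> indicator (\<Union>q. S q) x"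
    by (simp add: sums_iff) (metis indicator_pos_le sum_le_suminf finite_lessThan)
  also have "\<dots> \<le> 1" by (simp add: indicator_def)
  finally show ?thesis .
qed

lemma sums_integral_UN:
  fixes f :: "'a \<Rightarrow> real"
  assumes f: "integrable M f" and S: "\<And>q. S q \<in> sets M" "disjoint_family S"
  shows "(\<lambda>q. \<integral>x. indicator (S q) x * f x \<partial>M) sums (\<integral>x. indicator (\<Union>q. S q) x * f x \<partial>M)"
proof (rule sums_integral_dominated[where w="\<lambda>x. \<bar>f x\<bar>"])
  show "integrable M (\<lambda>x. indicator (S q) x * f x)" for q
    using integrable_real_mult_indicator[OF S(1) f] by (simp add: mult.commute)
  show "(\<lambda>q. indicator (S q) x * f x) sums (indicator (\<Union>q. S q) x * f x)" for x
    using S(2) by (intro sums_mult2 indicator_sums) (auto simp: disjoint_family_on_def)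
  show "\<bar>\<Sum>q<N. indicator (S q) x * f x\<bar> \<le> \<bar>f x\<bar>" for x N
    using sum_indicator_disjoint_le_1[OF S(2), of x N]
    by (simp add: sum_distrib_right[symmetric] abs_mult mult_left_le_one_le sum_nonneg)
qed (use f in auto)

text \<open>For maps assembled from countably many branches; \<open>h\<close> equal to 1 gives their
  law and \<open>h\<close> the identity their barycentres.\<close>

lemma glue_sums:
  fixes F :: "nat \<Rightarrow> real \<Rightarrow> real" and h :: "real \<Rightarrow> real"
  assumes M: "finite_borel_measure M" and I [measurable]: "I \<in> measurable borel (count_space UNIV)"
    and F [measurable]: "\<And>n. F n \<in> borel_measurable borel"
    and h: "integrable M h" and B [measurable]: "B \<in> sets borel"
  shows "(\<lambda>n. \<integral>y. indicator {y. I y = n} y * (indicator B (F n y) * h y) \<partial>M)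
    sums (\<integral>y. indicator B (F (I y) y) * h y \<partial>M)"
proof -
  interpret finite_borel_measure M by fact
  have f [measurable]: "(\<lambda>y. F (I y) y) \<in> borel_measurable borel"
    by (rule measurable_compose_countable[OF F I])
  have "integrable M (\<lambda>y. indicator ((\<lambda>y. F (I y) y) -` B) y * h y)"
    using integrable_real_mult_indicator[of "(\<lambda>y. F (I y) y) -` B" M h] h
      measurable_sets[OF f B] by (simp add: mult.commute)
  then have "(\<lambda>n. \<integral>y. indicator {y. I y = n} y * (indicator B (F (I y) y) * h y) \<partial>M)
      sums (\<integral>y. indicator (\<Union>n. {y. I y = n}) y * (indicator B (F (I y) y) * h y) \<partial>M)"
    by (intro sums_integral_UN) (auto simp: disjoint_family_on_def indicator_def if_distrib cong: if_cong)
  moreover have "(\<integral>y. indicator {y. I y = n} y * (indicator B (F (I y) y) * h y) \<partial>M)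
      = (\<integral>y. indicator {y. I y = n} y * (indicator B (F n y) * h y) \<partial>M)" for n
    by (intro Bochner_Integration.integral_cong) (auto simp: indicator_def)
  moreover have "(\<Union>n. {y. I y = n}) = UNIV" by auto
  ultimately show ?thesis by simp
qed

section \<open>Kernels that move points to atoms\<close>

text \<open>\<open>k q x\<close> is the probability of moving \<open>x\<close> to the atom \<open>b q\<close>; the points of \<open>Z\<close> do not move.\<close>

definition spreads :: "real set \<Rightarrow> (nat \<Rightarrow> real \<Rightarrow> real) \<Rightarrow> (nat \<Rightarrow> real) \<Rightarrow> bool" where
  "spreads Z k b \<longleftrightarrow> (\<forall>q. k q \<in> borel_measurable borel) \<and> (\<forall>q x. 0 \<le> k q x) \<and>
     (\<forall>q. \<forall>x\<in>Z. k q x = 0) \<and> (\<forall>q x. k q x \<noteq> 0 \<longrightarrow> \<bar>b q - x\<bar> \<le> 1) \<and>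
     (\<forall>x. x \<notin> Z \<longrightarrow> ((\<lambda>q. k q x) has_sum 1) UNIV \<and> ((\<lambda>q. k q x * b q) has_sum x) UNIV)"

lemma spreads_partial_sum:
  assumes "spreads Z k b" "finite Q"
  shows "(\<Sum>q\<in>Q. k q x) \<le> 1"
proof (cases "x \<in> Z")
  case False
  then have "((\<lambda>q. k q x) has_sum 1) UNIV" using assms unfolding spreads_def by blast
  with has_sum_finite[OF assms(2), of "\<lambda>q. k q x"] show ?thesis
    by (rule has_sum_mono2) (use assms in \<open>auto simp: spreads_def\<close>)
qed (use assms in \<open>auto simp: spreads_def\<close>)

lemma spreads_le_1: "spreads Z k b \<Longrightarrow> k q x \<le> 1"
  using spreads_partial_sum[of Z k b "{q}" x] by simp

text \<open>This is where the bound |b q - x| \<le> 1 of \<open>spreads\<close> pays off: a function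
  of the atoms that is controlled near x gets a majorant independent of the number of terms, which
  \<open>sums_integral_dominated\<close> asks for.\<close>

lemma spreads_partial_abs_sum:
  assumes sp: "spreads Z k b" and v: "\<And>q. \<bar>b q - x\<bar> \<le> 1 \<Longrightarrow> \<bar>v q\<bar> \<le> W" and W: "0 \<le> W"
  shows "\<bar>\<Sum>q<N. k q x * v q\<bar> \<le> W"
proof -
  have k: "0 \<le> k q x" for q using sp unfolding spreads_def by blast
  have "\<bar>\<Sum>q<N. k q x * v q\<bar> \<le> (\<Sum>q<N. k q x * W)"
  proof (intro order_trans[OF sum_abs] sum_mono)
    fix q show "\<bar>k q x * v q\<bar> \<le> k q x * W"
      using k[of q] v[of q] sp unfolding spreads_def
      by (cases "k q x = 0") (auto simp: abs_mult intro!: mult_left_mono)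
  qed
  also have "\<dots> \<le> 1 * W"
    unfolding sum_distrib_right[symmetric]
    using spreads_partial_sum[OF sp finite_lessThan] W by (intro mult_right_mono)
  finally show ?thesis by simp
qed

lemma (in first_moment_measure) integrable_kernel:
  assumes "k \<in> borel_measurable borel" "\<And>x. 0 \<le> k x" "\<And>x. k x \<le> (1::real)"
  shows "integrable M (\<lambda>x. k x * v)"
proof (rule integrable_linear_growth[where C="\<bar>v\<bar>" and D=0])
  show "\<bar>k x * v\<bar> \<le> \<bar>v\<bar> + 0 * \<bar>x\<bar>" for x
    using assms(2,3)[of x] by (simp add: abs_mult mult_left_le_one_le)
qed (use assms in measurable)

text \<open>The second identity yields the martingale property of glued maps: on the set of an atom
  Y averages to \<open>b q\<close>, and averaging \<open>b q\<close> over the kernel of x returns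
  x.\<close>

lemma (in first_moment_measure) spreads_sums:
  assumes sp: "spreads Z k b" and Z [measurable]: "Z \<in> sets borel" and B [measurable]: "B \<in> sets borel"
  shows "(\<lambda>q. \<integral>x. indicator B x * k q x \<partial>M) sums (\<integral>x. indicator B x * indicator (- Z) x \<partial>M)"
    and "(\<lambda>q. b q * (\<integral>x. indicator B x * k q x \<partial>M))
      sums (\<integral>x. indicator B x * (indicator (- Z) x * x) \<partial>M)"
proof -
  have km [measurable]: "k q \<in> borel_measurable borel" for q using sp unfolding spreads_def by blast
  have k0: "0 \<le> k q x" for q x using sp unfolding spreads_def by blast
  have sum1: "(\<lambda>q. k q x) sums indicator (- Z) x" for x
    using sp unfolding spreads_def by (cases "x \<in> Z") (auto intro: has_sum_imp_sums)
  have sumb: "(\<lambda>q. k q x * b q) sums (indicator (- Z) x * x)" for x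
    using sp unfolding spreads_def by (cases "x \<in> Z") (auto intro: has_sum_imp_sums)
  have int: "integrable M (\<lambda>x. indicator B x * k q x * v)" for q v
    by (rule integrable_kernel) (use k0 spreads_le_1[OF sp] in \<open>auto simp: indicator_def\<close>)
  have "(\<lambda>q. \<integral>x. indicator B x * k q x \<partial>M) sums (\<integral>x. indicator B x * indicator (- Z) x \<partial>M)"
  proof (rule sums_integral_dominated[where w="\<lambda>_. 1"])
    show "integrable M (\<lambda>x. indicator B x * k q x)" for q using int[of q 1] by simp
    show "\<bar>\<Sum>q<N. indicator B x * k q x\<bar> \<le> 1" for x N
      using spreads_partial_abs_sum[OF sp, of x "\<lambda>_. 1" 1 N]
      by (auto simp: sum_distrib_left[symmetric] abs_mult indicator_def)
  qed (intro sums_mult sum1 | simp)+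
  then show "(\<lambda>q. \<integral>x. indicator B x * k q x \<partial>M) sums (\<integral>x. indicator B x * indicator (- Z) x \<partial>M)" .
  have "(\<lambda>q. \<integral>x. indicator B x * k q x * b q \<partial>M)
      sums (\<integral>x. indicator B x * (indicator (- Z) x * x) \<partial>M)"
  proof (rule sums_integral_dominated[where w="\<lambda>x. \<bar>x\<bar> + 1"])
    show "integrable M (\<lambda>x. \<bar>x\<bar> + 1)" using integrable_id by simp
    show "integrable M (\<lambda>x. indicator B x * k q x * b q)" for q by (rule int)
    show "(\<lambda>q. indicator B x * k q x * b q) sums (indicator B x * (indicator (- Z) x * x))" for x
      unfolding mult.assoc by (intro sums_mult sumb)
    show "\<bar>\<Sum>q<N. indicator B x * k q x * b q\<bar> \<le> \<bar>x\<bar> + 1" for x N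
      using spreads_partial_abs_sum[OF sp, of x b "\<bar>x\<bar> + 1" N]
      by (auto simp: sum_distrib_left[symmetric] abs_mult indicator_def mult.assoc)
  qed
  then show "(\<lambda>q. b q * (\<integral>x. indicator B x * k q x \<partial>M))
      sums (\<integral>x. indicator B x * (indicator (- Z) x * x) \<partial>M)"
    by (simp add: mult.commute)
qed

text \<open>\<open>P\<close> will be the gap between two potentials. Moving mass to the endpoints of intervals that
  are this short raises the lower potential by at most \<open>P\<close>.\<close>

lemma tents:
  fixes P :: "real \<Rightarrow> real"
  assumes cont: "continuous_on UNIV P" and P: "\<And>x. 0 \<le> P x" and d: "0 < d"
  obtains k b where "spreads {x. P x = 0} k b"
    and "\<And>x. P x \<noteq> 0 \<Longrightarrow> \<exists>a c. a \<le> x \<and> x \<le> c \<and> a < c \<and> (\<forall>t\<in>{a..c}. (c - a) * d \<le> P t) \<and>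
        (\<forall>\<phi>. ((\<lambda>q. k q x * \<phi> (b q)) has_sum ((c - x) / (c - a) * \<phi> a + (x - a) / (c - a) * \<phi> c)) UNIV)"
proof -
  define A C where "A n = (of_rat (fst (from_nat n :: rat \<times> rat)) :: real)"
    and "C n = (of_rat (snd (from_nat n :: rat \<times> rat)) :: real)" for n
  \<comment> \<open>Length at most 1 gives the nearness demanded by \<open>spreads\<close>; length
    times d below the gap P limits the rise of the potential.\<close>
  define good where "good n \<longleftrightarrow> A n < C n \<and> C n - A n \<le> 1 \<and> (\<forall>t\<in>{A n..C n}. (C n - A n) * d \<le> P t)" for n
  define K where "K n = (if good n then {A n..C n} else {})" for n
  define E where "E = disjointed K"
  \<comment> \<open>Atom 2n is the left and atom 2n + 1 the right end of interval n, with the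
    barycentric coordinates of x as weights. Disjointing the intervals assigns each x to just one of
    them, whose two ends are kept unchanged.\<close>
  define k where "k q x = (indicator (E (q div 2)) x :: real) * (if even q
      then (C (q div 2) - x) / (C (q div 2) - A (q div 2))
      else (x - A (q div 2)) / (C (q div 2) - A (q div 2)))" for q x
  define b where "b q = (if even q then A (q div 2) else C (q div 2))" for q
  have E_K: "E n \<subseteq> K n" for n unfolding E_def by (rule disjointed_subset)
  have K_meas: "K n \<in> sets borel" for n unfolding K_def by simp
  have E_meas [measurable]: "E n \<in> sets borel" for n
    unfolding E_def using K_meas sets.range_disjointed_sets[of K borel] by blast
  have E_good: "good n \<and> A n \<le> x \<and> x \<le> C n" if "x \<in> E n" for n x
    using that E_K[of n] unfolding K_def by (auto split: if_splits)
  have k_meas [measurable]: "k q \<in> borel_measurable borel" for q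
    unfolding k_def by (cases "even q") simp_all
  have k_nonneg: "0 \<le> k q x" for q x
    using E_good[of x "q div 2"] unfolding k_def good_def by (auto simp: indicator_def)
  have k_near: "\<bar>b q - x\<bar> \<le> 1" if "k q x \<noteq> 0" for q x
  proof -
    have "x \<in> E (q div 2)" using that unfolding k_def by (auto simp: indicator_def split: if_splits)
    then show ?thesis using E_good[of x "q div 2"] unfolding b_def good_def by auto
  qed
  have k_zero: "k q x = 0" if "P x = 0" for q x
  proof -
    have "x \<notin> E (q div 2)"
    proof
      assume "x \<in> E (q div 2)"
      from E_good[OF this] have "A (q div 2) < C (q div 2)" "(C (q div 2) - A (q div 2)) * d \<le> 0"
        using that unfolding good_def by force+
      then show False using d by (simp add: mult_le_0_iff)
    qed
    then show ?thesis unfolding k_def by simp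
  qed
  have main: "\<exists>a c. a \<le> x \<and> x \<le> c \<and> a < c \<and> (\<forall>t\<in>{a..c}. (c - a) * d \<le> P t) \<and>
        (\<forall>\<phi>. ((\<lambda>q. k q x * \<phi> (b q)) has_sum ((c - x) / (c - a) * \<phi> a + (x - a) / (c - a) * \<phi> c)) UNIV)"
    if "P x \<noteq> 0" for x
  proof -
    have Px: "0 < P x" using that P[of x] by simp
    have "isCont P x" using cont by (simp add: continuous_on_eq_continuous_at)
    then obtain e where e: "0 < e" "\<And>t. dist t x < e \<Longrightarrow> dist (P t) (P x) < P x / 2"
      using Px unfolding continuous_at_eps_delta by (meson half_gt_zero)
    \<comment> \<open>Within distance e of x the gap exceeds P x / 2. The interval is shorter than 2
      * r, so 1 / 2 keeps its length below 1 and P x / (4 * d) keeps length times d below P x /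
      2.\<close>
    define r where "r = min e (min (1/2) (P x / (4 * d)))"
    have r: "0 < r" "r \<le> e" "r \<le> 1 / 2" "r \<le> P x / (4 * d)" using e(1) Px d by (auto simp: r_def)
    obtain a where a: "x - r < of_rat a" "of_rat a < x" using of_rat_dense[of "x - r" x] r by auto
    obtain c where c: "x < of_rat c" "of_rat c < x + r" using of_rat_dense[of x "x + r"] r by auto
    define n where "n = to_nat (a, c)"
    have AC: "A n = of_rat a" "C n = of_rat c" unfolding A_def C_def n_def by simp_all
    have "good n" unfolding good_def AC
    proof (intro conjI ballI)
      fix t assume t: "t \<in> {real_of_rat a..real_of_rat c}"
      then have "dist t x < e" using a c r by (auto simp: dist_real_def)
      then have "P x / 2 < P t" using e(2)[of t] unfolding dist_real_def by linarith
      moreover have "(real_of_rat c - real_of_rat a) * d \<le> (2 * r) * d"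
        using a c d by (intro mult_right_mono) auto
      moreover have "(2 * r) * d \<le> P x / 2" using r(4) d by (simp add: field_simps)
      ultimately show "(real_of_rat c - real_of_rat a) * d \<le> P t" by linarith
    qed (use a c r in auto)
    then have "x \<in> K n" using a c unfolding K_def AC by auto
    then have "x \<in> (\<Union>n. E n)" unfolding E_def UN_disjointed_eq by blast
    then obtain n where n: "x \<in> E n" by blast
    have n_unique: "x \<notin> E k" if "k \<noteq> n" for k
      using n that disjoint_family_disjointed[of K] unfolding E_def[symmetric] disjoint_family_on_def by blast
    have "((\<lambda>q. k q x * \<phi> (b q)) has_sum
        ((C n - x) / (C n - A n) * \<phi> (A n) + (x - A n) / (C n - A n) * \<phi> (C n))) UNIV" for \<phi>
    proof -
      have *: "((\<lambda>q. k q x * \<phi> (b q)) has_sum (\<Sum>q\<in>{2 * n, Suc (2 * n)}. k q x * \<phi> (b q))) {2 * n, Suc (2 * n)}"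
        by (rule has_sum_finite) simp
      have "k q x = 0" if "q \<notin> {2 * n, Suc (2 * n)}" for q
      proof -
        have "q div 2 \<noteq> n" using that by auto
        then show ?thesis unfolding k_def using n_unique by simp
      qed
      then have "((\<lambda>q. k q x * \<phi> (b q)) has_sum (\<Sum>q\<in>{2 * n, Suc (2 * n)}. k q x * \<phi> (b q))) UNIV"
        using * by (subst has_sum_cong_neutral[of "{2 * n, Suc (2 * n)}" UNIV _ "\<lambda>q. k q x * \<phi> (b q)"]) auto
      then show ?thesis using n unfolding k_def b_def by simp
    qed
    moreover have "A n \<le> x \<and> x \<le> C n \<and> A n < C n \<and> (\<forall>t\<in>{A n..C n}. (C n - A n) * d \<le> P t)"
      using E_good[OF n] unfolding good_def by auto
    ultimately show ?thesis by blast
  qed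
  have "spreads {x. P x = 0} k b"
    unfolding spreads_def
  proof (intro conjI allI impI ballI)
    fix x assume "x \<notin> {x. P x = 0}"
    then obtain a c where ac: "a \<le> x" "x \<le> c" "a < c"
      and *: "\<And>\<phi>. ((\<lambda>q. k q x * \<phi> (b q)) has_sum ((c - x) / (c - a) * \<phi> a + (x - a) / (c - a) * \<phi> c)) UNIV"
      using main[of x] by blast
    have "(c - x) / (c - a) + (x - a) / (c - a) = 1"
      using ac by (simp add: add_divide_distrib[symmetric])
    then show "((\<lambda>q. k q x) has_sum 1) UNIV" using *[of "\<lambda>_. 1"] by simp
    have "(c - x) / (c - a) * a + (x - a) / (c - a) * c = x"
    proof -
      have "(c - x) / (c - a) * a + (x - a) / (c - a) * c = ((c - x) * a + (x - a) * c) / (c - a)"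
        by (simp add: add_divide_distrib)
      also have "(c - x) * a + (x - a) * c = x * (c - a)" by (simp add: algebra_simps)
      finally show ?thesis using ac by simp
    qed
    then show "((\<lambda>q. k q x * b q) has_sum x) UNIV" using *[of "\<lambda>z. z"] by simp
  qed (use k_nonneg k_near k_zero k_meas in auto)
  then show ?thesis using main by (rule that)
qed

text \<open>\<open>S q\<close> is the share of \<open>\<beta>\<close> that is assigned to the atom at \<open>b q\<close>.\<close>

definition pieces :: "real measure \<Rightarrow> real measure \<Rightarrow> real set \<Rightarrow> (nat \<Rightarrow> real set) \<Rightarrow>
    (nat \<Rightarrow> real \<Rightarrow> real) \<Rightarrow> (nat \<Rightarrow> real) \<Rightarrow> bool" where
  "pieces \<alpha> \<beta> Z S k b \<longleftrightarrow> Z \<in> sets borel \<and> spreads Z k b \<and>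
     (\<forall>q. S q \<in> sets borel) \<and> disjoint_family S \<and>
     (\<forall>q. measure \<beta> (S q) = (\<integral>x. k q x \<partial>\<alpha>)) \<and>
     (\<forall>q. (\<integral>y. indicator (S q) y * y \<partial>\<beta>) = b q * (\<integral>x. k q x \<partial>\<alpha>))"

text \<open>The series of masses, and that of moments, of the \<open>S q\<close> is summed twice:
  over the disjoint sets and, by \<open>spreads_sums\<close>, over the kernel.\<close>

lemma (in first_moment_measure) pieces_compl:
  assumes p: "pieces \<alpha> M Z S k b" and \<alpha>: "first_moment_measure \<alpha>"
    and "mass \<alpha> = mass M" "moment \<alpha> = moment M"
  shows "mass (restr M (- (\<Union>q. S q))) = mass (restr \<alpha> Z)"
    and "moment (restr M (- (\<Union>q. S q))) = moment (restr \<alpha> Z)"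
proof -
  interpret \<alpha>: first_moment_measure \<alpha> by fact
  have sp: "spreads Z k b" and Z [measurable]: "Z \<in> sets borel" and S [measurable]: "\<And>q. S q \<in> sets borel"
    and disj: "disjoint_family S" and mS: "\<And>q. measure M (S q) = (\<integral>x. k q x \<partial>\<alpha>)"
    and fS: "\<And>q. (\<integral>y. indicator (S q) y * y \<partial>M) = b q * (\<integral>x. k q x \<partial>\<alpha>)"
    using p unfolding pieces_def by auto
  have "(\<lambda>q. measure M (S q)) sums measure M (\<Union>q. S q)"
    using disj by (intro finite_measure_UNION) auto
  moreover have "(\<lambda>q. measure M (S q)) sums measure \<alpha> (- Z)"
    using \<alpha>.spreads_sums(1)[OF sp Z, of UNIV] unfolding mS by simp
  ultimately have "measure M (\<Union>q. S q) = measure \<alpha> (- Z)" by (rule sums_unique2)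
  moreover have "measure M (- (\<Union>q. S q)) = mass M - measure M (\<Union>q. S q)"
    using finite_measure_compl[of "\<Union>q. S q"] by (simp add: Compl_eq_Diff_UNIV)
  moreover have "measure \<alpha> (- Z) = mass \<alpha> - measure \<alpha> Z"
    using \<alpha>.finite_measure_compl[of Z] by (simp add: Compl_eq_Diff_UNIV)
  ultimately show "mass (restr M (- (\<Union>q. S q))) = mass (restr \<alpha> Z)"
    using assms by (simp add: mass_restr \<alpha>.mass_restr)
  have "(\<lambda>q. \<integral>y. indicator (S q) y * y \<partial>M) sums (\<integral>y. indicator (\<Union>q. S q) y * y \<partial>M)"
    using disj by (intro sums_integral_UN integrable_id) auto
  moreover have "(\<lambda>q. \<integral>y. indicator (S q) y * y \<partial>M) sums (\<integral>x. indicator (- Z) x * x \<partial>\<alpha>)"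
    using \<alpha>.spreads_sums(2)[OF sp Z, of UNIV] unfolding fS by simp
  ultimately have "(\<integral>y. indicator (\<Union>q. S q) y * y \<partial>M) = (\<integral>x. indicator (- Z) x * x \<partial>\<alpha>)"
    by (rule sums_unique2)
  then show "moment (restr M (- (\<Union>q. S q))) = moment (restr \<alpha> Z)"
    using integral_split_compl[OF integrable_id, of "\<Union>q. S q"]
      \<alpha>.integral_split_compl[OF \<alpha>.integrable_id, of Z] assms
    by (simp add: moment_restr \<alpha>.moment_restr)
qed

text \<open>Off the contact set \<open>Z\<close> of the potentials, \<open>\<alpha>\<close> is first spread out to a discrete measure that
  stays below \<open>\<beta>\<close> in convex order, whose atoms are then embedded into \<open>\<beta>\<close> by successive shadows.
  On \<open>Z\<close> there is no slack at all, so what is left of \<open>\<beta>\<close> must be \<open>\<alpha>\<close> itself.\<close>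

lemma convex_order_pieces:
  assumes \<alpha>: "first_moment_measure \<alpha>" and \<beta>: "first_moment_measure \<beta>" and al: "atomless \<beta>"
    and mass: "mass \<alpha> = mass \<beta>" and mom: "moment \<alpha> = moment \<beta>"
    and le: "\<And>t. pot \<alpha> t \<le> pot \<beta> t"
  obtains Z S k b where "pieces \<alpha> \<beta> Z S k b" "restr \<beta> (- (\<Union>q. S q)) = restr \<alpha> Z"
proof -
  interpret \<alpha>: first_moment_measure \<alpha> by fact
  interpret \<beta>: first_moment_measure \<beta> by fact
  define P where "P t = pot \<beta> t - pot \<alpha> t" for t
  \<comment> \<open>Spreading raises the integrand by at most P t / d at each point, hence the
    potential by at most \<open>mass \<alpha>\<close> * P t / d, which is below P t. Adding 1 keeps
    d positive when \<alpha> is zero.\<close>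
  define d where "d = mass \<alpha> + 1"
  have d: "0 < d" unfolding d_def using measure_nonneg[of \<alpha> UNIV] by linarith
  have P_cont: "continuous_on UNIV P"
    unfolding P_def by (intro continuous_on_diff \<alpha>.continuous_on_pot \<beta>.continuous_on_pot)
  have P_nonneg: "0 \<le> P t" for t using le unfolding P_def by simp
  define Z where "Z = {x. P x = 0}"
  obtain k b where sp: "spreads Z k b"
    and tent: "\<And>x. P x \<noteq> 0 \<Longrightarrow> \<exists>a c. a \<le> x \<and> x \<le> c \<and> a < c \<and> (\<forall>t\<in>{a..c}. (c - a) * d \<le> P t) \<and>
        (\<forall>\<phi>. ((\<lambda>q. k q x * \<phi> (b q)) has_sum ((c - x) / (c - a) * \<phi> a + (x - a) / (c - a) * \<phi> c)) UNIV)"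
    using tents[OF P_cont P_nonneg d] unfolding Z_def by blast
  have "closed Z"
    unfolding Z_def by (intro closed_Collect_eq P_cont) auto
  then have Z [measurable]: "Z \<in> sets borel" by simp
  have km [measurable]: "k q \<in> borel_measurable borel" for q using sp unfolding spreads_def by blast
  have k0: "0 \<le> k q x" for q x using sp unfolding spreads_def by blast
  define m where "m q = (\<integral>x. k q x \<partial>\<alpha>)" for q
  have m0: "0 \<le> m q" for q unfolding m_def using k0 by simp
  define g where "g t x = (\<Sum>q. k q x * \<bar>b q - t\<bar>)" for t x
  \<comment> \<open>The lower bound is convexity. For the upper one, |z - t| is affine on [a, c]
    unless t lies inside, and in that case the mean is at most c - a, hence at most P t / d.\<close>
  have g_tent: "(\<lambda>q. k q x * \<bar>b q - t\<bar>) sums g t x \<and> indicator (- Z) x * \<bar>x - t\<bar> \<le> g t x \<and>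
      g t x \<le> indicator (- Z) x * \<bar>x - t\<bar> + P t / d" for t x
  proof (cases "x \<in> Z")
    case True
    then have "k q x = 0" for q using sp unfolding spreads_def by blast
    then show ?thesis using True d P_nonneg unfolding g_def by simp
  next
    case False
    then obtain a c where ac: "a \<le> x" "x \<le> c" "a < c" and P_ac: "\<And>t. t \<in> {a..c} \<Longrightarrow> (c - a) * d \<le> P t"
      and *: "\<And>\<phi>. ((\<lambda>q. k q x * \<phi> (b q)) has_sum ((c - x) / (c - a) * \<phi> a + (x - a) / (c - a) * \<phi> c)) UNIV"
      using tent[of x] unfolding Z_def by blast
    define l where "l = (x - a) / (c - a)"
    have l: "0 \<le> l" "l \<le> 1" "(c - x) / (c - a) = 1 - l"
      using ac unfolding l_def by (auto simp: diff_divide_distrib[symmetric] divide_simps)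
    have x_eq: "x = (1 - l) * a + l * c"
    proof -
      have "l * (c - a) = x - a" using ac unfolding l_def by simp
      then show ?thesis by (simp add: algebra_simps)
    qed
    have s: "(\<lambda>q. k q x * \<bar>b q - t\<bar>) sums ((1 - l) * \<bar>a - t\<bar> + l * \<bar>c - t\<bar>)"
      using *[of "\<lambda>z. \<bar>z - t\<bar>"] l(3) unfolding l_def[symmetric] by (intro has_sum_imp_sums) simp
    then have g: "g t x = (1 - l) * \<bar>a - t\<bar> + l * \<bar>c - t\<bar>"
      unfolding g_def by (rule sums_unique[symmetric])
    have lower: "\<bar>x - t\<bar> \<le> g t x"
      using abs_convex_combination_le[OF l(1,2), of t a c] unfolding g x_eq[symmetric]
      by (simp add: abs_minus_commute)
    have upper: "g t x \<le> \<bar>x - t\<bar> + P t / d"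
    proof (cases "t \<in> {a..c}")
      case True
      have "(1 - l) * \<bar>a - t\<bar> + l * \<bar>c - t\<bar> \<le> (1 - l) * (c - a) + l * (c - a)"
        using True l by (intro add_mono mult_left_mono) auto
      also have "\<dots> = c - a" by (simp add: algebra_simps)
      also have "\<dots> \<le> P t / d" using P_ac[OF True] d by (simp add: field_simps)
      finally show ?thesis unfolding g by linarith
    next
      case False
      then consider "t < a" | "c < t" by force
      then have "g t x = \<bar>x - t\<bar>"
      proof cases
        case 1
        then have "\<bar>a - t\<bar> = a - t" "\<bar>c - t\<bar> = c - t" "\<bar>x - t\<bar> = x - t" using ac by auto
        then show ?thesis unfolding g by (simp add: x_eq algebra_simps)
      next
        case 2
        then have "\<bar>a - t\<bar> = t - a" "\<bar>c - t\<bar> = t - c" "\<bar>x - t\<bar> = t - x" using ac by auto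
        then show ?thesis unfolding g by (simp add: x_eq algebra_simps)
      qed
      then show ?thesis using P_nonneg[of t] d by simp
    qed
    show ?thesis using s lower upper False unfolding g by simp
  qed
  have int_k: "integrable \<alpha> (\<lambda>x. k q x * v)" for q v
    using k0 spreads_le_1[OF sp] by (intro \<alpha>.integrable_kernel) auto
  have sums_m: "m sums measure \<alpha> (- Z)"
    using \<alpha>.spreads_sums(1)[OF sp Z, of UNIV] unfolding m_def by simp
  have sums_mb: "(\<lambda>q. m q * b q) sums (\<integral>x. indicator (- Z) x * x \<partial>\<alpha>)"
    using \<alpha>.spreads_sums(2)[OF sp Z, of UNIV] unfolding m_def by (simp add: mult.commute)
  have sums_abs: "(\<lambda>q. m q * \<bar>b q - t\<bar>) sums (\<integral>x. g t x \<partial>\<alpha>)" for t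
  proof -
    have "(\<lambda>q. \<integral>x. k q x * \<bar>b q - t\<bar> \<partial>\<alpha>) sums (\<integral>x. g t x \<partial>\<alpha>)"
    proof (rule sums_integral_dominated[where w="\<lambda>x. \<bar>x - t\<bar> + 1"])
      show "integrable \<alpha> (\<lambda>x. \<bar>x - t\<bar> + 1)" by simp
      show "\<bar>\<Sum>q<N. k q x * \<bar>b q - t\<bar>\<bar> \<le> \<bar>x - t\<bar> + 1" for x N
        by (rule spreads_partial_abs_sum[OF sp]) auto
    qed (use g_tent int_k in auto)
    then show ?thesis unfolding m_def by simp
  qed
  have g_meas: "g t \<in> borel_measurable borel" for t
    unfolding g_def by measurable
  have int_Z: "integrable \<alpha> (\<lambda>x. indicator (- Z) x * \<bar>x - t\<bar>)" for t
    by (intro \<alpha>.integrable_indicator_mult) auto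
  have int_g: "integrable \<alpha> (g t)" for t
  proof (rule Bochner_Integration.integrable_bound)
    show "integrable \<alpha> (\<lambda>x. \<bar>x - t\<bar> + P t / d)" by simp
    show "g t \<in> borel_measurable \<alpha>" using g_meas by simp
    show "AE x in \<alpha>. norm (g t x) \<le> norm (\<bar>x - t\<bar> + P t / d)"
    proof (rule AE_I2)
      fix x
      have "0 \<le> indicator (- Z) x * \<bar>x - t\<bar>" "indicator (- Z) x * \<bar>x - t\<bar> \<le> \<bar>x - t\<bar>" 
        by (auto simp: indicator_def)
      then show "norm (g t x) \<le> norm (\<bar>x - t\<bar> + P t / d)" using g_tent[of x t] unfolding real_norm_def by linarith
    qed
  qed
  have g_lower: "(\<integral>x. indicator (- Z) x * \<bar>x - t\<bar> \<partial>\<alpha>) \<le> (\<integral>x. g t x \<partial>\<alpha>)" for t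
    using g_tent by (intro integral_mono int_Z int_g) auto
  have g_upper: "(\<integral>x. g t x \<partial>\<alpha>) \<le> (\<integral>x. indicator (- Z) x * \<bar>x - t\<bar> \<partial>\<alpha>) + P t" for t
  proof -
    have "(\<integral>x. g t x \<partial>\<alpha>) \<le> (\<integral>x. indicator (- Z) x * \<bar>x - t\<bar> + P t / d \<partial>\<alpha>)"
      using g_tent by (intro integral_mono int_g) (auto intro: int_Z)
    also have "\<dots> = (\<integral>x. indicator (- Z) x * \<bar>x - t\<bar> \<partial>\<alpha>) + mass \<alpha> * (P t / d)"
      by (subst Bochner_Integration.integral_add[OF int_Z]) auto
    also have "mass \<alpha> * (P t / d) \<le> P t"
      using P_nonneg[of t] d unfolding d_def by (simp add: field_simps)
    finally show ?thesis by simp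
  qed
  interpret \<alpha>Z: first_moment_measure "restr \<alpha> Z" by (rule \<alpha>.first_moment_measure_restr) fact
  have pot_\<alpha>: "pot \<alpha> t = pot (restr \<alpha> Z) t + (\<integral>x. indicator (- Z) x * \<bar>x - t\<bar> \<partial>\<alpha>)" for t
    using \<alpha>.pot_restr_compl[OF Z, of t] by (simp add: \<alpha>.pot_restr)
  obtain S where S [measurable]: "\<And>q. S q \<in> sets borel" and disj: "disjoint_family S"
    and mS: "\<And>q. measure \<beta> (S q) = m q" and fS: "\<And>q. (\<integral>y. indicator (S q) y * y \<partial>\<beta>) = m q * b q"
    and potS: "\<And>t. pot (restr \<alpha> Z) t \<le> pot (restr \<beta> (- (\<Union>q. S q))) t"
  proof (rule \<beta>.barcode[OF al \<alpha>Z.first_moment_measure_axioms, of m b])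
    show "summable m" using sums_m by (rule sums_summable)
    show "summable (\<lambda>q. m q * \<bar>b q\<bar>)" using sums_abs[of 0] by (auto intro: sums_summable)
    have "measure \<alpha> (- Z) = mass \<alpha> - measure \<alpha> Z"
      using \<alpha>.finite_measure_compl[of Z] by (simp add: Compl_eq_Diff_UNIV)
    then show "mass (restr \<alpha> Z) + (\<Sum>q. m q) = mass \<beta>"
      using sums_unique[OF sums_m] mass by (simp add: \<alpha>.mass_restr)
    show "moment (restr \<alpha> Z) + (\<Sum>q. m q * b q) = moment \<beta>"
      using sums_unique[OF sums_mb] mom \<alpha>.integral_split_compl[OF \<alpha>.integrable_id Z]
      by (simp add: \<alpha>.moment_restr)
    show "pot (restr \<alpha> Z) t + (\<Sum>q. m q * \<bar>b q - t\<bar>) \<le> pot \<beta> t" for t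
      using sums_unique[OF sums_abs[of t]] g_upper[of t] pot_\<alpha>[of t] unfolding P_def by simp
  qed (use m0 in blast)+
  let ?L = "- (\<Union>q. S q)"
  have pieces: "pieces \<alpha> \<beta> Z S k b"
    unfolding pieces_def using Z sp S disj mS fS by (auto simp: m_def mult.commute)
  interpret L: first_moment_measure "restr \<beta> ?L" by (rule \<beta>.first_moment_measure_restr) auto
  note L_eq = \<beta>.pieces_compl[OF pieces \<alpha> mass mom]
  have "restr \<beta> ?L = restr \<alpha> Z"
  proof (rule first_moment_eqI_pot[OF L.first_moment_measure_axioms \<alpha>Z.first_moment_measure_axioms])
    show "mass (restr \<beta> ?L) = mass (restr \<alpha> Z)" "moment (restr \<beta> ?L) = moment (restr \<alpha> Z)"
      by (rule L_eq)+
    note lim = pot_diff_tendsto[OF L.first_moment_measure_axioms \<alpha>Z.first_moment_measure_axioms L_eq]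
    \<comment> \<open>The converse of \<open>potS\<close>. Since \<open>restr \<alpha> Z\<close>
      lives on Z, \<open>convex_le_pot\<close> reduces it to contact points, and equal mass and
      moment take care of infinity.\<close>
    have "pot (restr \<beta> ?L) t \<le> pot (restr \<alpha> Z) t" for t
    proof (rule convex_le_pot[where A=Z])
      show "first_moment_measure (restr \<alpha> Z)" by (rule \<alpha>Z.first_moment_measure_axioms)
      show "convex_on UNIV (pot (restr \<beta> ?L))" by (rule L.convex_on_pot)
      show "AE y in restr \<alpha> Z. y \<in> Z"
        unfolding restr_def by (subst AE_density) (auto simp: indicator_def)
      show "\<forall>\<^sub>F t in at_top. pot (restr \<beta> ?L) t \<le> pot (restr \<alpha> Z) t + e" if "0 < e" for e
        using order_tendstoD(2)[OF lim(1) that] by eventually_elim linarith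
      show "\<forall>\<^sub>F t in at_bot. pot (restr \<beta> ?L) t \<le> pot (restr \<alpha> Z) t + e" if "0 < e" for e
        using order_tendstoD(2)[OF lim(2) that] by eventually_elim linarith
      show "pot (restr \<beta> ?L) z \<le> pot (restr \<alpha> Z) z" if z: "z \<in> Z" for z
      proof -
        \<comment> \<open>Each \<open>S q\<close> has at least the potential of its barycentre, so
          together they have at least that of \<alpha> off Z. The totals agree at z, which leaves at
          most the potential of \<open>restr \<alpha> Z\<close> for the rest.\<close>
        have "(\<integral>x. g z x \<partial>\<alpha>) \<le> pot (restr \<beta> (\<Union>q. S q)) z"
        proof (rule sums_le[OF _ sums_abs])
          show "(\<lambda>q. \<integral>y. indicator (S q) y * \<bar>y - z\<bar> \<partial>\<beta>) sums pot (restr \<beta> (\<Union>q. S q)) z"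
            using disj by (subst \<beta>.pot_restr) (auto intro!: sums_integral_UN)
          fix q
          interpret q: first_moment_measure "restr \<beta> (S q)" by (rule \<beta>.first_moment_measure_restr) fact
          have "m q * \<bar>b q - z\<bar> = \<bar>moment (restr \<beta> (S q)) - z * mass (restr \<beta> (S q))\<bar>"
          proof -
            have "m q * \<bar>b q - z\<bar> = \<bar>m q * (b q - z)\<bar>" using m0 by (simp add: abs_mult)
            then show ?thesis using mS fS by (simp add: \<beta>.mass_restr \<beta>.moment_restr algebra_simps)
          qed
          then show "m q * \<bar>b q - z\<bar> \<le> (\<integral>y. indicator (S q) y * \<bar>y - z\<bar> \<partial>\<beta>)"
            using q.pot_ge[of z] by (simp add: \<beta>.pot_restr)
        qed
        moreover have "pot (restr \<beta> (\<Union>q. S q)) z + pot (restr \<beta> ?L) z = pot \<beta> z"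
          by (rule \<beta>.pot_restr_compl) auto
        moreover have "pot \<beta> z = pot \<alpha> z" using z unfolding Z_def P_def by simp
        ultimately show ?thesis using pot_\<alpha>[of z] g_lower[of z] by linarith
      qed
    qed
    then show "pot (restr \<beta> ?L) t = pot (restr \<alpha> Z) t" for t
      using potS[of t] by (intro order.antisym)
  qed
  with pieces show ?thesis by (rule that)
qed

text \<open>Both sides are the uniform measure on [0, mass], by
  \<open>measure_cdf_le\<close>.\<close>

lemma cdf_transform_eq:
  assumes M: "finite_borel_measure M" "atomless M" and N: "finite_borel_measure N" "atomless N"
    and mass: "mass M = mass N"
  shows "distr M borel (cdf M) = distr N borel (cdf N)"
proof -
  have fin: "finite_borel_measure (distr K borel (cdf K))" if "finite_borel_measure K" for K
  proof -
    interpret K: finite_borel_measure K by fact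
    show ?thesis
      by (intro finite_borel_measure.intro K.finite_measure_distr finite_borel_measure_axioms.intro) auto
  qed
  have tail: "measure (distr K borel (cdf K)) {x<..} = (if x < 0 then mass K else mass K - min x (mass K))"
    if "finite_borel_measure K" "atomless K" for K x
  proof -
    interpret K: finite_borel_measure K by fact
    have "measure (distr K borel (cdf K)) {x<..} = measure K {y. x < cdf K y}"
      by (subst measure_distr) (auto simp: vimage_def)
    also have "\<dots> = (if x < 0 then mass K else mass K - min x (mass K))"
    proof (cases "x < 0")
      case True
      have "x < cdf K y" for y using True K.cdf_nonneg[of y] by linarith
      then show ?thesis using True by simp
    next
      case False
      have "{y. x < cdf K y} = space K - {y. cdf K y \<le> x}" by auto
      then have "measure K {y. x < cdf K y} = mass K - measure K {y. cdf K y \<le> x}"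
        using K.finite_measure_compl[of "{y. cdf K y \<le> x}"] by simp
      then show ?thesis using False K.measure_cdf_le[OF that(2), of x] by simp
    qed
    finally show ?thesis .
  qed
  show ?thesis
    by (intro finite_borel_measure_eqI fin M N) (simp only: tail[OF M] tail[OF N] mass)
qed

section \<open>Backward maps from convex order\<close>

text \<open>Meant for densities that grow like the distance to b. They are unbounded, and the
  weighted measure may have no first moment, so it is only a
  \<open>finite_borel_measure\<close>.\<close>

lemma (in first_moment_measure) finite_borel_measure_density:
  assumes h: "integrable M h" "\<And>y. 0 \<le> h y"
  shows "finite_borel_measure (density M h)"
proof -
  have [measurable]: "h \<in> borel_measurable borel" using h(1) by auto
  have "emeasure (density M h) UNIV = ennreal (\<integral>y. h y \<partial>M)"
    using h by (subst emeasure_density) (auto simp: nn_integral_eq_integral)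
  then interpret d: finite_measure "density M h" by (intro finite_measureI) auto
  show ?thesis by unfold_locales auto
qed

lemma (in first_moment_measure) measure_density_integrable:
  assumes h: "integrable M h" "\<And>y. 0 \<le> h y" and B [measurable]: "B \<in> sets borel"
  shows "measure (density M h) B = (\<integral>y. indicator B y * h y \<partial>M)"
proof -
  interpret d: finite_borel_measure "density M h" by (rule finite_borel_measure_density[OF h])
  have [measurable]: "h \<in> borel_measurable borel" using h(1) by auto
  have "measure (density M h) B = (\<integral>y. indicator B y \<partial>density M h)" by simp
  also have "\<dots> = (\<integral>y. h y * indicator B y \<partial>M)"
    using h(2) by (subst integral_density) auto
  finally show ?thesis by (simp add: mult.commute)
qed

lemma (in first_moment_measure) atomless_density:
  assumes al: "atomless M" and h: "integrable M h" "\<And>y. 0 \<le> h y"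
  shows "atomless (density M h)"
  unfolding atomless_def
proof
  fix x
  interpret d: finite_borel_measure "density M h" by (rule finite_borel_measure_density[OF h])
  have "{x} \<in> null_sets M" using al unfolding atomless_def by (intro null_setsI) auto
  then have "(\<integral>y. indicator {x} y * h y \<partial>M) = (\<integral>y. 0 \<partial>M)"
    using h(1) by (intro integral_cong_AE) (auto dest!: AE_not_in elim!: eventually_mono)
  then have "measure (density M h) {x} = 0" using h by (subst measure_density_integrable) auto
  then show "emeasure (density M h) {x} = 0" by (simp add: d.emeasure_eq_measure)
qed

text \<open>\<open>F y\<close> is the deviation from \<open>b\<close> accumulated between \<open>b\<close> and \<open>y\<close>. Since the deviations to
  the left and to the right of \<open>b\<close> are both transformed by \<open>F\<close> to the uniform measure on the same
  interval, \<open>y - b\<close> averages to zero given \<open>F\<close>; then \<open>F\<close> is composed with a quantile transform.\<close>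

lemma (in first_moment_measure) fiber_map:
  assumes al: "atomless M" and \<kappa>: "finite_borel_measure \<kappa>"
    and mass: "mass \<kappa> = mass M" and mom: "moment M = b * mass M"
  obtains f where "f \<in> borel_measurable borel" "distr M borel f = \<kappa>"
    "\<And>B. B \<in> sets borel \<Longrightarrow> (\<integral>y. indicator B (f y) * y \<partial>M) = b * measure \<kappa> B"
proof -
  interpret \<kappa>: finite_borel_measure \<kappa> by fact
  define r l where "r y = max 0 (y - b)" and "l y = max 0 (b - y)" for y
  have [measurable]: "r \<in> borel_measurable borel" "l \<in> borel_measurable borel"
    unfolding r_def l_def by auto
  have r: "integrable M r" "0 \<le> r y" and l: "integrable M l" "0 \<le> l y" for y
    unfolding r_def l_def using integrable_id by auto
  define R where "R = density M r"
  \<comment> \<open>Reflected so that \<open>cdf L (- y)\<close> accumulates the deviation from b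
    leftwards to y, as \<open>cdf R y\<close> does rightwards.\<close>
  define L where "L = distr (density M l) borel uminus"
  interpret l: finite_borel_measure "density M l" by (rule finite_borel_measure_density[OF l])
  interpret R: finite_borel_measure R unfolding R_def by (rule finite_borel_measure_density[OF r])
  interpret L: finite_borel_measure L
    unfolding L_def
    by (intro finite_borel_measure.intro l.finite_measure_distr finite_borel_measure_axioms.intro) auto
  have "atomless R" unfolding R_def by (rule atomless_density[OF al r])
  have "atomless L" unfolding atomless_def
  proof
    fix x
    have "emeasure L {x} = emeasure (density M l) {- x}"
    proof -
      have "uminus -` {x} = {- x}" by auto
      then show ?thesis unfolding L_def by (subst emeasure_distr) auto
    qed
    then show "emeasure L {x} = 0" using atomless_density[OF al l] unfolding atomless_def by simp
  qed
  have mass_RL: "mass R = mass L"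
  proof -
    have "mass R - mass L = (\<integral>y. r y \<partial>M) - (\<integral>y. l y \<partial>M)"
      unfolding R_def L_def
      by (simp add: measure_distr measure_density_integrable[OF r] measure_density_integrable[OF l])
    also have "\<dots> = (\<integral>y. y - b \<partial>M)"
      using r l by (subst Bochner_Integration.integral_diff[symmetric])
        (auto intro!: Bochner_Integration.integral_cong simp: r_def l_def)
    also have "\<dots> = 0" using mom by (simp add: integral_affine)
    finally show ?thesis by simp
  qed
  define F where "F y = (if b \<le> y then cdf R y else cdf L (- y))" for y
  have F [measurable]: "F \<in> borel_measurable borel" unfolding F_def by measurable
  have F_r: "(\<integral>y. indicator B (F y) * r y \<partial>M) = measure (distr R borel (cdf R)) B"
    and F_l: "(\<integral>y. indicator B (F y) * l y \<partial>M) = measure (distr R borel (cdf R)) B"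
    if B [measurable]: "B \<in> sets borel" for B
  proof -
    have "(\<integral>y. indicator B (F y) * r y \<partial>M) = (\<integral>y. indicator (cdf R -` B) y * r y \<partial>M)"
      by (intro Bochner_Integration.integral_cong) (auto simp: F_def r_def indicator_def)
    also have "\<dots> = measure R (cdf R -` B)"
      unfolding R_def using measurable_sets[OF R.measurable_cdf B]
      by (subst measure_density_integrable[OF r]) (auto simp: R_def)
    also have "\<dots> = measure (distr R borel (cdf R)) B" by (subst measure_distr) auto
    finally show "(\<integral>y. indicator B (F y) * r y \<partial>M) = measure (distr R borel (cdf R)) B" .
    have "(\<integral>y. indicator B (F y) * l y \<partial>M) = (\<integral>y. indicator (uminus -` (cdf L -` B)) y * l y \<partial>M)"
      by (intro Bochner_Integration.integral_cong) (auto simp: F_def l_def indicator_def)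
    also have "\<dots> = measure (density M l) (uminus -` (cdf L -` B))"
    proof -
      have "(\<lambda>y. cdf L (- y)) \<in> borel_measurable borel" by measurable
      from measurable_sets[OF this B] have "uminus -` (cdf L -` B) \<in> sets borel"
        by (simp add: vimage_def)
      then show ?thesis by (subst measure_density_integrable[OF l]) auto
    qed
    also have "\<dots> = measure L (cdf L -` B)"
    proof -
      have "measure (distr (density M l) borel uminus) C = measure (density M l) (uminus -` C)"
        if "C \<in> sets borel" for C
        using that by (subst measure_distr) auto
      from this[of "cdf L -` B"] show ?thesis
        using measurable_sets[OF L.measurable_cdf B] unfolding L_def by simp
    qed
    also have "\<dots> = measure (distr L borel (cdf L)) B" by (subst measure_distr) auto
    also have "distr L borel (cdf L) = distr R borel (cdf R)"
      by (rule cdf_transform_eq[OF L.finite_borel_measure_axioms \<open>atomless L\<close>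
            R.finite_borel_measure_axioms \<open>atomless R\<close> mass_RL[symmetric]])
    finally show "(\<integral>y. indicator B (F y) * l y \<partial>M) = measure (distr R borel (cdf R)) B" .
  qed
  have int_B: "integrable M (\<lambda>y. indicator B (F y) * h y)"
    if [measurable]: "B \<in> sets borel" and h: "integrable M h" for B and h :: "real \<Rightarrow> real"
    using integrable_real_mult_indicator[of "F -` B" M h] h measurable_sets[OF F that(1)]
    by (simp add: mult.commute indicator_def vimage_def)
  have centred: "(\<integral>y. indicator B (F y) * (y - b) \<partial>M) = 0" if B: "B \<in> sets borel" for B
  proof -
    have "(\<integral>y. indicator B (F y) * (y - b) \<partial>M)
        = (\<integral>y. indicator B (F y) * r y - indicator B (F y) * l y \<partial>M)"
      by (intro Bochner_Integration.integral_cong) (auto simp: r_def l_def indicator_def)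
    also have "\<dots> = 0" using F_r[OF B] F_l[OF B] int_B[OF B] r l by simp
    finally show ?thesis .
  qed
  define \<Lambda> where "\<Lambda> = distr M borel F"
  interpret \<Lambda>: finite_borel_measure \<Lambda>
    unfolding \<Lambda>_def
    by (intro finite_borel_measure.intro finite_measure_distr finite_borel_measure_axioms.intro) auto
  have mass_\<Lambda>: "mass \<Lambda> = mass M" unfolding \<Lambda>_def by (subst measure_distr) auto
  \<comment> \<open>With weight |y - b| the law of F is twice a uniform measure and charges no
    point. The weight is positive almost everywhere because b is not an atom, so the unweighted law
    charges none either.\<close>
  have "atomless \<Lambda>"
    unfolding atomless_def
  proof
    fix x
    have "(\<integral>y. indicator {x} (F y) * \<bar>y - b\<bar> \<partial>M)
        = (\<integral>y. indicator {x} (F y) * r y + indicator {x} (F y) * l y \<partial>M)"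
      by (intro Bochner_Integration.integral_cong) (auto simp: r_def l_def indicator_def)
    also have "\<dots> = 2 * measure (distr R borel (cdf R)) {x}"
      using F_r[of "{x}"] F_l[of "{x}"] int_B[of "{x}"] r l by simp
    also have "measure (distr R borel (cdf R)) {x} = 0"
      using R.measure_cdf_eq[OF \<open>atomless R\<close>, of x] by (subst measure_distr) (auto simp: vimage_def)
    finally have "(\<integral>y. indicator {x} (F y) * \<bar>y - b\<bar> \<partial>M) = 0" by simp
    then have "AE y in M. indicator {x} (F y) * \<bar>y - b\<bar> = 0"
      by (subst (asm) integral_nonneg_eq_0_iff_AE) (auto intro: int_B)
    moreover have "AE y in M. y \<noteq> b"
      using AE_not_in[of "{b}" M] al unfolding atomless_def by (simp add: null_setsI)
    ultimately have "AE y in M. F y \<noteq> x"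
      by eventually_elim auto
    then show "emeasure \<Lambda> {x} = 0"
      unfolding \<Lambda>_def by (subst emeasure_distr) (auto simp: AE_iff_measurable[OF _ refl] vimage_def)
  qed
  interpret Q: right_continuous_mono "cdf \<kappa>" 0 "mass \<kappa>"
    using \<kappa>.cdf_lim_at_bot \<kappa>.cdf_lim_at_top
    by unfold_locales (auto intro!: \<kappa>.cdf_is_right_cont monoI \<kappa>.cdf_nondecreasing)
  \<comment> \<open>The quantile function of \<kappa>. The value 0 elsewhere is harmless: only the
    levels 0 and \<open>mass M\<close> can reach it, and \<open>cdf \<Lambda>\<close> almost never
    takes them.\<close>
  define q where "q w = (if w \<in> {0<..<mass M} then Inf {x. w \<le> cdf \<kappa> x} else 0)" for w
  have q_le: "q w \<le> x \<longleftrightarrow> w \<le> cdf \<kappa> x" if "w \<in> {0<..<mass M}" for w x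
    using Q.pseudoinverse[of w x] that unfolding q_def mass by simp
  have q [measurable]: "q \<in> borel_measurable borel"
  proof (rule borel_measurable_iff_le[THEN iffD2, rule_format])
    fix x
    have "{w \<in> space borel. q w \<le> x}
        = ({0<..<mass M} \<inter> {..cdf \<kappa> x}) \<union> (if 0 \<le> x then - {0<..<mass M} else {})"
      using q_le[of _ x] by (auto simp: q_def)
    then show "{w \<in> space borel. q w \<le> x} \<in> sets borel" by simp
  qed
  define h where "h z = q (cdf \<Lambda> z)" for z
  have h [measurable]: "h \<in> borel_measurable borel" unfolding h_def by measurable
  have h_distr: "distr \<Lambda> borel h = \<kappa>"
  proof (rule finite_borel_measure_eqI)
    show "finite_borel_measure (distr \<Lambda> borel h)"
      by (intro finite_borel_measure.intro \<Lambda>.finite_measure_distr finite_borel_measure_axioms.intro) auto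
    show "finite_borel_measure \<kappa>" by fact
    fix x
    have "measure (distr \<Lambda> borel h) {x<..} = measure \<Lambda> {z. x < h z}"
      by (subst measure_distr) (auto simp: vimage_def)
    also have "\<dots> = measure \<Lambda> {z. cdf \<kappa> x < cdf \<Lambda> z}"
    proof (rule \<Lambda>.finite_measure_eq_AE)
      show "AE z in \<Lambda>. (z \<in> {z. x < h z}) = (z \<in> {z. cdf \<kappa> x < cdf \<Lambda> z})"
        using \<Lambda>.AE_cdf_neq[OF \<open>atomless \<Lambda>\<close>, of 0] \<Lambda>.AE_cdf_neq[OF \<open>atomless \<Lambda>\<close>, of "mass M"]
      proof eventually_elim
        case (elim z)
        then have "cdf \<Lambda> z \<in> {0<..<mass M}"
          using \<Lambda>.cdf_nonneg[of z] \<Lambda>.cdf_le_mass[of z] unfolding mass_\<Lambda> by simp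
        then show ?case using q_le[of "cdf \<Lambda> z" x] unfolding h_def by auto
      qed
    qed measurable
    also have "\<dots> = mass M - measure \<Lambda> {z. cdf \<Lambda> z \<le> cdf \<kappa> x}"
    proof -
      have "{z. cdf \<kappa> x < cdf \<Lambda> z} = space \<Lambda> - {z. cdf \<Lambda> z \<le> cdf \<kappa> x}" by auto
      then show ?thesis
        using \<Lambda>.finite_measure_compl[of "{z. cdf \<Lambda> z \<le> cdf \<kappa> x}"] mass_\<Lambda> by simp
    qed
    also have "\<dots> = mass M - cdf \<kappa> x"
      using \<Lambda>.measure_cdf_le[OF \<open>atomless \<Lambda>\<close> \<kappa>.cdf_nonneg, of x] \<kappa>.cdf_le_mass[of x]
      unfolding mass_\<Lambda> mass by simp
    also have "\<dots> = measure \<kappa> {x<..}"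
    proof -
      have "{x<..} = space \<kappa> - {..x}" by auto
      then show ?thesis using \<kappa>.finite_measure_compl[of "{..x}"] mass by (simp add: cdf_def)
    qed
    finally show "measure (distr \<Lambda> borel h) {x<..} = measure \<kappa> {x<..}" .
  qed
  define f where "f y = h (F y)" for y
  have f [measurable]: "f \<in> borel_measurable borel" unfolding f_def by measurable
  have f_distr: "distr M borel f = \<kappa>"
    unfolding h_distr[symmetric] \<Lambda>_def by (subst distr_distr) (auto simp: f_def[abs_def] comp_def)
  have "(\<integral>y. indicator B (f y) * y \<partial>M) = b * measure \<kappa> B" if B [measurable]: "B \<in> sets borel" for B
  proof -
    have hB: "h -` B \<in> sets borel" using measurable_sets[OF h B] by simp
    \<comment> \<open>As f factors through F, an event about f is one about F, and y - b integrates
      to zero over it by \<open>centred\<close>.\<close>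
    have "(\<integral>y. indicator B (f y) * y \<partial>M)
        = (\<integral>y. indicator (h -` B) (F y) * (y - b) + b * indicator (f -` B) y \<partial>M)"
      by (intro Bochner_Integration.integral_cong) (auto simp: f_def indicator_def)
    also have "\<dots> = b * measure M (f -` B)"
      using centred[OF hB] int_B[OF hB integrable_diff_const] measurable_sets[OF f B]
      by (subst Bochner_Integration.integral_add) (auto simp: less_top[symmetric])
    also have "measure M (f -` B) = measure \<kappa> B"
      unfolding f_distr[symmetric] by (subst measure_distr) auto
    finally show ?thesis .
  qed
  with f f_distr show ?thesis by (rule that)
qed

text \<open>Equivalently, (f, id) pushes \<beta> forward to a martingale coupling of \<alpha> and
  \<beta>: the last clause is E[Y | f(Y)] = f(Y), tested on Borel sets.\<close>

definition barycentric_map :: "real measure \<Rightarrow> real measure \<Rightarrow> (real \<Rightarrow> real) \<Rightarrow> bool" where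
  "barycentric_map \<alpha> \<beta> f \<longleftrightarrow> f \<in> borel_measurable borel \<and> distr \<beta> borel f = \<alpha> \<and>
     (\<forall>B\<in>sets borel. (\<integral>y. indicator B (f y) * y \<partial>\<beta>) = (\<integral>x. indicator B x * x \<partial>\<alpha>))"

lemma finite_borel_measure_distr:
  assumes "finite_borel_measure M" "f \<in> borel_measurable borel"
  shows "finite_borel_measure (distr M borel f)"
proof -
  interpret finite_borel_measure M by fact
  show ?thesis
    using assms(2)
    by (intro finite_borel_measure.intro finite_measure_distr finite_borel_measure_axioms.intro) auto
qed

lemma barycentric_mapI:
  assumes \<alpha>: "first_moment_measure \<alpha>" and \<beta>: "first_moment_measure \<beta>" and f: "f \<in> borel_measurable borel"
    and mass: "\<And>B. B \<in> sets borel \<Longrightarrow> (\<integral>y. indicator B (f y) \<partial>\<beta>) = measure \<alpha> B"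
    and mom: "\<And>B. B \<in> sets borel \<Longrightarrow> (\<integral>y. indicator B (f y) * y \<partial>\<beta>) = (\<integral>x. indicator B x * x \<partial>\<alpha>)"
  shows "barycentric_map \<alpha> \<beta> f"
proof -
  interpret \<alpha>: first_moment_measure \<alpha> by fact
  interpret \<beta>: first_moment_measure \<beta> by fact
  have "distr \<beta> borel f = \<alpha>"
  proof (rule finite_borel_measure_eqI)
    show "finite_borel_measure (distr \<beta> borel f)"
      using f by (intro finite_borel_measure_distr) unfold_locales
    fix x
    have "measure (distr \<beta> borel f) {x<..} = (\<integral>y. indicator {x<..} y \<partial>distr \<beta> borel f)" by simp
    also have "\<dots> = (\<integral>y. indicator {x<..} (f y) \<partial>\<beta>)"
      using f by (subst integral_distr) auto
    finally show "measure (distr \<beta> borel f) {x<..} = measure \<alpha> {x<..}" using mass by simp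
  qed unfold_locales
  with f mom show ?thesis unfolding barycentric_map_def by blast
qed

lemma barycentric_map_measure:
  assumes "barycentric_map \<alpha> \<beta> f" "first_moment_measure \<beta>" "B \<in> sets borel"
  shows "(\<integral>y. indicator B (f y) \<partial>\<beta>) = measure \<alpha> B"
proof -
  interpret \<beta>: first_moment_measure \<beta> by fact
  have "f \<in> borel_measurable borel" and \<alpha>: "\<alpha> = distr \<beta> borel f"
    using assms unfolding barycentric_map_def by auto
  then have "(\<integral>y. indicator B (f y) \<partial>\<beta>) = (\<integral>x. (indicator B x :: real) \<partial>\<alpha>)"
    using assms(3) unfolding \<alpha> by (subst integral_distr) auto
  then show ?thesis using \<alpha> by simp
qed

text \<open>On \<open>S q\<close> the lemma \<open>fiber_map\<close> realises the share
  \<open>k q\<close> of \<alpha> with conditional mean \<open>b q\<close> of Y;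
  \<open>spreads_sums\<close> adds up the shares. The last two conclusions keep track of where f
  sends each set, for the count of cell masses in \<open>cellwise_map\<close>.\<close>

lemma glue_pieces:
  assumes \<alpha>: "first_moment_measure \<alpha>" and \<beta>: "first_moment_measure \<beta>" and al: "atomless \<beta>"
    and p: "pieces \<alpha> \<beta> Z S k b"
    and rest: "barycentric_map (restr \<alpha> Z) (restr \<beta> (- (\<Union>q. S q))) g"
  obtains f where "barycentric_map \<alpha> \<beta> f"
    "\<And>y. y \<notin> (\<Union>q. S q) \<Longrightarrow> f y = g y"
    "\<And>q B. B \<in> sets borel \<Longrightarrow> measure \<beta> {y \<in> S q. f y \<in> B} = (\<integral>x. indicator B x * k q x \<partial>\<alpha>)"
proof -
  interpret \<alpha>: first_moment_measure \<alpha> by fact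
  interpret \<beta>: first_moment_measure \<beta> by fact
  have sp: "spreads Z k b" and Z [measurable]: "Z \<in> sets borel" and S [measurable]: "\<And>q. S q \<in> sets borel"
    and disj: "disjoint_family S" and mS: "\<And>q. measure \<beta> (S q) = (\<integral>x. k q x \<partial>\<alpha>)"
    and fS: "\<And>q. (\<integral>y. indicator (S q) y * y \<partial>\<beta>) = b q * (\<integral>x. k q x \<partial>\<alpha>)"
    using p unfolding pieces_def by auto
  have km [measurable]: "k q \<in> borel_measurable borel" for q using sp unfolding spreads_def by blast
  have k0: "0 \<le> k q x" for q x using sp unfolding spreads_def by blast
  have k1: "k q x \<le> 1" for q x by (rule spreads_le_1[OF sp])
  note meas_k = \<alpha>.measure_density_real[OF km k0 k1]
  let ?L = "- (\<Union>q. S q)"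
  interpret L: first_moment_measure "restr \<beta> ?L" by (rule \<beta>.first_moment_measure_restr) auto
  have g [measurable]: "g \<in> borel_measurable borel" using rest unfolding barycentric_map_def by blast
  have "\<exists>f. f \<in> borel_measurable borel \<and> distr (restr \<beta> (S q)) borel f = density \<alpha> (k q) \<and>
      (\<forall>B\<in>sets borel. (\<integral>y. indicator B (f y) * y \<partial>restr \<beta> (S q)) = b q * measure (density \<alpha> (k q)) B)" for q
  proof -
    interpret q: first_moment_measure "restr \<beta> (S q)" by (rule \<beta>.first_moment_measure_restr) fact
    interpret k: first_moment_measure "density \<alpha> (k q)" by (rule \<alpha>.first_moment_measure_density[OF km k0 k1])
    have "mass (density \<alpha> (k q)) = mass (restr \<beta> (S q))"
      using mS by (simp add: meas_k \<beta>.mass_restr)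
    moreover have "moment (restr \<beta> (S q)) = b q * mass (restr \<beta> (S q))"
      using mS fS by (simp add: \<beta>.mass_restr \<beta>.moment_restr)
    ultimately obtain f where "f \<in> borel_measurable borel" "distr (restr \<beta> (S q)) borel f = density \<alpha> (k q)"
      "\<And>B. B \<in> sets borel \<Longrightarrow> (\<integral>y. indicator B (f y) * y \<partial>restr \<beta> (S q)) = b q * measure (density \<alpha> (k q)) B"
      using q.fiber_map[OF \<beta>.atomless_restr[OF al S] k.finite_borel_measure_axioms] by blast
    then show ?thesis by blast
  qed
  then have "\<exists>F. \<forall>q. F q \<in> borel_measurable borel \<and> distr (restr \<beta> (S q)) borel (F q) = density \<alpha> (k q) \<and>
      (\<forall>B\<in>sets borel. (\<integral>y. indicator B (F q y) * y \<partial>restr \<beta> (S q)) = b q * measure (density \<alpha> (k q)) B)"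
    by (intro choice allI)
  then obtain F where F [measurable]: "\<And>q. F q \<in> borel_measurable borel"
    and F_distr: "\<And>q. distr (restr \<beta> (S q)) borel (F q) = density \<alpha> (k q)"
    and F_mom: "\<And>q B. B \<in> sets borel \<Longrightarrow>
      (\<integral>y. indicator B (F q y) * y \<partial>restr \<beta> (S q)) = b q * measure (density \<alpha> (k q)) B"
    by blast
  \<comment> \<open>Branch selector: 0 for what is left over, \<open>Suc q\<close> for
    \<open>S q\<close>.\<close>
  define I where "I y = (if \<exists>q. y \<in> S q then Suc (THE q. y \<in> S q) else 0)" for y
  have I_Suc: "I y = Suc q \<longleftrightarrow> y \<in> S q" for y q
  proof -
    have uniq: "q = q'" if "y \<in> S q" "y \<in> S q'" for q q'
      using disj that unfolding disjoint_family_on_def by blast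
    have THE: "(THE q. y \<in> S q) = q" if "y \<in> S q" for q
      using that uniq[OF _ that] by (intro the_equality)
    show ?thesis
    proof
      assume "I y = Suc q"
      then have "\<exists>q. y \<in> S q" and q: "(THE q. y \<in> S q) = q" unfolding I_def by (auto split: if_splits)
      then obtain q' where "y \<in> S q'" by blast
      with THE[OF this] q show "y \<in> S q" by simp
    next
      assume "y \<in> S q"
      with THE[OF this] show "I y = Suc q" unfolding I_def by auto
    qed
  qed
  have I_0: "I y = 0 \<longleftrightarrow> y \<notin> (\<Union>q. S q)" for y unfolding I_def by auto
  have I_sets: "{y. I y = n} = (case n of 0 \<Rightarrow> ?L | Suc q \<Rightarrow> S q)" for n
    by (cases n) (simp_all only: I_Suc I_0 nat.case Collect_mem_eq Collect_neg_eq)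
  have I [measurable]: "I \<in> measurable borel (count_space UNIV)"
  proof (subst measurable_count_space_eq2_countable, intro conjI ballI)
    fix n :: nat
    have "I -` {n} = {y. I y = n}" by auto
    then show "I -` {n} \<inter> space borel \<in> sets borel"
      unfolding I_sets by (auto split: nat.splits)
  qed auto
  define G where "G n = (case n of 0 \<Rightarrow> g | Suc q \<Rightarrow> F q)" for n
  have G [measurable]: "G n \<in> borel_measurable borel" for n
    unfolding G_def by (auto split: nat.splits)
  define f where "f y = G (I y) y" for y
  have f [measurable]: "f \<in> borel_measurable borel"
    unfolding f_def by (rule measurable_compose_countable[OF G I])
  have F_meas: "(\<integral>y. indicator (S q) y * indicator B (F q y) \<partial>\<beta>) = (\<integral>x. indicator B x * k q x \<partial>\<alpha>)"
    and F_int: "(\<integral>y. indicator (S q) y * (indicator B (F q y) * y) \<partial>\<beta>) = b q * (\<integral>x. indicator B x * k q x \<partial>\<alpha>)"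
    if B [measurable]: "B \<in> sets borel" for q B
  proof -
    interpret q: first_moment_measure "restr \<beta> (S q)" by (rule \<beta>.first_moment_measure_restr) fact
    have "(\<integral>y. indicator (S q) y * indicator B (F q y) \<partial>\<beta>) = (\<integral>y. (indicator B (F q y) :: real) \<partial>restr \<beta> (S q))"
      by (subst \<beta>.integral_restr) auto
    also have "\<dots> = (\<integral>x. indicator B x \<partial>density \<alpha> (k q))"
      unfolding F_distr[symmetric] by (subst integral_distr) auto
    also have "\<dots> = (\<integral>x. indicator B x * k q x \<partial>\<alpha>)"
      using meas_k[OF B] by simp
    finally show "(\<integral>y. indicator (S q) y * indicator B (F q y) \<partial>\<beta>) = (\<integral>x. indicator B x * k q x \<partial>\<alpha>)" .
    have "(\<integral>y. indicator (S q) y * (indicator B (F q y) * y) \<partial>\<beta>)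
        = (\<integral>y. indicator B (F q y) * y \<partial>restr \<beta> (S q))"
      by (subst \<beta>.integral_restr) auto
    then show "(\<integral>y. indicator (S q) y * (indicator B (F q y) * y) \<partial>\<beta>) = b q * (\<integral>x. indicator B x * k q x \<partial>\<alpha>)"
      using F_mom[OF B] meas_k[OF B] by simp
  qed
  have "barycentric_map \<alpha> \<beta> f"
  proof (rule barycentric_mapI[OF \<alpha> \<beta> f])
    fix B :: "real set" assume B [measurable]: "B \<in> sets borel"
    have g_meas: "(\<integral>y. indicator ?L y * indicator B (g y) \<partial>\<beta>) = measure \<alpha> (Z \<inter> B)"
      using barycentric_map_measure[OF rest L.first_moment_measure_axioms B]
      by (subst (asm) \<beta>.integral_restr) (auto simp: \<alpha>.measure_restr)
    have g_mom: "(\<integral>y. indicator ?L y * (indicator B (g y) * y) \<partial>\<beta>) = (\<integral>x. indicator Z x * (indicator B x * x) \<partial>\<alpha>)"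
    proof -
      have "(\<integral>y. indicator B (g y) * y \<partial>restr \<beta> ?L) = (\<integral>x. indicator B x * x \<partial>restr \<alpha> Z)"
        using rest B unfolding barycentric_map_def by blast
      then show ?thesis by (simp add: \<beta>.integral_restr \<alpha>.integral_restr)
    qed
    have s1: "(\<lambda>n. \<integral>y. indicator {y. I y = n} y * (indicator B (G n y) * (1::real)) \<partial>\<beta>)
        sums (\<integral>y. indicator B (G (I y) y) * (1::real) \<partial>\<beta>)"
      by (rule glue_sums[OF \<beta>.finite_borel_measure_axioms I G]) auto
    have s2: "(\<lambda>n. \<integral>y. indicator {y. I y = n} y * (indicator B (G n y) * (1::real)) \<partial>\<beta>)
        sums ((\<integral>x. indicator B x * indicator (- Z) x \<partial>\<alpha>) + measure \<alpha> (Z \<inter> B))"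
      unfolding I_sets G_def mult_1_right
      by (rule sums_Suc[of "\<lambda>n. \<integral>y. indicator {y. I y = n} y * (indicator B (G n y) * (1::real)) \<partial>\<beta>",
            unfolded I_sets G_def nat.case mult_1_right F_meas[OF B] g_meas])
        (rule \<alpha>.spreads_sums(1)[OF sp Z B])
    have e1: "(\<integral>x. indicator B x * indicator (- Z) x \<partial>\<alpha>) + measure \<alpha> (Z \<inter> B) = measure \<alpha> B"
    proof -
      have "(\<integral>x. indicator B x * indicator (- Z) x \<partial>\<alpha>) = measure \<alpha> (B \<inter> - Z)"
        by (simp only: indicator_inter_arith[symmetric]) simp
      moreover have "measure \<alpha> (B - Z) = measure \<alpha> B - measure \<alpha> (B \<inter> Z)"
        by (rule \<alpha>.finite_measure_Diff') auto
      ultimately show ?thesis unfolding Int_commute[of Z B] Diff_eq by linarith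
    qed
    show "(\<integral>y. indicator B (f y) \<partial>\<beta>) = measure \<alpha> B"
      using sums_unique2[OF s1 s2] e1 unfolding f_def by simp
    have s3: "(\<lambda>n. \<integral>y. indicator {y. I y = n} y * (indicator B (G n y) * y) \<partial>\<beta>)
        sums (\<integral>y. indicator B (G (I y) y) * y \<partial>\<beta>)"
      by (rule glue_sums[OF \<beta>.finite_borel_measure_axioms I G \<beta>.integrable_id B])
    have s4: "(\<lambda>n. \<integral>y. indicator {y. I y = n} y * (indicator B (G n y) * y) \<partial>\<beta>)
        sums ((\<integral>x. indicator B x * (indicator (- Z) x * x) \<partial>\<alpha>) + (\<integral>x. indicator Z x * (indicator B x * x) \<partial>\<alpha>))"
      unfolding I_sets G_def
      by (rule sums_Suc[of "\<lambda>n. \<integral>y. indicator {y. I y = n} y * (indicator B (G n y) * y) \<partial>\<beta>",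
            unfolded I_sets G_def nat.case F_int[OF B] g_mom])
        (rule \<alpha>.spreads_sums(2)[OF sp Z B])
    have e2: "(\<integral>x. indicator B x * (indicator (- Z) x * x) \<partial>\<alpha>) + (\<integral>x. indicator Z x * (indicator B x * x) \<partial>\<alpha>)
        = (\<integral>x. indicator B x * x \<partial>\<alpha>)"
    proof -
      have "(\<integral>x. indicator B x * (indicator (- Z) x * x) \<partial>\<alpha>) = (\<integral>x. indicator (- Z) x * (indicator B x * x) \<partial>\<alpha>)"
        by (intro Bochner_Integration.integral_cong) (auto simp: indicator_def)
      then show ?thesis
        using \<alpha>.integral_split_compl[OF \<alpha>.integrable_indicator_mult[OF \<alpha>.integrable_id B] Z] by linarith
    qed
    show "(\<integral>y. indicator B (f y) * y \<partial>\<beta>) = (\<integral>x. indicator B x * x \<partial>\<alpha>)"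
      using sums_unique2[OF s3 s4] e2 unfolding f_def by simp
  qed
  moreover have "f y = g y" if "y \<notin> (\<Union>q. S q)" for y
    using that I_0[of y] unfolding f_def G_def by simp
  moreover have "measure \<beta> {y \<in> S q. f y \<in> B} = (\<integral>x. indicator B x * k q x \<partial>\<alpha>)"
    if B [measurable]: "B \<in> sets borel" for q B
  proof -
    have *: "f y = F q y" if "y \<in> S q" for y
      using that I_Suc[of y q] unfolding f_def G_def by simp
    have eq: "{y \<in> S q. f y \<in> B} = {y \<in> S q. F q y \<in> B}" using * by auto
    have "measure \<beta> {y \<in> S q. F q y \<in> B} = (\<integral>y. indicator {y \<in> S q. F q y \<in> B} y \<partial>\<beta>)" by simp
    also have "\<dots> = (\<integral>y. indicator (S q) y * indicator B (F q y) \<partial>\<beta>)"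
      by (intro Bochner_Integration.integral_cong) (auto simp: indicator_def)
    finally show ?thesis unfolding eq F_meas[OF B] .
  qed
  ultimately show ?thesis by (rule that)
qed

text \<open>Strassen's theorem in backward form for an atomless target. The leftover measures
  coincide, so the identity is a backward map between them.\<close>

lemma barycentric_map_exists:
  assumes "first_moment_measure \<alpha>" "first_moment_measure \<beta>" "atomless \<beta>"
    and "mass \<alpha> = mass \<beta>" "moment \<alpha> = moment \<beta>" "\<And>t. pot \<alpha> t \<le> pot \<beta> t"
  obtains f where "barycentric_map \<alpha> \<beta> f"
proof -
  interpret \<alpha>: first_moment_measure \<alpha> by fact
  obtain Z S k b where p: "pieces \<alpha> \<beta> Z S k b" and eq: "restr \<beta> (- (\<Union>q. S q)) = restr \<alpha> Z"
    by (rule convex_order_pieces[OF assms])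
  have "Z \<in> sets borel" using p unfolding pieces_def by blast
  interpret Z: first_moment_measure "restr \<alpha> Z" by (rule \<alpha>.first_moment_measure_restr) fact
  have "barycentric_map (restr \<alpha> Z) (restr \<beta> (- (\<Union>q. S q))) (\<lambda>y. y)"
    unfolding eq
    by (rule barycentric_mapI[OF Z.first_moment_measure_axioms Z.first_moment_measure_axioms]) simp_all
  then show ?thesis by (rule glue_pieces[OF assms(1-3) p]) (rule that)
qed

section \<open>Cellwise approximation of a martingale coupling\<close>

locale martingale_coupling = prob_space \<pi> for \<pi> :: "(real \<times> real) measure" +
  fixes \<mu> \<nu> :: "real measure"
  assumes sets_eq [simp, measurable_cong]: "sets \<pi> = sets borel"
    and distr_fst: "distr \<pi> borel fst = \<mu>" and distr_snd: "distr \<pi> borel snd = \<nu>"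
    and first_moment_fst: "first_moment_measure \<mu>" and first_moment_snd: "first_moment_measure \<nu>"
    and martingale: "\<And>B. B \<in> sets borel \<Longrightarrow>
      (\<integral>z. indicator B (fst z) * snd z \<partial>\<pi>) = (\<integral>z. indicator B (fst z) * fst z \<partial>\<pi>)"
begin

sublocale X: first_moment_measure \<mu> by (rule first_moment_fst)
sublocale Y: first_moment_measure \<nu> by (rule first_moment_snd)

lemma measurable_M [simp]: "measurable \<pi> N = measurable borel N"
  by (rule measurable_cong_sets) simp_all

lemma space_eq [simp]: "space \<pi> = UNIV"
  using sets_eq_imp_space_eq[OF sets_eq] by simp

lemma measurable_coords [measurable]:
  "fst \<in> borel_measurable (borel :: (real \<times> real) measure)"
  "snd \<in> borel_measurable (borel :: (real \<times> real) measure)"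
  by (auto intro!: borel_measurable_continuous_onI continuous_intros)

lemma integral_fst:
  fixes h :: "real \<Rightarrow> real"
  assumes "h \<in> borel_measurable borel"
  shows "(\<integral>x. h x \<partial>\<mu>) = (\<integral>z. h (fst z) \<partial>\<pi>)"
  unfolding distr_fst[symmetric] using assms by (subst integral_distr) auto

lemma integral_snd:
  fixes h :: "real \<Rightarrow> real"
  assumes "h \<in> borel_measurable borel"
  shows "(\<integral>y. h y \<partial>\<nu>) = (\<integral>z. h (snd z) \<partial>\<pi>)"
  unfolding distr_snd[symmetric] using assms by (subst integral_distr) auto

lemma integrable_fst:
  fixes h :: "real \<Rightarrow> real"
  assumes "integrable \<mu> h"
  shows "integrable \<pi> (\<lambda>z. h (fst z))"
proof -
  have "h \<in> borel_measurable borel" using borel_measurable_integrable[OF assms] by simp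
  then show ?thesis
    using assms unfolding distr_fst[symmetric] by (subst (asm) integrable_distr_eq) auto
qed

lemma integrable_snd:
  fixes h :: "real \<Rightarrow> real"
  assumes "integrable \<nu> h"
  shows "integrable \<pi> (\<lambda>z. h (snd z))"
proof -
  have "h \<in> borel_measurable borel" using borel_measurable_integrable[OF assms] by simp
  then show ?thesis
    using assms unfolding distr_snd[symmetric] by (subst (asm) integrable_distr_eq) auto
qed

lemma integrable_indicator_mult:
  fixes h :: "real \<times> real \<Rightarrow> real"
  assumes "integrable \<pi> h" "A \<in> sets borel"
  shows "integrable \<pi> (\<lambda>z. indicator A z * h z)"
  using integrable_real_mult_indicator[of A \<pi> h] assms by (simp add: mult.commute)

lemma sets_fst_vimage [measurable]: "J \<in> sets borel \<Longrightarrow> fst -` J \<in> sets (borel :: (real \<times> real) measure)"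
  using measurable_sets[OF measurable_coords(1), of J] by simp

lemma sets_snd_vimage [measurable]: "J \<in> sets borel \<Longrightarrow> snd -` J \<in> sets (borel :: (real \<times> real) measure)"
  using measurable_sets[OF measurable_coords(2), of J] by simp

definition slice :: "real set \<Rightarrow> real measure" where
  "slice J = distr (density \<pi> (indicator (fst -` J))) borel snd"

lemma emeasure_slice:
  assumes [measurable]: "J \<in> sets borel" "B \<in> sets borel"
  shows "emeasure (slice J) B = emeasure \<pi> (fst -` J \<inter> snd -` B)"
proof -
  have "emeasure (slice J) B = emeasure (density \<pi> (indicator (fst -` J))) (snd -` B)"
    unfolding slice_def by (subst emeasure_distr) auto
  also have "\<dots> = (\<integral>\<^sup>+z. indicator (fst -` J) z * indicator (snd -` B) z \<partial>\<pi>)"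
    by (subst emeasure_density) simp_all
  also have "\<dots> = (\<integral>\<^sup>+z. indicator (fst -` J \<inter> snd -` B) z \<partial>\<pi>)"
    by (simp only: indicator_inter_arith)
  also have "\<dots> = emeasure \<pi> (fst -` J \<inter> snd -` B)"
    by (subst nn_integral_indicator) auto
  finally show ?thesis .
qed

lemma measure_slice:
  assumes "J \<in> sets borel" "B \<in> sets borel"
  shows "measure (slice J) B = measure \<pi> (fst -` J \<inter> snd -` B)"
  using emeasure_slice[OF assms] by (simp add: measure_def)

lemma integral_slice:
  fixes h :: "real \<Rightarrow> real"
  assumes [measurable]: "J \<in> sets borel" "h \<in> borel_measurable borel"
  shows "(\<integral>y. h y \<partial>slice J) = (\<integral>z. indicator J (fst z) * h (snd z) \<partial>\<pi>)"
proof -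
  have "(\<integral>y. h y \<partial>slice J) = (\<integral>z. h (snd z) \<partial>density \<pi> (\<lambda>z. ennreal (indicator (fst -` J) z :: real)))"
    unfolding slice_def ennreal_indicator by (subst integral_distr) auto
  also have "\<dots> = (\<integral>z. indicator (fst -` J) z * h (snd z) \<partial>\<pi>)"
    by (subst integral_density) auto
  also have "\<dots> = (\<integral>z. indicator J (fst z) * h (snd z) \<partial>\<pi>)"
    by (intro Bochner_Integration.integral_cong) (auto simp: indicator_def)
  finally show ?thesis .
qed

lemma first_moment_slice:
  assumes J [measurable]: "J \<in> sets borel"
  shows "first_moment_measure (slice J)"
proof -
  have "emeasure (slice J) UNIV \<noteq> \<infinity>"
    using emeasure_slice[OF J, of UNIV] emeasure_finite by simp
  then interpret s: finite_measure "slice J"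
    by (intro finite_measureI) (simp add: slice_def)
  have "integrable (density \<pi> (\<lambda>z. ennreal (indicator (fst -` J) z :: real))) snd"
    using integrable_indicator_mult[OF integrable_snd[OF Y.integrable_id], of "fst -` J"]
    by (subst integrable_density) auto
  then have "integrable (slice J) (\<lambda>y. y)"
    unfolding slice_def ennreal_indicator by (subst integrable_distr_eq) auto
  then show ?thesis
    by unfold_locales (simp_all add: slice_def)
qed

lemma atomless_slice:
  assumes "atomless \<nu>" and J [measurable]: "J \<in> sets borel"
  shows "atomless (slice J)"
  unfolding atomless_def
proof
  fix y
  have "emeasure (slice J) {y} \<le> emeasure \<pi> (snd -` {y})"
    unfolding emeasure_slice[OF J, of "{y}", simplified] by (intro emeasure_mono) auto
  also have "\<dots> = emeasure \<nu> {y}"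
    unfolding distr_snd[symmetric] by (subst emeasure_distr) auto
  finally show "emeasure (slice J) {y} = 0" using assms(1) unfolding atomless_def by simp
qed

text \<open>Conditional Jensen for |x - t|: the sign of X - t is a function of X, so on either side
  of t the martingale property replaces X by Y, and the signed deviation of Y is at most |Y -
  t|.\<close>

lemma slice_convex_order:
  assumes J [measurable]: "J \<in> sets borel"
  shows "mass (restr \<mu> J) = mass (slice J)" and "moment (restr \<mu> J) = moment (slice J)"
    and "pot (restr \<mu> J) t \<le> pot (slice J) t"
proof -
  have int_x: "integrable \<pi> (\<lambda>z. fst z)" and int_y: "integrable \<pi> (\<lambda>z. snd z)"
    using integrable_fst[OF X.integrable_id] integrable_snd[OF Y.integrable_id] by auto
  have ind: "integrable \<pi> (\<lambda>z. indicator B (fst z) * h z)"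
    if "B \<in> sets borel" "integrable \<pi> h" for B and h :: "real \<times> real \<Rightarrow> real"
    using integrable_indicator_mult[OF that(2) sets_fst_vimage[OF that(1)]]
    by (simp add: indicator_def)
  have shift: "(\<integral>z. indicator B (fst z) * (snd z - t) \<partial>\<pi>) = (\<integral>z. indicator B (fst z) * (fst z - t) \<partial>\<pi>)"
    if B: "B \<in> sets borel" for B
    using martingale[OF B] ind[OF B int_x] ind[OF B int_y] ind[OF B, of "\<lambda>_. t"]
    by (simp add: right_diff_distrib)
  show "mass (restr \<mu> J) = mass (slice J)"
  proof -
    have "measure \<mu> J = measure \<pi> (fst -` J)"
      unfolding distr_fst[symmetric] by (subst measure_distr) auto
    then show ?thesis by (simp add: X.mass_restr measure_slice)
  qed
  show "moment (restr \<mu> J) = moment (slice J)"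
    using martingale[OF J] by (simp add: X.moment_restr integral_slice integral_fst)
  let ?A = "J \<inter> {t..}" and ?B = "J \<inter> {..<t}"
  have AB: "integrable \<pi> (\<lambda>z. indicator ?A (fst z) * (f z - t))" "integrable \<pi> (\<lambda>z. indicator ?B (fst z) * (f z - t))"
    if "integrable \<pi> f" for f
    using that by (auto intro!: ind)
  have "pot (restr \<mu> J) t = (\<integral>z. indicator ?A (fst z) * (fst z - t) - indicator ?B (fst z) * (fst z - t) \<partial>\<pi>)"
  proof -
    have "pot (restr \<mu> J) t = (\<integral>z. indicator J (fst z) * \<bar>fst z - t\<bar> \<partial>\<pi>)"
      by (simp add: X.pot_restr integral_fst)
    also have "\<dots> = (\<integral>z. indicator ?A (fst z) * (fst z - t) - indicator ?B (fst z) * (fst z - t) \<partial>\<pi>)"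
      by (intro Bochner_Integration.integral_cong) (auto simp: indicator_def)
    finally show ?thesis .
  qed
  also have "\<dots> = (\<integral>z. indicator ?A (fst z) * (snd z - t) - indicator ?B (fst z) * (snd z - t) \<partial>\<pi>)"
    using shift[of ?A] shift[of ?B] AB[OF int_x] AB[OF int_y] by simp
  also have "\<dots> \<le> (\<integral>z. indicator J (fst z) * \<bar>snd z - t\<bar> \<partial>\<pi>)"
  proof (rule integral_mono)
    show "integrable \<pi> (\<lambda>z. indicator ?A (fst z) * (snd z - t) - indicator ?B (fst z) * (snd z - t))"
      using AB[OF int_y] by simp
    show "integrable \<pi> (\<lambda>z. indicator J (fst z) * \<bar>snd z - t\<bar>)"
      using int_y by (intro ind) auto
  qed (auto simp: indicator_def)
  also have "\<dots> = pot (slice J) t"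
    unfolding pot_def by (simp add: integral_slice)
  finally show "pot (restr \<mu> J) t \<le> pot (slice J) t" .
qed

end

text \<open>The sums in \<open>spreads\<close> are unconditional precisely so that they can be
  reindexed along the enumeration of pairs.\<close>

lemma has_sum_prod_decode_slice:
  fixes g :: "nat \<Rightarrow> real"
  assumes "(g has_sum s) UNIV"
  shows "((\<lambda>n. if fst (prod_decode n) = i then g (snd (prod_decode n)) else 0) has_sum s) UNIV"
proof -
  have "((\<lambda>p. if fst p = i then g (snd p) else 0) has_sum s) (Pair i ` UNIV)"
    using assms by (subst has_sum_reindex) (auto simp: inj_on_def comp_def)
  moreover have "((\<lambda>p. if fst p = i then g (snd p) else 0) has_sum s) (Pair i ` UNIV)
      \<longleftrightarrow> ((\<lambda>p. if fst p = i then g (snd p) else 0) has_sum s) UNIV"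
    by (rule has_sum_cong_neutral) (auto simp: image_iff)
  ultimately have "((\<lambda>p. if fst p = i then g (snd p) else 0) has_sum s) UNIV" by (rule iffD1[rotated])
  then show ?thesis
    by (subst has_sum_reindex_bij_betw[OF bij_prod_decode])
qed

text \<open>The decomposition of \<open>convex_order_pieces\<close>, chosen for every slice of \<pi>
  at once.\<close>

locale sliced_coupling = martingale_coupling +
  fixes I :: "real \<Rightarrow> nat" and Z :: "nat \<Rightarrow> real set" and S :: "nat \<Rightarrow> nat \<Rightarrow> real set"
    and k :: "nat \<Rightarrow> nat \<Rightarrow> real \<Rightarrow> real" and b :: "nat \<Rightarrow> nat \<Rightarrow> real"
  assumes I [measurable]: "I \<in> measurable borel (count_space UNIV)" and al: "atomless \<nu>"
    and pieces: "\<And>i. pieces (restr \<mu> {x. I x = i}) (slice {x. I x = i}) (Z i) (S i) (k i) (b i)"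
    and rest: "\<And>i. restr (slice {x. I x = i}) (- (\<Union>q. S i q)) = restr (restr \<mu> {x. I x = i}) (Z i)"
begin

definition J :: "nat \<Rightarrow> real set" where "J i = {x. I x = i}"

text \<open>A single index stands for a pair of slice and atom, because \<open>barcode\<close> and
  \<open>pieces\<close> take one sequence; this is its slice component.\<close>

definition cell :: "nat \<Rightarrow> nat" where "cell n = fst (prod_decode n)"

definition T :: "nat \<Rightarrow> real set" where "T n = S (cell n) (snd (prod_decode n))"

abbreviation source :: "nat \<Rightarrow> real measure" where "source n \<equiv> slice (J (cell n))"

lemma J_sets [measurable, simp]: "J i \<in> sets borel"
  unfolding J_def by measurable

lemma S_sets [measurable, simp]: "S i q \<in> sets borel"
  using pieces[of i] unfolding pieces_def by blast

lemma T_sets [measurable, simp]: "T n \<in> sets borel"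
  unfolding T_def by simp

lemma Z_sets [measurable, simp]: "Z i \<in> sets borel"
  using pieces[of i] unfolding pieces_def by blast

lemma first_moment_source: "first_moment_measure (source n)"
  by (intro first_moment_slice) simp

lemma integral_slice_rest:
  fixes h :: "real \<Rightarrow> real"
  assumes h: "h \<in> borel_measurable borel"
  shows "(\<integral>y. indicator (- (\<Union>q. S i q)) y * h y \<partial>slice (J i)) = (\<integral>x. indicator (J i \<inter> Z i) x * h x \<partial>\<mu>)"
proof -
  interpret s: first_moment_measure "slice (J i)" by (intro first_moment_slice) simp
  interpret r: first_moment_measure "restr \<mu> (J i)" by (intro X.first_moment_measure_restr) simp
  have "(\<integral>y. indicator (- (\<Union>q. S i q)) y * h y \<partial>slice (J i)) = (\<integral>y. h y \<partial>restr (slice (J i)) (- (\<Union>q. S i q)))"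
    using h by (intro s.integral_restr[symmetric]) auto
  also have "\<dots> = (\<integral>x. h x \<partial>restr (restr \<mu> (J i)) (Z i))"
    using rest[of i] unfolding J_def by simp
  also have "restr (restr \<mu> (J i)) (Z i) = restr \<mu> (J i \<inter> Z i)"
    by (rule X.restr_restr) simp_all
  also have "(\<integral>x. h x \<partial>\<dots>) = (\<integral>x. indicator (J i \<inter> Z i) x * h x \<partial>\<mu>)"
    using h by (intro X.integral_restr) simp_all
  finally show ?thesis .
qed

text \<open>Under \<pi> the event that Y is in \<open>J j\<close> splits into the pieces of all
  slices and their leftovers. The leftover of slice i is \<mu> on \<open>J i \<inter> Z i\<close>
  and so misses \<open>J j\<close> unless i = j. The integrands 1, y and |y - t| supply mass, moment
  and potential to \<open>cell_barcode\<close>.\<close>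

lemma cell_sums:
  fixes h :: "real \<Rightarrow> real"
  assumes h: "integrable \<nu> h"
  shows "(\<lambda>n. \<integral>y. indicator (T n \<inter> J j) y * h y \<partial>source n)
    sums ((\<integral>y. indicator (J j) y * h y \<partial>\<nu>) - (\<integral>x. indicator (J j \<inter> Z j) x * h x \<partial>\<mu>))"
proof -
  have [measurable]: "h \<in> borel_measurable borel" using borel_measurable_integrable[OF h] by simp
  note h' = integrable_snd[OF h]
  define A where "A n = fst -` J (cell n) \<inter> snd -` (T n \<inter> J j)" for n
  define C where "C i = fst -` J i \<inter> snd -` (- (\<Union>q. S i q) \<inter> J j)" for i
  have A_sets [measurable]: "A n \<in> sets borel" for n
    unfolding A_def by (intro sets.Int sets_fst_vimage sets_snd_vimage) simp_all
  have C_sets [measurable]: "C i \<in> sets borel" for i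
    unfolding C_def by (intro sets.Int sets_fst_vimage sets_snd_vimage) (auto intro!: sets.Int)
  have A_disj: "disjoint_family A"
  proof -
    have "n = n'" if z: "z \<in> A n" "z \<in> A n'" for n n' z
    proof -
      have "cell n = cell n'" using z unfolding A_def J_def by simp
      moreover have "snd z \<in> S (cell n) (snd (prod_decode n))" "snd z \<in> S (cell n') (snd (prod_decode n'))"
        using z unfolding A_def T_def by auto
      moreover have "disjoint_family (S (cell n))" using pieces unfolding pieces_def by blast
      ultimately have "snd (prod_decode n) = snd (prod_decode n')"
        unfolding disjoint_family_on_def by fastforce
      with \<open>cell n = cell n'\<close> have "prod_decode n = prod_decode n'" unfolding cell_def by (rule prod_eqI)
      then show ?thesis by simp
    qed
    then show ?thesis unfolding disjoint_family_on_def by blast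
  qed
  have C_disj: "disjoint_family C"
    unfolding disjoint_family_on_def C_def J_def by auto
  have A_int: "(\<integral>z. indicator (A n) z * h (snd z) \<partial>\<pi>) = (\<integral>y. indicator (T n \<inter> J j) y * h y \<partial>source n)" for n
    by (subst integral_slice) (auto intro!: Bochner_Integration.integral_cong simp: A_def indicator_def)
  have C_int: "(\<integral>z. indicator (C i) z * h (snd z) \<partial>\<pi>) = (if i = j then \<integral>x. indicator (J j \<inter> Z j) x * h x \<partial>\<mu> else 0)" for i
  proof -
    have "(\<integral>z. indicator (C i) z * h (snd z) \<partial>\<pi>)
        = (\<integral>y. indicator (- (\<Union>q. S i q)) y * (indicator (J j) y * h y) \<partial>slice (J i))"
      by (subst integral_slice) (auto intro!: Bochner_Integration.integral_cong simp: C_def indicator_def)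
    also have "\<dots> = (\<integral>x. indicator (J i \<inter> Z i) x * (indicator (J j) x * h x) \<partial>\<mu>)"
      by (rule integral_slice_rest) measurable
    also have "\<dots> = (if i = j then \<integral>x. indicator (J j \<inter> Z j) x * h x \<partial>\<mu> else 0)"
    proof (cases "i = j")
      case True
      then show ?thesis
        by (auto intro!: Bochner_Integration.integral_cong simp: indicator_def)
    next
      case False
      have "(\<integral>x. indicator (J i \<inter> Z i) x * (indicator (J j) x * h x) \<partial>\<mu>) = (\<integral>x. 0 \<partial>\<mu>)"
        using False by (intro Bochner_Integration.integral_cong) (auto simp: indicator_def J_def)
      then show ?thesis using False by simp
    qed
    finally show ?thesis .
  qed
  have sA: "(\<lambda>n. \<integral>y. indicator (T n \<inter> J j) y * h y \<partial>source n) sums (\<integral>z. indicator (\<Union>n. A n) z * h (snd z) \<partial>\<pi>)"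
    unfolding A_int[symmetric] by (intro sums_integral_UN h' A_disj) simp
  have sC: "(\<lambda>i. if i = j then \<integral>x. indicator (J j \<inter> Z j) x * h x \<partial>\<mu> else 0)
      sums (\<integral>z. indicator (\<Union>i. C i) z * h (snd z) \<partial>\<pi>)"
    unfolding C_int[symmetric] by (intro sums_integral_UN h' C_disj) simp
  have UN: "(\<Union>i. C i) = snd -` J j - (\<Union>n. A n)"
  proof (intro equalityI subsetI)
    fix z assume "z \<in> (\<Union>i. C i)"
    then show "z \<in> snd -` J j - (\<Union>n. A n)" unfolding A_def C_def J_def T_def by auto
  next
    fix z assume z: "z \<in> snd -` J j - (\<Union>n. A n)"
    have "snd z \<notin> S (I (fst z)) q" for q
    proof
      assume "snd z \<in> S (I (fst z)) q"
      then have "z \<in> A (prod_encode (I (fst z), q))"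
        using z unfolding A_def J_def T_def cell_def by simp
      with z show False by blast
    qed
    then have "z \<in> C (I (fst z))" using z unfolding C_def J_def by auto
    then show "z \<in> (\<Union>i. C i)" by blast
  qed
  have "(\<integral>z. indicator (\<Union>n. A n) z * h (snd z) \<partial>\<pi>) + (\<integral>z. indicator (\<Union>i. C i) z * h (snd z) \<partial>\<pi>)
      = (\<integral>z. indicator (\<Union>n. A n) z * h (snd z) + indicator (\<Union>i. C i) z * h (snd z) \<partial>\<pi>)"
    by (intro Bochner_Integration.integral_add[symmetric] integrable_indicator_mult h') auto
  also have "\<dots> = (\<integral>z. indicator (J j) (snd z) * h (snd z) \<partial>\<pi>)"
    unfolding UN by (intro Bochner_Integration.integral_cong) (auto simp: indicator_def A_def)
  also have "\<dots> = (\<integral>y. indicator (J j) y * h y \<partial>\<nu>)"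
    by (rule integral_snd[symmetric]) measurable
  also have "(\<integral>z. indicator (\<Union>i. C i) z * h (snd z) \<partial>\<pi>) = (\<integral>x. indicator (J j \<inter> Z j) x * h x \<partial>\<mu>)"
    by (rule sums_unique2[OF sC]) (rule sums_single)
  finally have "(\<integral>z. indicator (\<Union>n. A n) z * h (snd z) \<partial>\<pi>)
      = (\<integral>y. indicator (J j) y * h y \<partial>\<nu>) - (\<integral>x. indicator (J j \<inter> Z j) x * h x \<partial>\<mu>)" by simp
  with sA show ?thesis by simp
qed

text \<open>The part of \<open>\<nu>\<close> in \<open>J j\<close> consists of the contributions of all pieces of all slices and of the
  contact part of the slice \<open>j\<close> alone, as the contact part of the slice \<open>i\<close> sits inside \<open>J i\<close>.\<close>

lemma cell_barcode:
  obtains U where "\<And>n. U n \<in> sets borel" "disjoint_family U" "\<And>n. U n \<subseteq> J j"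
    "\<And>n. measure \<nu> (U n) = measure (source n) (T n \<inter> J j)"
    "\<And>n. (\<integral>y. indicator (U n) y * y \<partial>\<nu>) = (\<integral>y. indicator (T n \<inter> J j) y * y \<partial>source n)"
    "mass (restr \<mu> (J j \<inter> Z j)) = mass (restr \<nu> (J j - (\<Union>n. U n)))"
    "moment (restr \<mu> (J j \<inter> Z j)) = moment (restr \<nu> (J j - (\<Union>n. U n)))"
    "\<And>t. pot (restr \<mu> (J j \<inter> Z j)) t \<le> pot (restr \<nu> (J j - (\<Union>n. U n))) t"
proof -
  have TJ [measurable]: "T n \<inter> J j \<in> sets borel" for n by simp
  define m where "m n = measure (source n) (T n \<inter> J j)" for n
  define M where "M n = (\<integral>y. indicator (T n \<inter> J j) y * y \<partial>source n)" for n
  \<comment> \<open>Barycentre of the contribution. For m n = 0 the division returns 0, which is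
    compatible with \<open>mc_eq\<close> because M n is then 0 too.\<close>
  define c where "c n = M n / m n" for n
  interpret E: first_moment_measure "restr \<mu> (J j \<inter> Z j)" by (rule X.first_moment_measure_restr) simp
  interpret N: first_moment_measure "restr \<nu> (J j)" by (rule Y.first_moment_measure_restr) simp
  have m0: "0 \<le> m n" for n unfolding m_def by simp
  \<comment> \<open>Collapsing a contribution to its barycentre does not raise its potential; summed
    over n, this is the hypothesis of \<open>barcode\<close>.\<close>
  have mc: "m n * \<bar>c n - t\<bar> \<le> (\<integral>y. indicator (T n \<inter> J j) y * \<bar>y - t\<bar> \<partial>source n)"
    and mc_eq: "m n * c n = M n" for n t
  proof -
    interpret s: first_moment_measure "source n" by (rule first_moment_source)
    interpret r: first_moment_measure "restr (source n) (T n \<inter> J j)" by (rule s.first_moment_measure_restr) fact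
    have ge: "\<bar>M n - t * m n\<bar> \<le> (\<integral>y. indicator (T n \<inter> J j) y * \<bar>y - t\<bar> \<partial>source n)" for t
      using r.pot_ge[of t] unfolding M_def m_def
      by (simp only: s.mass_restr[OF TJ] s.moment_restr[OF TJ] s.pot_restr[OF TJ])
    show eq: "m n * c n = M n"
    proof (cases "m n = 0")
      case True
      have "T n \<inter> J j \<in> null_sets (source n)"
        using True unfolding m_def by (intro null_setsI) (simp_all add: s.emeasure_eq_measure)
      from AE_not_in[OF this] have "M n = (\<integral>y. 0 \<partial>source n)"
        unfolding M_def by (intro integral_cong_AE) (auto elim!: eventually_mono)
      then show ?thesis using True by simp
    next
      case False
      then show ?thesis unfolding c_def by simp
    qed
    have "m n * \<bar>c n - t\<bar> = \<bar>m n * c n - t * m n\<bar>"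
    proof -
      have "m n * c n - t * m n = m n * (c n - t)" by (simp add: algebra_simps)
      then show ?thesis using m0[of n] by (simp add: abs_mult)
    qed
    then show "m n * \<bar>c n - t\<bar> \<le> (\<integral>y. indicator (T n \<inter> J j) y * \<bar>y - t\<bar> \<partial>source n)"
      using ge[of t] unfolding eq by simp
  qed
  have sums_m: "m sums (measure \<nu> (J j) - measure \<mu> (J j \<inter> Z j))"
  proof -
    have "(\<integral>y. indicator (T n \<inter> J j) y * 1 \<partial>source n) = m n" for n
    proof -
      interpret s: first_moment_measure "source n" by (rule first_moment_source)
      show ?thesis unfolding m_def by simp
    qed
    then show ?thesis using cell_sums[of "\<lambda>_. 1" j] by simp
  qed
  have sums_M: "M sums (moment (restr \<nu> (J j)) - moment (restr \<mu> (J j \<inter> Z j)))"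
    using cell_sums[OF Y.integrable_id, of j] unfolding M_def
    by (simp only: X.moment_restr Y.moment_restr J_sets Z_sets sets.Int)
  have sums_P: "(\<lambda>n. \<integral>y. indicator (T n \<inter> J j) y * \<bar>y - t\<bar> \<partial>source n)
      sums (pot (restr \<nu> (J j)) t - pot (restr \<mu> (J j \<inter> Z j)) t)" for t
    using cell_sums[OF Y.integrable_abs_diff, of j]
    by (simp only: X.pot_restr Y.pot_restr J_sets Z_sets sets.Int)
  have s_abs: "summable (\<lambda>n. m n * \<bar>c n - t\<bar>)" for t
    by (rule summable_comparison_test[OF _ sums_summable[OF sums_P[of t]]])
      (use mc[of _ t] m0 in \<open>auto simp: abs_mult\<close>)
  obtain V where V [measurable]: "\<And>n. V n \<in> sets borel" and disj: "disjoint_family V"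
    and mV: "\<And>n. measure (restr \<nu> (J j)) (V n) = m n"
    and fV: "\<And>n. (\<integral>y. indicator (V n) y * y \<partial>restr \<nu> (J j)) = m n * c n"
    and pV: "\<And>t. pot (restr \<mu> (J j \<inter> Z j)) t \<le> pot (restr (restr \<nu> (J j)) (- (\<Union>n. V n))) t"
  proof (rule N.barcode[OF Y.atomless_restr[OF al J_sets] E.first_moment_measure_axioms, of m c])
    show "summable m" by (rule sums_summable[OF sums_m])
    show "summable (\<lambda>q. m q * \<bar>c q\<bar>)" using s_abs[of 0] by simp
    show "mass (restr \<mu> (J j \<inter> Z j)) + (\<Sum>q. m q) = mass (restr \<nu> (J j))"
      using sums_unique[OF sums_m] by (simp add: X.mass_restr Y.mass_restr)
    show "moment (restr \<mu> (J j \<inter> Z j)) + (\<Sum>q. m q * c q) = moment (restr \<nu> (J j))"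
      using sums_unique[OF sums_M] unfolding mc_eq by simp
    show "pot (restr \<mu> (J j \<inter> Z j)) t + (\<Sum>q. m q * \<bar>c q - t\<bar>) \<le> pot (restr \<nu> (J j)) t" for t
      using suminf_le[OF mc s_abs sums_summable[OF sums_P], of t] sums_unique[OF sums_P[of t]] by simp
  qed (use m0 in blast)+
  \<comment> \<open>The sets from \<open>barcode\<close> may leave \<open>J j\<close>, but
    \<open>restr \<nu> (J j)\<close> does not see that part.\<close>
  define U where "U n = J j \<inter> V n" for n
  have U [measurable]: "U n \<in> sets borel" for n unfolding U_def by simp
  have U_disj: "disjoint_family U" using disj unfolding disjoint_family_on_def U_def by blast
  have mU: "measure \<nu> (U n) = m n" for n
    using mV[of n] unfolding U_def by (simp add: Y.measure_restr)
  have fU: "(\<integral>y. indicator (U n) y * y \<partial>\<nu>) = M n" for n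
    using fV[of n] unfolding U_def mc_eq by (simp add: Y.integral_restr indicator_inter_arith mult.assoc)
  have eq: "restr (restr \<nu> (J j)) (- (\<Union>n. V n)) = restr \<nu> (J j - (\<Union>n. U n))"
  proof -
    have "J j \<inter> - (\<Union>n. V n) = J j - (\<Union>n. U n)" unfolding U_def by auto
    then show ?thesis by (subst Y.restr_restr) auto
  qed
  have UJ: "(\<Union>n. U n) \<subseteq> J j" unfolding U_def by auto
  have "(\<lambda>n. m n) sums measure \<nu> (\<Union>n. U n)"
    unfolding mU[symmetric] using U_disj by (intro Y.finite_measure_UNION) auto
  then have "measure \<nu> (\<Union>n. U n) = measure \<nu> (J j) - measure \<mu> (J j \<inter> Z j)"
    by (rule sums_unique2) (rule sums_m)
  moreover have "measure \<nu> (J j - (\<Union>n. U n)) = measure \<nu> (J j) - measure \<nu> (\<Union>n. U n)"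
    using UJ by (intro Y.finite_measure_Diff) auto
  ultimately have mass: "mass (restr \<mu> (J j \<inter> Z j)) = mass (restr \<nu> (J j - (\<Union>n. U n)))"
    by (simp add: X.mass_restr Y.mass_restr)
  have "M sums (\<integral>y. indicator (\<Union>n. U n) y * y \<partial>\<nu>)"
    unfolding fU[symmetric] using U_disj by (intro sums_integral_UN Y.integrable_id) auto
  then have "(\<integral>y. indicator (\<Union>n. U n) y * y \<partial>\<nu>) = moment (restr \<nu> (J j)) - moment (restr \<mu> (J j \<inter> Z j))"
    by (rule sums_unique2) (rule sums_M)
  moreover have "(\<integral>y. indicator (J j - (\<Union>n. U n)) y * y \<partial>\<nu>)
      = (\<integral>y. indicator (J j) y * y - indicator (\<Union>n. U n) y * y \<partial>\<nu>)"
    using UJ by (intro Bochner_Integration.integral_cong) (auto simp: indicator_def)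
  moreover have "\<dots> = (\<integral>y. indicator (J j) y * y \<partial>\<nu>) - (\<integral>y. indicator (\<Union>n. U n) y * y \<partial>\<nu>)"
    by (intro Bochner_Integration.integral_diff Y.integrable_indicator_mult Y.integrable_id) auto
  ultimately have mom: "moment (restr \<mu> (J j \<inter> Z j)) = moment (restr \<nu> (J j - (\<Union>n. U n)))"
    by (simp add: Y.moment_restr)
  show ?thesis
    using that[OF U U_disj _ _ _ mass mom] mU fU pV unfolding eq m_def M_def U_def[symmetric]
    by (auto simp: U_def)
qed

end

section \<open>Gluing the cells to a map of the whole line\<close>

context sliced_coupling
begin

definition Z_all :: "real set" where "Z_all = (\<Union>j. J j \<inter> Z j)"

lemma Z_all_iff: "x \<in> Z_all \<longleftrightarrow> x \<in> Z (I x)"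
  unfolding Z_all_def J_def by auto

lemma Z_all_sets [measurable, simp]: "Z_all \<in> sets borel"
  unfolding Z_all_def by simp

definition k_all :: "nat \<Rightarrow> real \<Rightarrow> real" where
  "k_all n x = indicator (J (cell n)) x * k (cell n) (snd (prod_decode n)) x"

definition b_all :: "nat \<Rightarrow> real" where "b_all n = b (cell n) (snd (prod_decode n))"

lemma spreads_cell: "spreads (Z i) (k i) (b i)"
  using pieces[of i] unfolding pieces_def by blast

text \<open>At x only the indices whose slice is \<open>I x\<close> contribute, so each sum reduces
  to the one of that slice.\<close>

lemma spreads_all: "spreads Z_all k_all b_all"
proof -
  have k_meas [measurable]: "k i q \<in> borel_measurable borel" for i q
    using spreads_cell[of i] unfolding spreads_def by blast
  have k0: "0 \<le> k i q x" for i q x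
    using spreads_cell[of i] unfolding spreads_def by blast
  have kZ: "k i q x = 0" if "x \<in> Z i" for i q x
    using spreads_cell[of i] that unfolding spreads_def by blast
  have near: "\<bar>b i q - x\<bar> \<le> 1" if "k i q x \<noteq> 0" for i q x
    using spreads_cell[of i] that unfolding spreads_def by blast
  have slice: "((\<lambda>n. k_all n x * v n) has_sum s) UNIV"
    if "((\<lambda>q. k (I x) q x * w q) has_sum s) UNIV" "\<And>n. cell n = I x \<Longrightarrow> v n = w (snd (prod_decode n))"
    for x v w s
  proof -
    have eq: "(\<lambda>n. if fst (prod_decode n) = I x then k (I x) (snd (prod_decode n)) x * w (snd (prod_decode n)) else 0)
      = (\<lambda>n. k_all n x * v n)"
      using that(2) by (auto simp: k_all_def cell_def J_def fun_eq_iff)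
    show ?thesis using has_sum_prod_decode_slice[OF that(1), of "I x"] unfolding eq .
  qed
  show ?thesis
    unfolding spreads_def
  proof (intro conjI allI ballI impI)
    show "k_all n \<in> borel_measurable borel" for n unfolding k_all_def by measurable
    show "0 \<le> k_all n x" for n x unfolding k_all_def using k0 by simp
    show "k_all n x = 0" if "x \<in> Z_all" for n x
      using that kZ[of x "I x"] unfolding k_all_def Z_all_iff J_def by (auto simp: indicator_def)
    show "\<bar>b_all n - x\<bar> \<le> 1" if "k_all n x \<noteq> 0" for n x
      using that near unfolding k_all_def b_all_def by auto
    fix x assume "x \<notin> Z_all"
    then have "((\<lambda>q. k (I x) q x) has_sum 1) UNIV" "((\<lambda>q. k (I x) q x * b (I x) q) has_sum x) UNIV"
      using spreads_cell[of "I x"] unfolding Z_all_iff spreads_def by blast+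
    then show "((\<lambda>q. k_all q x) has_sum 1) UNIV" "((\<lambda>q. k_all q x * b_all q) has_sum x) UNIV"
      using slice[of x "\<lambda>_. 1" 1 "\<lambda>_. 1"] slice[of x "b (I x)" x b_all] by (auto simp: b_all_def)
  qed
qed

lemma source_integral:
  "measure (source n) (T n) = (\<integral>x. k_all n x \<partial>\<mu>)"
  "(\<integral>y. indicator (T n) y * y \<partial>source n) = b_all n * (\<integral>x. k_all n x \<partial>\<mu>)"
proof -
  have "k (cell n) q \<in> borel_measurable borel" for q
    using spreads_cell[of "cell n"] unfolding spreads_def by blast
  then have "(\<integral>x. k (cell n) (snd (prod_decode n)) x \<partial>restr \<mu> (J (cell n))) = (\<integral>x. k_all n x \<partial>\<mu>)"
    unfolding k_all_def by (intro X.integral_restr) simp_all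
  then show "measure (source n) (T n) = (\<integral>x. k_all n x \<partial>\<mu>)"
    "(\<integral>y. indicator (T n) y * y \<partial>source n) = b_all n * (\<integral>x. k_all n x \<partial>\<mu>)"
    using pieces[of "cell n"] unfolding pieces_def J_def[symmetric] T_def b_all_def by auto
qed

text \<open>The leftover of slice i is a copy of \<mu> on \<open>J i \<inter> Z i\<close>: contact
  mass occurs in diagonal cells only.\<close>

lemma slice_cell_rest:
  "measure (slice (J i)) (J j - (\<Union>q. S i q)) = (if i = j then measure \<mu> (J j \<inter> Z j) else 0)"
proof -
  interpret s: first_moment_measure "slice (J i)" by (intro first_moment_slice) simp
  have [measurable]: "J j - (\<Union>q. S i q) \<in> sets borel" by (intro sets.Diff) auto
  have "measure (slice (J i)) (J j - (\<Union>q. S i q)) = (\<integral>y. indicator (J j - (\<Union>q. S i q)) y \<partial>slice (J i))"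
    by simp
  also have "\<dots> = (\<integral>y. indicator (- (\<Union>q. S i q)) y * indicator (J j) y \<partial>slice (J i))"
    by (intro Bochner_Integration.integral_cong) (auto simp: indicator_def)
  also have "\<dots> = (\<integral>x. indicator (J i \<inter> Z i) x * indicator (J j) x \<partial>\<mu>)"
    by (rule integral_slice_rest) simp
  also have "\<dots> = (\<integral>x. indicator (J i \<inter> Z i \<inter> J j) x \<partial>\<mu>)"
    by (simp only: indicator_inter_arith)
  also have "\<dots> = measure \<mu> (J i \<inter> Z i \<inter> J j)"
    by simp
  also have "J i \<inter> Z i \<inter> J j = (if i = j then J j \<inter> Z j else {})"
    unfolding J_def by auto
  finally show ?thesis by (simp split: if_splits)
qed

text \<open>The sets \<open>U j n\<close> reproduce mass and moment of
  \<open>T n \<inter> J j\<close>. Their union \<open>V n\<close> over j thus has mass and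
  barycentre of \<open>T n\<close>, which is all that \<open>pieces\<close> asks for, now for \<mu>
  and \<nu> themselves. The glued map sends \<open>V n\<close> into the slice of n and the remainder
  of \<open>J j\<close> into \<open>J j\<close>, so the cell masses can be read off from those of
  the \<open>U j n\<close>.\<close>

lemma cellwise_map:
  obtains f where "barycentric_map \<mu> \<nu> f"
    "\<And>i j. measure \<nu> {y. I (f y) = i \<and> I y = j} = measure \<pi> {z. I (fst z) = i \<and> I (snd z) = j}"
proof -
  have "\<exists>U g. (\<forall>n. U n \<in> sets borel) \<and> disjoint_family U \<and> (\<forall>n. U n \<subseteq> J j) \<and>
      (\<forall>n. measure \<nu> (U n) = measure (source n) (T n \<inter> J j)) \<and>
      (\<forall>n. (\<integral>y. indicator (U n) y * y \<partial>\<nu>) = (\<integral>y. indicator (T n \<inter> J j) y * y \<partial>source n)) \<and>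
      mass (restr \<mu> (J j \<inter> Z j)) = mass (restr \<nu> (J j - (\<Union>n. U n))) \<and>
      barycentric_map (restr \<mu> (J j \<inter> Z j)) (restr \<nu> (J j - (\<Union>n. U n))) g" for j
  proof -
    obtain U where U: "\<And>n. U n \<in> sets borel" "disjoint_family U" "\<And>n. U n \<subseteq> J j"
      "\<And>n. measure \<nu> (U n) = measure (source n) (T n \<inter> J j)"
      "\<And>n. (\<integral>y. indicator (U n) y * y \<partial>\<nu>) = (\<integral>y. indicator (T n \<inter> J j) y * y \<partial>source n)"
      and m: "mass (restr \<mu> (J j \<inter> Z j)) = mass (restr \<nu> (J j - (\<Union>n. U n)))"
      "moment (restr \<mu> (J j \<inter> Z j)) = moment (restr \<nu> (J j - (\<Union>n. U n)))"
      "\<And>t. pot (restr \<mu> (J j \<inter> Z j)) t \<le> pot (restr \<nu> (J j - (\<Union>n. U n))) t"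
      by (rule cell_barcode[of j]) (rule that; assumption)
    have L: "J j - (\<Union>n. U n) \<in> sets borel" using U(1) by (intro sets.Diff) auto
    obtain g where "barycentric_map (restr \<mu> (J j \<inter> Z j)) (restr \<nu> (J j - (\<Union>n. U n))) g"
      by (rule barycentric_map_exists[OF X.first_moment_measure_restr Y.first_moment_measure_restr
            Y.atomless_restr[OF al] m]) (use L in simp_all)
    with U m(1) show ?thesis by blast
  qed
  then have "\<exists>U g. \<forall>j. (\<forall>n. U j n \<in> sets borel) \<and> disjoint_family (U j) \<and> (\<forall>n. U j n \<subseteq> J j) \<and>
      (\<forall>n. measure \<nu> (U j n) = measure (source n) (T n \<inter> J j)) \<and>
      (\<forall>n. (\<integral>y. indicator (U j n) y * y \<partial>\<nu>) = (\<integral>y. indicator (T n \<inter> J j) y * y \<partial>source n)) \<and>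
      mass (restr \<mu> (J j \<inter> Z j)) = mass (restr \<nu> (J j - (\<Union>n. U j n))) \<and>
      barycentric_map (restr \<mu> (J j \<inter> Z j)) (restr \<nu> (J j - (\<Union>n. U j n))) (g j)"
    by (subst choice_iff[symmetric])+ blast
  then obtain U g where U [measurable]: "\<And>j n. U j n \<in> sets borel" and U_disj: "\<And>j. disjoint_family (U j)"
    and UJ: "\<And>j n. U j n \<subseteq> J j"
    and mU: "\<And>j n. measure \<nu> (U j n) = measure (source n) (T n \<inter> J j)"
    and fU: "\<And>j n. (\<integral>y. indicator (U j n) y * y \<partial>\<nu>) = (\<integral>y. indicator (T n \<inter> J j) y * y \<partial>source n)"
    and mL: "\<And>j. mass (restr \<mu> (J j \<inter> Z j)) = mass (restr \<nu> (J j - (\<Union>n. U j n)))"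
    and g_bary: "\<And>j. barycentric_map (restr \<mu> (J j \<inter> Z j)) (restr \<nu> (J j - (\<Union>n. U j n))) (g j)"
    by blast
  have g [measurable]: "g j \<in> borel_measurable borel" for j using g_bary unfolding barycentric_map_def by blast
  define L where "L j = J j - (\<Union>n. U j n)" for j
  have L [measurable]: "L j \<in> sets borel" for j unfolding L_def by (intro sets.Diff) auto
  define V where "V n = (\<Union>j. U j n)" for n
  have V [measurable]: "V n \<in> sets borel" for n unfolding V_def by auto
  have V_iff: "y \<in> V n \<longleftrightarrow> y \<in> U (I y) n" for y n
    using UJ unfolding V_def J_def by blast
  have V_disj: "disjoint_family V"
  proof -
    have "m = n" if "y \<in> V m" "y \<in> V n" for m n y
      using that U_disj[of "I y"] unfolding V_iff disjoint_family_on_def by blast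
    then show ?thesis unfolding disjoint_family_on_def by blast
  qed
  have UN_V: "y \<notin> (\<Union>n. V n) \<longleftrightarrow> y \<in> L (I y)" for y
    unfolding L_def by (auto simp: V_iff J_def)
  have U_disj': "disjoint_family (\<lambda>j. U j n)" for n
    using UJ unfolding disjoint_family_on_def J_def by blast
  have J_disj: "disjoint_family J" unfolding disjoint_family_on_def J_def by auto
  have UN_J: "(\<Union>j. J j) = UNIV" unfolding J_def by auto
  have mV: "measure \<nu> (V n) = (\<integral>x. k_all n x \<partial>\<mu>)"
    and fV: "(\<integral>y. indicator (V n) y * y \<partial>\<nu>) = b_all n * (\<integral>x. k_all n x \<partial>\<mu>)" for n
  proof -
    interpret s: first_moment_measure "source n" by (rule first_moment_source)
    have TJ: "disjoint_family (\<lambda>j. T n \<inter> J j)" "(\<Union>j. T n \<inter> J j) = T n"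
    proof -
      show "disjoint_family (\<lambda>j. T n \<inter> J j)" using J_disj unfolding disjoint_family_on_def by blast
      show "(\<Union>j. T n \<inter> J j) = T n" using UN_J by blast
    qed
    have "(\<lambda>j. measure \<nu> (U j n)) sums measure \<nu> (V n)"
      unfolding V_def using U_disj' by (intro Y.finite_measure_UNION) auto
    moreover have "(\<lambda>j. measure \<nu> (U j n)) sums measure (source n) (\<Union>j. T n \<inter> J j)"
      unfolding mU using TJ(1) by (intro s.finite_measure_UNION) auto
    ultimately have "measure \<nu> (V n) = measure (source n) (\<Union>j. T n \<inter> J j)" by (rule sums_unique2)
    then show "measure \<nu> (V n) = (\<integral>x. k_all n x \<partial>\<mu>)" unfolding TJ(2) source_integral .
    have "(\<lambda>j. \<integral>y. indicator (U j n) y * y \<partial>\<nu>) sums (\<integral>y. indicator (V n) y * y \<partial>\<nu>)"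
      unfolding V_def using U_disj' by (intro sums_integral_UN Y.integrable_id) auto
    moreover have "(\<lambda>j. \<integral>y. indicator (U j n) y * y \<partial>\<nu>) sums (\<integral>y. indicator (\<Union>j. T n \<inter> J j) y * y \<partial>source n)"
      unfolding fU using TJ(1) by (intro sums_integral_UN s.integrable_id) auto
    ultimately have "(\<integral>y. indicator (V n) y * y \<partial>\<nu>) = (\<integral>y. indicator (\<Union>j. T n \<inter> J j) y * y \<partial>source n)"
      by (rule sums_unique2)
    then show "(\<integral>y. indicator (V n) y * y \<partial>\<nu>) = b_all n * (\<integral>x. k_all n x \<partial>\<mu>)"
      unfolding TJ(2) source_integral .
  qed
  have pieces_all: "pieces \<mu> \<nu> Z_all V k_all b_all"
    unfolding pieces_def by (intro conjI allI Z_all_sets spreads_all V V_disj mV fV)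
  interpret R: first_moment_measure "restr \<nu> (- (\<Union>n. V n))" by (rule Y.first_moment_measure_restr) auto
  \<comment> \<open>Off all \<open>V n\<close>, the cell \<open>J j\<close> consists exactly of
    \<open>L j\<close>; this matches the terms of \<open>glue_sums\<close> with the domain of
    \<open>g j\<close>.\<close>
  have g_term: "(\<integral>y. indicator {y. I y = j} y * (indicator B (g j y) * h y) \<partial>restr \<nu> (- (\<Union>n. V n)))
      = (\<integral>y. indicator B (g j y) * h y \<partial>restr \<nu> (L j))"
    if [measurable]: "B \<in> sets borel" "h \<in> borel_measurable borel" for B j and h :: "real \<Rightarrow> real"
  proof -
    have "(\<integral>y. indicator {y. I y = j} y * (indicator B (g j y) * h y) \<partial>restr \<nu> (- (\<Union>n. V n)))
        = (\<integral>y. indicator (- (\<Union>n. V n)) y * (indicator {y. I y = j} y * (indicator B (g j y) * h y)) \<partial>\<nu>)"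
      by (rule Y.integral_restr) measurable
    also have "\<dots> = (\<integral>y. indicator (L j) y * (indicator B (g j y) * h y) \<partial>\<nu>)"
    proof (intro Bochner_Integration.integral_cong refl)
      fix y
      have "y \<in> L j \<longleftrightarrow> y \<notin> (\<Union>n. V n) \<and> I y = j" using UN_V[of y] by (auto simp: L_def J_def)
      then show "indicator (- (\<Union>n. V n)) y * (indicator {y. I y = j} y * (indicator B (g j y) * h y))
          = indicator (L j) y * (indicator B (g j y) * h y)"
        by (simp add: indicator_def)
    qed
    also have "\<dots> = (\<integral>y. indicator B (g j y) * h y \<partial>restr \<nu> (L j))"
      by (rule Y.integral_restr[symmetric]) measurable
    finally show ?thesis .
  qed
  have Z_disj: "disjoint_family (\<lambda>j. J j \<inter> Z j)"
    using J_disj unfolding disjoint_family_on_def by blast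
  have rest_all: "barycentric_map (restr \<mu> Z_all) (restr \<nu> (- (\<Union>n. V n))) (\<lambda>y. g (I y) y)"
  proof (rule barycentric_mapI)
    show "first_moment_measure (restr \<mu> Z_all)" by (rule X.first_moment_measure_restr) simp
    show "first_moment_measure (restr \<nu> (- (\<Union>n. V n)))" by (rule R.first_moment_measure_axioms)
    show "(\<lambda>y. g (I y) y) \<in> borel_measurable borel" by (rule measurable_compose_countable[OF g I])
    fix B :: "real set" assume B [measurable]: "B \<in> sets borel"
    have s1: "(\<lambda>j. \<integral>y. indicator B (g j y) * (1::real) \<partial>restr \<nu> (L j))
        sums (\<integral>y. indicator B (g (I y) y) * (1::real) \<partial>restr \<nu> (- (\<Union>n. V n)))"
      unfolding g_term[OF B borel_measurable_const, symmetric]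
      by (rule glue_sums[OF R.finite_borel_measure_axioms I g R.integrable_const B])
    have eqj: "(\<integral>y. indicator B (g j y) * (1::real) \<partial>restr \<nu> (L j)) = measure \<mu> (J j \<inter> Z j \<inter> B)" for j
    proof -
      have "(\<integral>y. indicator B (g j y) \<partial>restr \<nu> (L j)) = measure (restr \<mu> (J j \<inter> Z j)) B"
        using g_bary[of j] unfolding L_def[symmetric]
        by (rule barycentric_map_measure) (rule Y.first_moment_measure_restr[OF L], rule B)
      also have "\<dots> = measure \<mu> (J j \<inter> Z j \<inter> B)" by (rule X.measure_restr) simp_all
      finally show ?thesis unfolding mult_1_right .
    qed
    have s2: "(\<lambda>j. measure \<mu> (J j \<inter> Z j \<inter> B)) sums measure \<mu> (\<Union>j. J j \<inter> Z j \<inter> B)"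
      using Z_disj by (intro X.finite_measure_UNION) (auto simp: disjoint_family_on_def)
    have UN: "(\<Union>j. J j \<inter> Z j \<inter> B) = Z_all \<inter> B" unfolding Z_all_def by blast
    have "(\<integral>y. indicator B (g (I y) y) * (1::real) \<partial>restr \<nu> (- (\<Union>n. V n))) = measure \<mu> (Z_all \<inter> B)"
      using sums_unique2[OF s1[unfolded eqj] s2] unfolding UN .
    then show "(\<integral>y. indicator B (g (I y) y) \<partial>restr \<nu> (- (\<Union>n. V n))) = measure (restr \<mu> Z_all) B"
      unfolding mult_1_right X.measure_restr[OF Z_all_sets B] .
    have "(\<lambda>j. \<integral>y. indicator B (g j y) * y \<partial>restr \<nu> (L j))
        sums (\<integral>y. indicator B (g (I y) y) * y \<partial>restr \<nu> (- (\<Union>n. V n)))"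
      unfolding g_term[OF B measurable_ident_sets[OF refl], symmetric]
      by (rule glue_sums[OF R.finite_borel_measure_axioms I g R.integrable_id B])
    moreover have "(\<integral>y. indicator B (g j y) * y \<partial>restr \<nu> (L j))
        = (\<integral>x. indicator (J j \<inter> Z j) x * (indicator B x * x) \<partial>\<mu>)" for j
    proof -
      have "(\<integral>y. indicator B (g j y) * y \<partial>restr \<nu> (L j)) = (\<integral>x. indicator B x * x \<partial>restr \<mu> (J j \<inter> Z j))"
        using g_bary[of j] B unfolding barycentric_map_def L_def by blast
      also have "\<dots> = (\<integral>x. indicator (J j \<inter> Z j) x * (indicator B x * x) \<partial>\<mu>)"
        by (rule X.integral_restr) (simp, measurable)
      finally show ?thesis .
    qed
    ultimately have "(\<lambda>j. \<integral>x. indicator (J j \<inter> Z j) x * (indicator B x * x) \<partial>\<mu>)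
        sums (\<integral>y. indicator B (g (I y) y) * y \<partial>restr \<nu> (- (\<Union>n. V n)))" by simp
    moreover have "(\<lambda>j. \<integral>x. indicator (J j \<inter> Z j) x * (indicator B x * x) \<partial>\<mu>)
        sums (\<integral>x. indicator Z_all x * (indicator B x * x) \<partial>\<mu>)"
      unfolding Z_all_def using Z_disj
      by (intro sums_integral_UN X.integrable_indicator_mult X.integrable_id) auto
    ultimately have "(\<integral>y. indicator B (g (I y) y) * y \<partial>restr \<nu> (- (\<Union>n. V n)))
        = (\<integral>x. indicator Z_all x * (indicator B x * x) \<partial>\<mu>)" by (rule sums_unique2)
    also have "\<dots> = (\<integral>x. indicator B x * x \<partial>restr \<mu> Z_all)"
      by (rule X.integral_restr[symmetric]) (simp, measurable)
    finally show "(\<integral>y. indicator B (g (I y) y) * y \<partial>restr \<nu> (- (\<Union>n. V n))) = (\<integral>x. indicator B x * x \<partial>restr \<mu> Z_all)" .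
  qed
  obtain f where f: "barycentric_map \<mu> \<nu> f" and f_rest: "\<And>y. y \<notin> (\<Union>n. V n) \<Longrightarrow> f y = g (I y) y"
    and f_V: "\<And>n B. B \<in> sets borel \<Longrightarrow> measure \<nu> {y \<in> V n. f y \<in> B} = (\<integral>x. indicator B x * k_all n x \<partial>\<mu>)"
    by (rule glue_pieces[OF first_moment_fst first_moment_snd al pieces_all rest_all]) (rule that; assumption)
  have f_meas [measurable]: "f \<in> borel_measurable borel" using f unfolding barycentric_map_def by blast
  \<comment> \<open>The law of f on \<open>V n\<close> has density \<open>k_all n\<close>, which
    vanishes outside the slice of n.\<close>
  have AE_V: "AE y in \<nu>. y \<in> V n \<longrightarrow> I (f y) = cell n" for n
  proof -
    have "measure \<nu> {y \<in> V n. f y \<in> - J (cell n)} = (\<integral>x. 0 \<partial>\<mu>)"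
      unfolding f_V[OF borel_comp[OF J_sets]]
      by (intro Bochner_Integration.integral_cong) (auto simp: k_all_def indicator_def)
    then have "{y \<in> V n. f y \<in> - J (cell n)} \<in> null_sets \<nu>"
      by (intro null_setsI) (simp_all add: Y.emeasure_eq_measure)
    from AE_not_in[OF this] show ?thesis by eventually_elim (auto simp: J_def)
  qed
  have AE_L: "AE y in \<nu>. y \<in> L j \<longrightarrow> I (f y) = j" for j
  proof -
    interpret l: first_moment_measure "restr \<nu> (L j)" by (rule Y.first_moment_measure_restr) simp
    have "measure \<nu> {y \<in> L j. g j y \<in> - J j} = (\<integral>y. indicator {y \<in> L j. g j y \<in> - J j} y \<partial>\<nu>)" by simp
    also have "\<dots> = (\<integral>y. indicator (L j) y * indicator (- J j) (g j y) \<partial>\<nu>)"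
      by (intro Bochner_Integration.integral_cong) (auto simp: indicator_def)
    also have "\<dots> = (\<integral>y. indicator (- J j) (g j y) \<partial>restr \<nu> (L j))"
      by (rule Y.integral_restr[symmetric]) measurable
    also have "\<dots> = measure (restr \<mu> (J j \<inter> Z j)) (- J j)"
      using g_bary[of j] unfolding L_def[symmetric]
      by (rule barycentric_map_measure) (use l.first_moment_measure_axioms in auto)
    also have "\<dots> = measure \<mu> (J j \<inter> Z j \<inter> - J j)" by (rule X.measure_restr) simp_all
    also have "J j \<inter> Z j \<inter> - J j = {}" by blast
    finally have "{y \<in> L j. g j y \<in> - J j} \<in> null_sets \<nu>"
      by (intro null_setsI) (simp_all add: Y.emeasure_eq_measure)
    from AE_not_in[OF this] show ?thesis
    proof eventually_elim
      case (elim y)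
      show ?case
      proof
        assume y: "y \<in> L j"
        then have "I y = j" unfolding L_def J_def by simp
        with y have "f y = g j y" using f_rest[of y] UN_V[of y] by simp
        with y elim show "I (f y) = j" by (simp add: J_def)
      qed
    qed
  qed
  have "measure \<nu> {y. I (f y) = i \<and> I y = j} = measure \<pi> {z. I (fst z) = i \<and> I (snd z) = j}" for i j
  proof -
    interpret s: first_moment_measure "slice (J i)" by (intro first_moment_slice) simp
    define n where "n q = prod_encode (i, q)" for q
    have cell_n: "cell m = i \<longleftrightarrow> (\<exists>q. m = n q)" for m
      unfolding cell_def n_def by (metis prod_decode_inverse prod_encode_inverse fst_conv prod.collapse)
    \<comment> \<open>Up to a null set this is the event to be measured: the sets carved out of
      \<open>J j\<close> for the atoms of slice i and, on the diagonal, the contact part.\<close>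
    define A where "A = (\<Union>q. U j (n q)) \<union> (if i = j then L j else {})"
    have A_sets: "A \<in> sets \<nu>" unfolding A_def by auto
    have "AE y in \<nu>. (\<forall>m. y \<in> V m \<longrightarrow> I (f y) = cell m) \<and> (\<forall>j. y \<in> L j \<longrightarrow> I (f y) = j)"
      using AE_V AE_L by (simp add: AE_all_countable)
    then have "AE y in \<nu>. (y \<in> {y. I (f y) = i \<and> I y = j}) = (y \<in> A)"
    proof eventually_elim
      case (elim y)
      show ?case
      proof (cases "y \<in> (\<Union>m. V m)")
        case True
        then obtain m where m: "y \<in> V m" by blast
        then have fy: "I (f y) = cell m" using elim by blast
        have "y \<notin> L j" using m UN_V[of y] unfolding L_def J_def by auto
        have "y \<in> A \<longleftrightarrow> I y = j \<and> cell m = i"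
        proof
          assume "y \<in> A"
          then obtain q where q: "y \<in> U j (n q)"
            using \<open>y \<notin> L j\<close> unfolding A_def by (auto split: if_splits)
          then have Iy: "I y = j" using UJ unfolding J_def by blast
          with q have "y \<in> V (n q)" using V_iff by simp
          with m V_disj have "m = n q" unfolding disjoint_family_on_def by blast
          then show "I y = j \<and> cell m = i" using Iy cell_n by blast
        next
          assume "I y = j \<and> cell m = i"
          with m show "y \<in> A" unfolding A_def V_iff cell_n by auto
        qed
        then show ?thesis using fy by auto
      next
        case False
        then have Ly: "y \<in> L (I y)" using UN_V by blast
        then have fy: "I (f y) = I y" using elim by blast
        have "y \<notin> U j (n q)" for q using False UJ[of j "n q"] V_iff[of y "n q"] unfolding J_def by auto
        then have "y \<in> A \<longleftrightarrow> i = j \<and> y \<in> L j" unfolding A_def by auto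
        also have "y \<in> L j \<longleftrightarrow> I y = j" using Ly unfolding L_def J_def by auto
        finally show ?thesis using fy by auto
      qed
    qed
    then have "measure \<nu> {y. I (f y) = i \<and> I y = j} = measure \<nu> A"
      using A_sets by (intro Y.finite_measure_eq_AE) auto
    also have "\<dots> = measure \<nu> (\<Union>q. U j (n q)) + measure \<nu> (if i = j then L j else {})"
      unfolding A_def by (intro Y.finite_measure_Union) (auto simp: L_def)
    also have "measure \<nu> (\<Union>q. U j (n q)) = measure (slice (J i)) (\<Union>q. S i q \<inter> J j)"
    proof -
      have n_inj: "n q = n q' \<longleftrightarrow> q = q'" for q q' unfolding n_def by simp
      have n_decode: "cell (n q) = i" "T (n q) = S i q" for q unfolding n_def cell_def T_def by simp_all
      have "(\<lambda>q. measure \<nu> (U j (n q))) sums measure \<nu> (\<Union>q. U j (n q))"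
        using U_disj[of j] n_inj by (intro Y.finite_measure_UNION) (auto simp: disjoint_family_on_def)
      moreover have "disjoint_family (S i)" using pieces[of i] unfolding pieces_def by blast
      then have "(\<lambda>q. measure \<nu> (U j (n q))) sums measure (slice (J i)) (\<Union>q. S i q \<inter> J j)"
        unfolding mU n_decode by (intro s.finite_measure_UNION) (auto simp: disjoint_family_on_def)
      ultimately show ?thesis by (rule sums_unique2)
    qed
    also have "measure \<nu> (if i = j then L j else {}) = measure (slice (J i)) (J j - (\<Union>q. S i q))"
      unfolding slice_cell_rest using mL[of j] unfolding L_def[symmetric]
      by (simp add: X.mass_restr Y.mass_restr)
    also have "measure (slice (J i)) (\<Union>q. S i q \<inter> J j) + measure (slice (J i)) (J j - (\<Union>q. S i q))
        = measure (slice (J i)) ((\<Union>q. S i q \<inter> J j) \<union> (J j - (\<Union>q. S i q)))"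
      by (intro s.finite_measure_Union[symmetric]) auto
    also have "(\<Union>q. S i q \<inter> J j) \<union> (J j - (\<Union>q. S i q)) = J j" by auto
    also have "measure (slice (J i)) (J j) = measure \<pi> (fst -` J i \<inter> snd -` J j)"
      by (rule measure_slice) simp_all
    also have "fst -` J i \<inter> snd -` J j = {z. I (fst z) = i \<and> I (snd z) = j}" unfolding J_def by auto
    finally show ?thesis .
  qed
  with f show ?thesis by (rule that)
qed

end

text \<open>Each slice satisfies \<open>convex_order_pieces\<close> by
  \<open>slice_convex_order\<close>; choice over the slices provides the data of
  \<open>sliced_coupling\<close>.\<close>

lemma (in martingale_coupling) cellwise_map:
  assumes I: "I \<in> measurable borel (count_space (UNIV :: nat set))" and al: "atomless \<nu>"
  obtains f where "barycentric_map \<mu> \<nu> f"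
    "\<And>i j. measure \<nu> {y. I (f y) = i \<and> I y = j} = measure \<pi> {z. I (fst z) = i \<and> I (snd z) = j}"
proof -
  have "\<exists>Z S k b. pieces (restr \<mu> {x. I x = i}) (slice {x. I x = i}) Z S k b \<and>
      restr (slice {x. I x = i}) (- (\<Union>q. S q)) = restr (restr \<mu> {x. I x = i}) Z" for i
  proof -
    have J: "{x. I x = i} \<in> sets borel" using I by measurable
    show ?thesis
      by (rule convex_order_pieces[OF X.first_moment_measure_restr[OF J] first_moment_slice[OF J]
            atomless_slice[OF al J] slice_convex_order[OF J]]) (intro exI conjI)
  qed
  then have "\<exists>Z S k b. \<forall>i. pieces (restr \<mu> {x. I x = i}) (slice {x. I x = i}) (Z i) (S i) (k i) (b i) \<and>
      restr (slice {x. I x = i}) (- (\<Union>q. S i q)) = restr (restr \<mu> {x. I x = i}) (Z i)"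
    by (subst choice_iff[symmetric])+ (rule allI)
  then obtain Z S k b where *: "\<forall>i. pieces (restr \<mu> {x. I x = i}) (slice {x. I x = i}) (Z i) (S i) (k i) (b i) \<and>
      restr (slice {x. I x = i}) (- (\<Union>q. S i q)) = restr (restr \<mu> {x. I x = i}) (Z i)"
    by (elim exE) (rule that)
  interpret sliced_coupling \<pi> \<mu> \<nu> I Z S k b
    by unfold_locales (rule I al conjunct1[OF spec[OF *]] conjunct2[OF spec[OF *]])+
  show ?thesis by (rule cellwise_map) (rule that; assumption)
qed

section \<open>Measures that agree on small cells\<close>

locale same_cells =
  fixes \<pi> \<pi>' :: "'a::{metric_space, second_countable_topology} measure" and D :: "'a \<Rightarrow> nat" and e :: real
  assumes probs: "\<pi> \<in> borel_probs" "\<pi>' \<in> borel_probs"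
    and D [measurable]: "D \<in> measurable borel (count_space UNIV)"
    and cells: "\<And>n. emeasure \<pi> {z. D z = n} = emeasure \<pi>' {z. D z = n}"
    and diam: "\<And>z z'. D z = D z' \<Longrightarrow> dist z z' \<le> e"
begin

sublocale p: prob_space \<pi> using probs unfolding borel_probs_def by simp
sublocale p': prob_space \<pi>' using probs unfolding borel_probs_def by simp

lemma sets_eq [simp, measurable_cong]: "sets \<pi> = sets borel" "sets \<pi>' = sets borel"
  using probs unfolding borel_probs_def by auto

lemma measurable_M [simp]: "measurable \<pi> N = measurable borel N" "measurable \<pi>' N = measurable borel N"
  by (auto intro!: measurable_cong_sets)

lemma space_eq [simp]: "space \<pi> = UNIV" "space \<pi>' = UNIV"
  using sets_eq[THEN sets_eq_imp_space_eq] by simp_all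

text \<open>There are countably many cells, so the null ones are jointly null. It justifies the
  division by the cell mass in \<open>cell_coupling\<close>.\<close>

lemma AE_cell_pos:
  assumes "prob_space M" and [simp, measurable_cong]: "sets M = sets borel"
  shows "AE z in M. emeasure M {z'. D z' = D z} \<noteq> 0"
proof -
  have "AE z in M. D z \<noteq> n" if "emeasure M {z'. D z' = n} = 0" for n
  proof -
    have "{z'. D z' = n} \<in> null_sets M" using that by (intro null_setsI) auto
    from AE_not_in[OF this] show ?thesis by simp
  qed
  then have "AE z in M. \<forall>n. emeasure M {z'. D z' = n} = 0 \<longrightarrow> D z \<noteq> n"
    by (subst AE_all_countable) auto
  then show ?thesis by eventually_elim auto
qed

text \<open>Given the cell, the two points are coupled independently.\<close>

definition cell_coupling :: "('a \<times> 'a) measure" where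
  "cell_coupling = density (\<pi> \<Otimes>\<^sub>M \<pi>')
     (\<lambda>(z, z'). if D z = D z' then inverse (emeasure \<pi> {w. D w = D z}) else 0)"

lemma measurable_cell_density [measurable]:
  "(\<lambda>(z, z'). if D z = D z' then inverse (emeasure \<pi> {w. D w = D z}) else (0::ennreal))
    \<in> borel_measurable (\<pi> \<Otimes>\<^sub>M \<pi>')"
proof -
  have D1: "(\<lambda>x. D (fst x)) \<in> measurable (\<pi> \<Otimes>\<^sub>M \<pi>') (count_space UNIV)"
    and D2: "(\<lambda>x. D (snd x)) \<in> measurable (\<pi> \<Otimes>\<^sub>M \<pi>') (count_space UNIV)"
    by (rule measurable_compose[OF measurable_fst], simp add: D)
      (rule measurable_compose[OF measurable_snd], simp add: D)
  have "(\<lambda>x. if n = D (snd x) then inverse (emeasure \<pi> {w. D w = n}) else (0::ennreal))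
      \<in> borel_measurable (\<pi> \<Otimes>\<^sub>M \<pi>')" for n
    by (rule measurable_compose[OF D2, of "\<lambda>k. if n = k then inverse (emeasure \<pi> {w. D w = n}) else 0"]) simp
  from measurable_compose_countable[OF this D1] show ?thesis
    unfolding case_prod_beta' .
qed

text \<open>Integrating out one coordinate multiplies the inverse of the cell mass by the cell mass.
  Both marginals come out right because the two measures give each cell the same mass.\<close>

lemma emeasure_cell_coupling:
  assumes [measurable]: "A \<in> sets borel"
  shows "emeasure cell_coupling (fst -` A) = emeasure \<pi> A"
    and "emeasure cell_coupling (snd -` A) = emeasure \<pi>' A"
proof -
  interpret pair_sigma_finite \<pi> \<pi>' by unfold_locales
  let ?p = "\<lambda>z. emeasure \<pi> {w. D w = D z}"
  let ?h = "\<lambda>z z'. if D z = D z' then inverse (?p z) else (0::ennreal)"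
  have h [measurable]: "(\<lambda>x. ?h (fst x) (snd x)) \<in> borel_measurable (\<pi> \<Otimes>\<^sub>M \<pi>')"
    using measurable_cell_density by (simp add: case_prod_beta')
  have A1: "fst -` A \<in> sets (\<pi> \<Otimes>\<^sub>M \<pi>')" and A2: "snd -` A \<in> sets (\<pi> \<Otimes>\<^sub>M \<pi>')"
  proof -
    have "fst \<in> measurable (\<pi> \<Otimes>\<^sub>M \<pi>') \<pi>" "snd \<in> measurable (\<pi> \<Otimes>\<^sub>M \<pi>') \<pi>'" by measurable
    from measurable_sets[OF this(1), of A] measurable_sets[OF this(2), of A]
    show "fst -` A \<in> sets (\<pi> \<Otimes>\<^sub>M \<pi>')" "snd -` A \<in> sets (\<pi> \<Otimes>\<^sub>M \<pi>')"
      by (auto simp: space_pair_measure)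
  qed
  have inv: "inverse (?p z) * ?p z = 1" if "?p z \<noteq> 0" for z
    using that p.emeasure_finite[of "{w. D w = D z}"]
    by (simp add: ennreal_inverse_mult mult.commute less_top[symmetric] ennreal_divide_self divide_ennreal_def[symmetric])
  have "emeasure cell_coupling (fst -` A)
      = (\<integral>\<^sup>+x. ?h (fst x) (snd x) * indicator A (fst x) \<partial>(\<pi> \<Otimes>\<^sub>M \<pi>'))"
    unfolding cell_coupling_def using A1
    by (subst emeasure_density) (auto intro!: nn_integral_cong simp: indicator_def case_prod_beta')
  also have "\<dots> = (\<integral>\<^sup>+z. \<integral>\<^sup>+z'. ?h z z' * indicator A z \<partial>\<pi>' \<partial>\<pi>)"
  proof (subst p'.nn_integral_fst[symmetric])
    show "(\<lambda>x. ?h (fst x) (snd x) * indicator A (fst x)) \<in> borel_measurable (\<pi> \<Otimes>\<^sub>M \<pi>')"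
      by measurable
  qed (simp only: fst_conv snd_conv)
  also have "\<dots> = (\<integral>\<^sup>+z. indicator A z \<partial>\<pi>)"
  proof (rule nn_integral_cong_AE)
    show "AE z in \<pi>. (\<integral>\<^sup>+z'. ?h z z' * indicator A z \<partial>\<pi>') = indicator A z"
      using AE_cell_pos[OF p.prob_space_axioms sets_eq(1)]
    proof eventually_elim
      case (elim z)
      have "(\<integral>\<^sup>+z'. ?h z z' * indicator A z \<partial>\<pi>')
          = (\<integral>\<^sup>+z'. (inverse (?p z) * indicator A z) * indicator {z'. D z' = D z} z' \<partial>\<pi>')"
        by (intro nn_integral_cong) (auto simp: indicator_def)
      also have "\<dots> = inverse (?p z) * indicator A z * ?p z"
        by (subst nn_integral_cmult_indicator) (auto simp: cells)
      also have "\<dots> = indicator A z" using inv[OF elim] by (auto simp: indicator_def)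
      finally show ?case .
    qed
  qed
  finally show "emeasure cell_coupling (fst -` A) = emeasure \<pi> A" by simp
  have "emeasure cell_coupling (snd -` A)
      = (\<integral>\<^sup>+x. ?h (fst x) (snd x) * indicator A (snd x) \<partial>(\<pi> \<Otimes>\<^sub>M \<pi>'))"
    unfolding cell_coupling_def using A2
    by (subst emeasure_density) (auto intro!: nn_integral_cong simp: indicator_def case_prod_beta')
  also have "\<dots> = (\<integral>\<^sup>+z'. \<integral>\<^sup>+z. ?h z z' * indicator A z' \<partial>\<pi> \<partial>\<pi>')"
  proof (subst nn_integral_snd[symmetric])
    show "(\<lambda>x. ?h (fst x) (snd x) * indicator A (snd x)) \<in> borel_measurable (\<pi> \<Otimes>\<^sub>M \<pi>')"
      by measurable
  qed (simp only: fst_conv snd_conv)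
  also have "\<dots> = (\<integral>\<^sup>+z'. indicator A z' \<partial>\<pi>')"
  proof (rule nn_integral_cong_AE)
    show "AE z' in \<pi>'. (\<integral>\<^sup>+z. ?h z z' * indicator A z' \<partial>\<pi>) = indicator A z'"
      using AE_cell_pos[OF p'.prob_space_axioms sets_eq(2)]
    proof eventually_elim
      case (elim z')
      then have pos: "?p z' \<noteq> 0" by (simp add: cells)
      have "(\<integral>\<^sup>+z. ?h z z' * indicator A z' \<partial>\<pi>)
          = (\<integral>\<^sup>+z. (inverse (?p z') * indicator A z') * indicator {z. D z = D z'} z \<partial>\<pi>)"
        by (intro nn_integral_cong) (auto simp: indicator_def)
      also have "\<dots> = inverse (?p z') * indicator A z' * ?p z'"
        by (subst nn_integral_cmult_indicator) auto
      also have "\<dots> = indicator A z'" using inv[OF pos] by (auto simp: indicator_def)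
      finally show ?case .
    qed
  qed
  finally show "emeasure cell_coupling (snd -` A) = emeasure \<pi>' A" by simp
qed

lemma sets_cell_coupling: "sets cell_coupling = sets borel"
proof -
  have "sets (\<pi> \<Otimes>\<^sub>M \<pi>') = sets (borel \<Otimes>\<^sub>M borel)" by (intro sets_pair_measure_cong) simp_all
  also have "\<dots> = sets (borel :: ('a \<times> 'a) measure)" by (rule arg_cong[OF borel_prod])
  finally show ?thesis unfolding cell_coupling_def by simp
qed

text \<open>\<open>cell_coupling\<close> charges only pairs in a common cell, whose distance is at
  most the diameter bound.\<close>

lemma Wasserstein_infty_le: "Wasserstein_infty \<pi> \<pi>' \<le> ereal e"
proof -
  have space: "space cell_coupling = UNIV"
    using sets_eq_imp_space_eq[OF sets_cell_coupling] by simp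
  have meas: "measurable cell_coupling N = measurable borel N" for N :: "'c measure"
    by (rule measurable_cong_sets[OF sets_cell_coupling refl])
  have fs: "fst \<in> borel_measurable (borel :: ('a \<times> 'a) measure)" "snd \<in> borel_measurable (borel :: ('a \<times> 'a) measure)"
    by (auto intro!: borel_measurable_continuous_onI continuous_intros)
  have "emeasure cell_coupling (space cell_coupling) = 1"
    using emeasure_cell_coupling(1)[of UNIV] p.emeasure_space_1 unfolding space by simp
  then have "cell_coupling \<in> borel_probs"
    unfolding borel_probs_def using sets_cell_coupling by (auto intro!: prob_spaceI)
  moreover have "distr cell_coupling borel fst = \<pi>"
    using emeasure_cell_coupling(1) by (intro measure_eqI) (auto simp: emeasure_distr meas fs space)
  moreover have "distr cell_coupling borel snd = \<pi>'"
    using emeasure_cell_coupling(2) by (intro measure_eqI) (auto simp: emeasure_distr meas fs space)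
  ultimately have "cell_coupling \<in> couplings \<pi> \<pi>'" unfolding couplings_def by simp
  moreover have "esssup cell_coupling (\<lambda>(z, z'). ereal (dist z z')) \<le> ereal e"
  proof (rule esssup_I)
    have "(\<lambda>x. dist (fst x) (snd x)) \<in> borel_measurable (borel :: ('a \<times> 'a) measure)"
      by (auto intro!: borel_measurable_continuous_onI continuous_intros)
    then show "(\<lambda>(z, z'). ereal (dist z z')) \<in> borel_measurable cell_coupling"
      unfolding meas case_prod_beta' by measurable
    show "AE x in cell_coupling. (case x of (z, z') \<Rightarrow> ereal (dist z z')) \<le> ereal e"
      unfolding cell_coupling_def
      by (subst AE_density[OF measurable_cell_density]) (auto intro!: AE_I2 diam split: if_splits)
  qed
  ultimately show ?thesis unfolding Wasserstein_infty_def by (rule INF_lower2)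
qed

lemma integral_cell: "(\<integral>z. g (D z) \<partial>\<pi>) = (\<integral>z. g (D z) \<partial>\<pi>')" for g :: "nat \<Rightarrow> real"
proof -
  have "distr \<pi> (count_space UNIV) D = distr \<pi>' (count_space UNIV) D"
    by (rule measure_eqI_countable[where A=UNIV])
      (use cells in \<open>auto simp: emeasure_distr vimage_def\<close>)
  moreover have "(\<integral>z. g (D z) \<partial>\<pi>) = (\<integral>n. g n \<partial>distr \<pi> (count_space UNIV) D)"
    "(\<integral>z. g (D z) \<partial>\<pi>') = (\<integral>n. g n \<partial>distr \<pi>' (count_space UNIV) D)"
    by (subst integral_distr; simp)+
  ultimately show ?thesis by simp
qed

text \<open>The cellwise supremum is a function of the cell, so both measures integrate it alike. An
  integral against the varying measure is thereby bounded by one against the fixed measure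
  \<pi>.\<close>

lemma integral_le_cell_Sup:
  fixes \<phi> :: "'a \<Rightarrow> real"
  assumes \<phi>: "\<phi> \<in> borel_measurable borel" "\<And>z. \<bar>\<phi> z\<bar> \<le> C"
  shows "(\<integral>z. \<phi> z \<partial>\<pi>') \<le> (\<integral>z. Sup (\<phi> ` {w. D w = D z}) \<partial>\<pi>)"
    and "(\<lambda>z. Sup (\<phi> ` {w. D w = D z})) \<in> borel_measurable borel"
    and "\<phi> z \<le> Sup (\<phi> ` {w. D w = D z})" and "\<bar>Sup (\<phi> ` {w. D w = D z})\<bar> \<le> C"
proof -
  let ?g = "\<lambda>n. Sup (\<phi> ` {w. D w = n})"
  have bdd: "bdd_above (\<phi> ` W)" for W
    using \<phi>(2) by (auto intro!: bdd_aboveI[of _ C] simp: abs_le_iff)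
  show upper: "\<phi> z \<le> ?g (D z)" for z by (intro cSup_upper bdd) auto
  have "?g (D z) \<le> C" for z
    using \<phi>(2) by (intro cSup_least) (auto simp: abs_le_iff)
  moreover have "- C \<le> ?g (D z)" for z
    using upper[of z] \<phi>(2)[of z] by (auto simp: abs_le_iff)
  ultimately show bound: "\<bar>?g (D z)\<bar> \<le> C" for z
    by (intro abs_leI) (simp_all add: minus_le_iff)
  show meas: "(\<lambda>z. ?g (D z)) \<in> borel_measurable borel"
    by (rule measurable_compose[OF D]) simp
  have "(\<integral>z. \<phi> z \<partial>\<pi>') \<le> (\<integral>z. ?g (D z) \<partial>\<pi>')"
  proof (rule integral_mono)
    show "integrable \<pi>' \<phi>" using \<phi> by (intro p'.integrable_const_bound[where B=C]) auto
    show "integrable \<pi>' (\<lambda>z. ?g (D z))" using bound meas by (intro p'.integrable_const_bound[where B=C]) auto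
  qed (rule upper)
  also have "\<dots> = (\<integral>z. ?g (D z) \<partial>\<pi>)" by (rule integral_cell[symmetric])
  finally show "(\<integral>z. \<phi> z \<partial>\<pi>') \<le> (\<integral>z. ?g (D z) \<partial>\<pi>)" .
qed

end

text \<open>As the cells shrink, the cellwise suprema of a continuous function converge to it
  pointwise, and dominated convergence under \<pi> gives the upper bound. The lower bound is the
  upper one for the negated function.\<close>

lemma integral_tendsto_same_cells:
  fixes \<phi> :: "'a::{metric_space, second_countable_topology} \<Rightarrow> real"
  assumes cells: "\<And>n. same_cells \<pi> (\<pi>' n) (D n) (e n)" and e: "e \<longlonglongrightarrow> 0"
    and cont: "continuous_on UNIV \<phi>" and bound: "bounded (range \<phi>)"
  shows "(\<lambda>n. \<integral>z. \<phi> z \<partial>\<pi>' n) \<longlonglongrightarrow> (\<integral>z. \<phi> z \<partial>\<pi>)"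
proof -
  interpret same_cells \<pi> "\<pi>' n" "D n" "e n" for n by (rule cells)
  obtain C where C: "\<And>z. \<bar>\<phi> z\<bar> \<le> C" using bound by (auto simp: bounded_iff)
  have upper: "\<forall>\<^sub>F n in sequentially. (\<integral>z. \<psi> z \<partial>\<pi>' n) < (\<integral>z. \<psi> z \<partial>\<pi>) + r"
    if r: "0 < r" and cont: "continuous_on UNIV \<psi>" and \<psi>: "\<And>z. \<bar>\<psi> z\<bar> \<le> C" for r and \<psi> :: "'a \<Rightarrow> real"
  proof -
    let ?s = "\<lambda>n z. Sup (\<psi> ` {w. D n w = D n z})"
    have meas: "\<psi> \<in> borel_measurable borel" using cont by (rule borel_measurable_continuous_onI)
    have "(\<lambda>n. \<integral>z. ?s n z \<partial>\<pi>) \<longlonglongrightarrow> (\<integral>z. \<psi> z \<partial>\<pi>)"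
    proof (rule integral_dominated_convergence[where w="\<lambda>_. C"])
      show "AE z in \<pi>. (\<lambda>n. ?s n z) \<longlonglongrightarrow> \<psi> z"
      proof (intro AE_I2 LIMSEQ_I)
        fix z and d :: real assume "0 < d"
        have "isCont \<psi> z" using cont by (simp add: continuous_on_eq_continuous_at)
        then obtain \<delta> where \<delta>: "0 < \<delta>" "\<And>w. dist w z < \<delta> \<Longrightarrow> dist (\<psi> w) (\<psi> z) < d / 2"
          using \<open>0 < d\<close> unfolding continuous_at_eps_delta by (meson half_gt_zero)
        obtain N where N: "\<And>n. n \<ge> N \<Longrightarrow> e n < \<delta>"
          using order_tendstoD(2)[OF e \<delta>(1)] unfolding eventually_sequentially by blast
        have "norm (?s n z - \<psi> z) < d" if n: "n \<ge> N" for n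
        proof -
          have "?s n z \<le> \<psi> z + d / 2"
          proof (rule cSup_least)
            fix x assume "x \<in> \<psi> ` {w. D n w = D n z}"
            then obtain w where w: "x = \<psi> w" "D n w = D n z" by auto
            then have "dist w z < \<delta>" using diam[of n w z] N[OF n] by simp
            then show "x \<le> \<psi> z + d / 2" using \<delta>(2)[of w] w unfolding dist_real_def by linarith
          qed auto
          moreover have "\<psi> z \<le> ?s n z" by (rule integral_le_cell_Sup(3)[OF meas \<psi>])
          ultimately show ?thesis using \<open>0 < d\<close> by simp
        qed
        then show "\<exists>N. \<forall>n\<ge>N. norm (?s n z - \<psi> z) < d" by blast
      qed
      show "\<psi> \<in> borel_measurable \<pi>" using meas by simp
      show "(\<lambda>z. ?s n z) \<in> borel_measurable \<pi>" for n using integral_le_cell_Sup(2)[OF meas \<psi>] by simp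
      show "AE z in \<pi>. norm (?s n z) \<le> C" for n using integral_le_cell_Sup(4)[OF meas \<psi>] by simp
    qed simp
    then have "\<forall>\<^sub>F n in sequentially. (\<integral>z. ?s n z \<partial>\<pi>) < (\<integral>z. \<psi> z \<partial>\<pi>) + r"
      using r by (intro order_tendstoD(2)) auto
    then show ?thesis
      by eventually_elim (rule le_less_trans[OF integral_le_cell_Sup(1)[OF meas \<psi>]])
  qed
  show ?thesis
  proof (rule order_tendstoI)
    fix a assume "(\<integral>z. \<phi> z \<partial>\<pi>) < a"
    then show "\<forall>\<^sub>F n in sequentially. (\<integral>z. \<phi> z \<partial>\<pi>' n) < a"
      using upper[of "a - (\<integral>z. \<phi> z \<partial>\<pi>)" \<phi>] cont C by simp
  next
    fix a assume a: "a < (\<integral>z. \<phi> z \<partial>\<pi>)"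
    have "\<forall>\<^sub>F n in sequentially. (\<integral>z. - \<phi> z \<partial>\<pi>' n) < (\<integral>z. - \<phi> z \<partial>\<pi>) + ((\<integral>z. \<phi> z \<partial>\<pi>) - a)"
      using a cont C by (intro upper continuous_on_minus) auto
    then show "\<forall>\<^sub>F n in sequentially. a < (\<integral>z. \<phi> z \<partial>\<pi>' n)" by simp
  qed
qed

text \<open>By induction over the generation of the topology: the property that the sequence
  eventually enters T, if \<pi> is in T, holds for the subbasis and passes to finite intersections
  and to unions.\<close>

lemma weak_limit_meets_open:
  assumes seq: "\<And>n. \<pi>' n \<in> A" and A: "A \<subseteq> borel_probs" and \<pi>: "\<pi> \<in> borel_probs"
    and lim: "\<And>\<phi> :: 'a::topological_space \<Rightarrow> real. continuous_on UNIV \<phi> \<Longrightarrow> bounded (range \<phi>) \<Longrightarrow>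
      (\<lambda>n. \<integral>z. \<phi> z \<partial>\<pi>' n) \<longlonglongrightarrow> (\<integral>z. \<phi> z \<partial>\<pi>)"
    and T: "openin weak_topology T" "\<pi> \<in> T"
  shows "\<exists>n. \<pi>' n \<in> T"
proof -
  have "\<pi> \<in> T \<longrightarrow> (\<forall>\<^sub>F n in sequentially. \<pi>' n \<in> T)"
    using T(1) unfolding weak_topology_def openin_topology_generated_by_iff
  proof (induction rule: generate_topology_on.induct)
    case (UN K)
    show ?case
    proof
      assume "\<pi> \<in> \<Union>K"
      then obtain U where U: "U \<in> K" "\<pi> \<in> U" by blast
      then have "\<forall>\<^sub>F n in sequentially. \<pi>' n \<in> U" using UN.IH by blast
      then show "\<forall>\<^sub>F n in sequentially. \<pi>' n \<in> \<Union>K" by eventually_elim (use U in blast)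
    qed
  next
    case (Int a b)
    then show ?case by (auto simp: eventually_conj_iff)
  next
    case (Basis s)
    then obtain \<phi> :: "'a \<Rightarrow> real" and U where s: "s = {\<pi> \<in> borel_probs. (\<integral>z. \<phi> z \<partial>\<pi>) \<in> U}"
      and \<phi>: "continuous_on UNIV \<phi>" "bounded (range \<phi>)" "open U" by blast
    show ?case
    proof
      assume "\<pi> \<in> s"
      then have "\<forall>\<^sub>F n in sequentially. (\<integral>z. \<phi> z \<partial>\<pi>' n) \<in> U"
        using lim[OF \<phi>(1,2)] \<phi>(3) unfolding s by (intro topological_tendstoD) auto
      then show "\<forall>\<^sub>F n in sequentially. \<pi>' n \<in> s"
        by eventually_elim (use seq A in \<open>auto simp: s\<close>)
    qed
  qed simp
  then have "\<forall>\<^sub>F n in sequentially. \<pi>' n \<in> T" using T(2) by blast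
  then show ?thesis by (auto dest: eventually_happens)
qed

section \<open>Density of backward Monge transports\<close>

text \<open>The sigma-algebra generated by \<open>fst\<close> consists of the preimages of Borel
  sets under \<open>fst\<close>, so the characterisation of the conditional expectation tests
  exactly the integrals in \<open>martingale_coupling\<close>.\<close>

lemma martingale_transports_iff:
  assumes \<mu>: "first_moment_measure \<mu>" and \<nu>: "first_moment_measure \<nu>"
  shows "\<pi> \<in> martingale_transports \<mu> \<nu> \<longleftrightarrow> martingale_coupling \<pi> \<mu> \<nu>"
proof -
  let ?F = "vimage_algebra (space \<pi>) fst borel"
  have *: "(AE z in \<pi>. real_cond_exp \<pi> ?F snd z = fst z) \<longleftrightarrow>
      (\<forall>B\<in>sets borel. (\<integral>z. indicator B (fst z) * snd z \<partial>\<pi>) = (\<integral>z. indicator B (fst z) * fst z \<partial>\<pi>))"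
    if \<pi>: "\<pi> \<in> borel_probs" and fst: "distr \<pi> borel fst = \<mu>" and snd: "distr \<pi> borel snd = \<nu>"
  proof -
    interpret prob_space \<pi> using \<pi> unfolding borel_probs_def by simp
    interpret \<mu>: first_moment_measure \<mu> by fact
    interpret \<nu>: first_moment_measure \<nu> by fact
    have sets: "sets \<pi> = sets borel" using \<pi> unfolding borel_probs_def by simp
    have space: "space \<pi> = UNIV" using sets_eq_imp_space_eq[OF sets] by simp
    have meas: "measurable \<pi> N = measurable borel N" for N :: "'c measure"
      by (rule measurable_cong_sets[OF sets refl])
    have coords [measurable]: "fst \<in> borel_measurable \<pi>" "snd \<in> borel_measurable \<pi>"
      unfolding meas
      by (rule borel_measurable_continuous_onI, rule continuous_on_fst, rule continuous_on_id)
        (rule borel_measurable_continuous_onI, rule continuous_on_snd, rule continuous_on_id)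
    have int: "integrable \<pi> fst" "integrable \<pi> snd"
    proof -
      have "integrable (distr \<pi> borel fst) (\<lambda>x. x)" "integrable (distr \<pi> borel snd) (\<lambda>x. x)"
        unfolding fst snd by (rule \<mu>.integrable_id \<nu>.integrable_id)+
      from integrable_distr[OF coords(1) this(1)] integrable_distr[OF coords(2) this(2)]
      show "integrable \<pi> fst" "integrable \<pi> snd" by simp_all
    qed
    have sets_F: "sets ?F = {fst -` B | B. B \<in> sets borel}"
      unfolding space using sets_vimage_algebra2[of fst UNIV borel] by simp
    interpret finite_measure_subalgebra \<pi> ?F
    proof
      show "subalgebra \<pi> ?F"
        unfolding subalgebra_def
      proof
        show "sets ?F \<subseteq> sets \<pi>"
          unfolding sets_F using measurable_sets[OF coords(1)] by (auto simp: space)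
      qed simp
    qed
    have set_int: "(LINT z:(fst -` B)|\<pi>. h z) = (\<integral>z. indicator B (fst z) * h z \<partial>\<pi>)"
      for B and h :: "real \<times> real \<Rightarrow> real"
      unfolding set_lebesgue_integral_def
      by (intro Bochner_Integration.integral_cong) (auto simp: indicator_def)
    show ?thesis
    proof
      assume ae: "AE z in \<pi>. real_cond_exp \<pi> ?F snd z = fst z"
      show "\<forall>B\<in>sets borel. (\<integral>z. indicator B (fst z) * snd z \<partial>\<pi>) = (\<integral>z. indicator B (fst z) * fst z \<partial>\<pi>)"
      proof
        fix B :: "real set" assume B: "B \<in> sets borel"
        have "(\<integral>z. indicator B (fst z) * snd z \<partial>\<pi>) = (LINT z:(fst -` B)|\<pi>. snd z)"
          by (rule set_int[symmetric])
        also have "\<dots> = (LINT z:(fst -` B)|\<pi>. real_cond_exp \<pi> ?F snd z)"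
          using B by (intro real_cond_exp_intA int) (auto simp: sets_F)
        also have "\<dots> = (\<integral>z. indicator B (fst z) * real_cond_exp \<pi> ?F snd z \<partial>\<pi>)"
          by (rule set_int)
        also have "\<dots> = (\<integral>z. indicator B (fst z) * fst z \<partial>\<pi>)"
        proof (rule integral_cong_AE)
          have [measurable]: "real_cond_exp \<pi> ?F snd \<in> borel_measurable \<pi>"
            by (rule borel_measurable_cond_exp2)
          have [measurable]: "B \<in> sets borel" by fact
          show "(\<lambda>z. indicator B (fst z) * real_cond_exp \<pi> ?F snd z) \<in> borel_measurable \<pi>"
            "(\<lambda>z. indicator B (fst z) * fst z) \<in> borel_measurable \<pi>" by measurable
          show "AE z in \<pi>. indicator B (fst z) * real_cond_exp \<pi> ?F snd z = indicator B (fst z) * fst z"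
            using ae by eventually_elim simp
        qed
        finally show "(\<integral>z. indicator B (fst z) * snd z \<partial>\<pi>) = (\<integral>z. indicator B (fst z) * fst z \<partial>\<pi>)" .
      qed
    next
      assume mart: "\<forall>B\<in>sets borel. (\<integral>z. indicator B (fst z) * snd z \<partial>\<pi>) = (\<integral>z. indicator B (fst z) * fst z \<partial>\<pi>)"
      show "AE z in \<pi>. real_cond_exp \<pi> ?F snd z = fst z"
      proof (rule real_cond_exp_charact)
        fix A assume "A \<in> sets ?F"
        then obtain B where "A = fst -` B" "B \<in> sets borel" unfolding sets_F by blast
        then show "(LINT z:A|\<pi>. snd z) = (LINT z:A|\<pi>. fst z)" using mart by (simp add: set_int)
      next
        show "fst \<in> borel_measurable ?F" by (rule measurable_vimage_algebra1) simp
      qed (rule int)+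
    qed
  qed
  have "\<pi> \<in> martingale_transports \<mu> \<nu> \<longleftrightarrow> \<pi> \<in> borel_probs \<and> distr \<pi> borel fst = \<mu> \<and> distr \<pi> borel snd = \<nu> \<and>
      (AE z in \<pi>. real_cond_exp \<pi> ?F snd z = fst z)"
    unfolding martingale_transports_def mem_Collect_eq by (rule refl)
  also have "\<dots> \<longleftrightarrow> \<pi> \<in> borel_probs \<and> distr \<pi> borel fst = \<mu> \<and> distr \<pi> borel snd = \<nu> \<and>
      (\<forall>B\<in>sets borel. (\<integral>z. indicator B (fst z) * snd z \<partial>\<pi>) = (\<integral>z. indicator B (fst z) * fst z \<partial>\<pi>))"
    by (intro conj_cong refl *)
  also have "\<dots> \<longleftrightarrow> martingale_coupling \<pi> \<mu> \<nu>"
    unfolding martingale_coupling_def martingale_coupling_axioms_def borel_probs_def mem_Collect_eq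
    using \<mu> \<nu> by blast
  finally show ?thesis .
qed

lemma (in martingale_coupling) backward_Monge_cells:
  assumes al: "atomless \<nu>" and e: "0 < e"
  obtains \<pi>' D where "\<pi>' \<in> backward_Monge_martingale_transports \<mu> \<nu>" "same_cells \<pi> \<pi>' D e"
proof -
  \<comment> \<open>Cells of length e / 2, so that a square of two cells has diameter at most e
    already in the sum of the coordinate distances; \<open>to_nat\<close> numbers the
    integers.\<close>
  define I :: "real \<Rightarrow> nat" where "I x = to_nat \<lfloor>2 * x / e\<rfloor>" for x
  have I [measurable]: "I \<in> measurable borel (count_space UNIV)"
    unfolding I_def by measurable
  have I_diam: "\<bar>x - x'\<bar> \<le> e / 2" if "I x = I x'" for x x'
  proof -
    have "\<lfloor>2 * x / e\<rfloor> = \<lfloor>2 * x' / e\<rfloor>" using that unfolding I_def by simp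
    then have "\<bar>2 * x / e - 2 * x' / e\<bar> \<le> 1" by linarith
    then have "\<bar>2 * x - 2 * x'\<bar> \<le> e"
      using e by (simp add: diff_divide_distrib[symmetric] abs_divide)
    then show ?thesis by linarith
  qed
  obtain f where f: "barycentric_map \<mu> \<nu> f"
    and cells: "\<And>i j. measure \<nu> {y. I (f y) = i \<and> I y = j} = measure \<pi> {z. I (fst z) = i \<and> I (snd z) = j}"
    by (rule cellwise_map[OF I al]) (rule that; assumption)
  have [measurable]: "f \<in> borel_measurable borel" using f unfolding barycentric_map_def by blast
  define \<pi>' where "\<pi>' = distr \<nu> borel (\<lambda>y. (f y, y))"
  have f_pair [measurable]: "(\<lambda>y. (f y, y)) \<in> borel_measurable (borel :: real measure)"
    unfolding borel_prod[symmetric] by measurable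
  have "emeasure \<nu> (space \<nu>) = 1"
  proof -
    have "emeasure \<nu> UNIV = emeasure \<pi> UNIV"
      unfolding distr_snd[symmetric] by (subst emeasure_distr) auto
    then show ?thesis using emeasure_space_1 by simp
  qed
  then interpret N: prob_space \<nu> by (rule prob_spaceI)
  interpret p': prob_space \<pi>' unfolding \<pi>'_def by (rule N.prob_space_distr) simp
  have "martingale_coupling \<pi>' \<mu> \<nu>"
  proof (intro martingale_coupling.intro martingale_coupling_axioms.intro p'.prob_space_axioms)
    show "sets \<pi>' = sets borel" unfolding \<pi>'_def by simp
    show "distr \<pi>' borel fst = \<mu>"
      unfolding \<pi>'_def using f unfolding barycentric_map_def by (subst distr_distr) (auto simp: comp_def)
    show "distr \<pi>' borel snd = \<nu>"
      unfolding \<pi>'_def by (subst distr_distr) (auto simp: comp_def distr_id2)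
    show "first_moment_measure \<mu>" "first_moment_measure \<nu>" by (rule first_moment_fst first_moment_snd)+
    fix B :: "real set" assume B [measurable]: "B \<in> sets borel"
    have "(\<integral>z. indicator B (fst z) * snd z \<partial>\<pi>') = (\<integral>y. indicator B (f y) * y \<partial>\<nu>)"
      unfolding \<pi>'_def by (subst integral_distr) auto
    also have "\<dots> = (\<integral>x. indicator B x * x \<partial>\<mu>)" using f B unfolding barycentric_map_def by blast
    also have "\<dots> = (\<integral>x. indicator B x * x \<partial>distr \<nu> borel f)" using f unfolding barycentric_map_def by simp
    also have "\<dots> = (\<integral>y. indicator B (f y) * f y \<partial>\<nu>)" by (subst integral_distr) auto
    also have "\<dots> = (\<integral>z. indicator B (fst z) * fst z \<partial>\<pi>')"
      unfolding \<pi>'_def by (subst integral_distr) auto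
    finally show "(\<integral>z. indicator B (fst z) * snd z \<partial>\<pi>') = (\<integral>z. indicator B (fst z) * fst z \<partial>\<pi>')" .
  qed
  then have "\<pi>' \<in> backward_Monge_martingale_transports \<mu> \<nu>"
    unfolding backward_Monge_martingale_transports_def
    using martingale_transports_iff[OF first_moment_fst first_moment_snd] \<pi>'_def by auto
  moreover define D where "D z = prod_encode (I (fst z), I (snd z))" for z
  have "same_cells \<pi> \<pi>' D e"
  proof
    show "\<pi> \<in> borel_probs" "\<pi>' \<in> borel_probs"
      unfolding borel_probs_def using prob_space_axioms p'.prob_space_axioms by (auto simp: \<pi>'_def)
    show D: "D \<in> measurable borel (count_space UNIV)"
    proof (subst measurable_count_space_eq2_countable, intro conjI ballI)
      fix n :: nat
      obtain i j where n: "n = prod_encode (i, j)" by (metis prod_decode_inverse surj_pair)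
      have "D -` {n} \<inter> space borel = fst -` {x. I x = i} \<inter> snd -` {y. I y = j}"
        unfolding D_def n by (simp add: set_eq_iff)
      then show "D -` {n} \<inter> space borel \<in> sets borel" by simp
    qed auto
    show "emeasure \<pi> {z. D z = n} = emeasure \<pi>' {z. D z = n}" for n
    proof -
      obtain i j where n: "n = prod_encode (i, j)" by (metis prod_decode_inverse surj_pair)
      have eq: "{z. D z = n} = {z. I (fst z) = i \<and> I (snd z) = j}" unfolding D_def n by auto
      have "{z. D z = n} \<in> sets borel" using measurable_sets[OF D, of "{n}"] by (simp add: vimage_def)
      then have "measure \<pi>' {z. D z = n} = measure \<nu> {y. I (f y) = i \<and> I y = j}"
        unfolding \<pi>'_def eq by (subst measure_distr) (auto simp: vimage_def)
      then show ?thesis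
        unfolding emeasure_eq_measure p'.emeasure_eq_measure using cells[of i j] unfolding eq by simp
    qed
    show "dist z z' \<le> e" if "D z = D z'" for z z'
    proof -
      have "dist z z' \<le> \<bar>fst z - fst z'\<bar> + \<bar>snd z - snd z'\<bar>"
        using sqrt_sum_squares_le_sum_abs[of "fst z - fst z'" "snd z - snd z'"]
        unfolding dist_prod_def dist_real_def by simp
      also have "\<dots> \<le> e / 2 + e / 2" using that unfolding D_def by (intro add_mono I_diam) auto
      finally show ?thesis by simp
    qed
  qed
  ultimately show ?thesis by (rule that)
qed

theorem theorem2p3:
  fixes \<mu> \<nu> :: "real measure"
  assumes "\<mu> \<in> finite_moment_measures" and "\<nu> \<in> finite_moment_measures"
    and "\<mu> \<le>cx \<nu>" and "atomless \<nu>"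
  shows "(subtopology weak_topology (martingale_transports \<mu> \<nu>)) closure_of
             (backward_Monge_martingale_transports \<mu> \<nu>) = martingale_transports \<mu> \<nu>
         \<and> (discrete_measure \<mu> \<longrightarrow>
             (\<forall>\<pi> \<in> martingale_transports \<mu> \<nu>. \<forall>\<epsilon>::real. \<epsilon> > 0 \<longrightarrow>
                (\<exists>\<pi>' \<in> backward_Monge_martingale_transports \<mu> \<nu>.
                   Wasserstein_infty \<pi> \<pi>' \<le> ereal \<epsilon>)))"
proof -
  let ?M = "martingale_transports \<mu> \<nu>" and ?B = "backward_Monge_martingale_transports \<mu> \<nu>"
  have fm: "first_moment_measure \<kappa>" if "\<kappa> \<in> finite_moment_measures" for \<kappa>
    using that unfolding finite_moment_measures_def first_moment_measure_def finite_borel_measure_def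
      first_moment_measure_axioms_def finite_borel_measure_axioms_def
    by (auto intro: prob_space.finite_measure)
  have coupling: "martingale_coupling \<pi> \<mu> \<nu>" if "\<pi> \<in> ?M" for \<pi>
    using that martingale_transports_iff[OF fm[OF assms(1)] fm[OF assms(2)]] by blast
  have approx: "\<exists>\<pi>' D. \<pi>' \<in> ?B \<and> same_cells \<pi> \<pi>' D e" if "\<pi> \<in> ?M" "0 < e" for \<pi> e
    by (rule martingale_coupling.backward_Monge_cells[OF coupling[OF that(1)] assms(4) that(2)]) blast
  have BM: "?B \<subseteq> ?M" unfolding backward_Monge_martingale_transports_def by blast
  have M_probs: "?M \<subseteq> borel_probs" unfolding martingale_transports_def by blast
  \<comment> \<open>\<open>closure_of\<close> stays inside the topspace, which must therefore
    contain all transports; the zero function with U = UNIV already yields all of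
    \<open>borel_probs\<close>.\<close>
  have top: "topspace (weak_topology :: (real \<times> real) measure topology) = borel_probs"
  proof
    show "topspace (weak_topology :: (real \<times> real) measure topology) \<subseteq> borel_probs"
      unfolding weak_topology_def by auto
    have "{\<pi> \<in> borel_probs. (\<integral>z. (\<lambda>_. 0) z \<partial>\<pi>) \<in> (UNIV :: real set)} \<in>
      {{\<pi> \<in> borel_probs. (\<integral>z. \<phi> z \<partial>\<pi>) \<in> U} | (\<phi> :: real \<times> real \<Rightarrow> real) U.
        continuous_on UNIV \<phi> \<and> bounded (range \<phi>) \<and> open U}"
      by (intro CollectI exI[of _ "\<lambda>_. 0"] exI[of _ UNIV]) auto
    then show "borel_probs \<subseteq> topspace (weak_topology :: (real \<times> real) measure topology)"
      unfolding weak_topology_def topology_generated_by_topspace by blast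
  qed
  have "\<pi> \<in> subtopology weak_topology ?M closure_of ?B" if \<pi>: "\<pi> \<in> ?M" for \<pi>
    unfolding in_closure_of
  proof (intro conjI allI impI)
    show "\<pi> \<in> topspace (subtopology weak_topology ?M)"
      using \<pi> M_probs by (auto simp: top)
    fix T assume "\<pi> \<in> T \<and> openin (subtopology weak_topology ?M) T"
    then obtain T' where T': "openin weak_topology T'" "\<pi> \<in> T'" "T = T' \<inter> ?M"
      unfolding openin_subtopology by blast
    have "\<exists>\<pi>' D. \<forall>n. \<pi>' n \<in> ?B \<and> same_cells \<pi> (\<pi>' n) (D n) (1 / real (Suc n))"
      using approx[OF \<pi>] by (subst choice_iff[symmetric])+ simp
    then obtain \<pi>' D where B: "\<And>n. \<pi>' n \<in> ?B"
      and cells: "\<And>n. same_cells \<pi> (\<pi>' n) (D n) (1 / real (Suc n))" by blast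
    have "\<exists>n. \<pi>' n \<in> T'"
    proof (rule weak_limit_meets_open[OF B _ _ _ T'(1,2)])
      show "?B \<subseteq> borel_probs" "\<pi> \<in> borel_probs" using BM M_probs \<pi> by auto
      show "(\<lambda>n. \<integral>z. \<phi> z \<partial>\<pi>' n) \<longlonglongrightarrow> (\<integral>z. \<phi> z \<partial>\<pi>)"
        if "continuous_on UNIV \<phi>" "bounded (range \<phi>)" for \<phi> :: "real \<times> real \<Rightarrow> real"
        using cells LIMSEQ_Suc[OF lim_1_over_n] that by (rule integral_tendsto_same_cells)
    qed
    then show "\<exists>\<pi>'. \<pi>' \<in> ?B \<and> \<pi>' \<in> T" using B BM T'(3) by blast
  qed
  moreover have "subtopology weak_topology ?M closure_of ?B \<subseteq> ?M"
    using closure_of_subset_topspace[of "subtopology weak_topology ?M" ?B] by auto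
  ultimately have "subtopology weak_topology ?M closure_of ?B = ?M" by blast
  moreover have "\<exists>\<pi>'\<in>?B. Wasserstein_infty \<pi> \<pi>' \<le> ereal \<epsilon>" if "\<pi> \<in> ?M" "\<epsilon> > 0" for \<pi> \<epsilon>
    using approx[OF that] same_cells.Wasserstein_infty_le by blast
  ultimately show ?thesis by blast
qed

end
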